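(* Let $\mathfrak{g}$ be a finite-dimensional complex reductive Lie algebra and let $\mathfrak{g}=\mathfrak{s}_1\oplus\cdots\oplus\mathfrak{s}_\ell\oplus\mathbb{C}^k$ be its decomposition into simple ideals $\mathfrak{s}_1,\dots,\mathfrak{s}_\ell$ and center $\mathbb{C}^k$ (with $\ell,k\ge 0$). Then $$\mu(\mathfrak{g})=\mu(\mathfrak{s}_1)+\cdots+\mu(\mathfrak{s}_\ell)+\mu(\mathbb{C}^{k-\ell}),$$ where $\mu(\mathbb{C}^{k-\ell})=\lceil 2\sqrt{k-\ell-1}\,\rceil$ if $k-\ell>1$, $\mu(\mathbb{C}^{k-\ell})=1$ if $k-\ell=1$, and $\mu(\mathbb{C}^{k-\ell})=0$ if $k-\ell\le 0$.
   Context: For a finite-dimensional Lie algebra $\mathfrak{g}$ over a field $K$, $\mu(\mathfrak{g})$ denotes the minimal dimension of a faithful linear representation of $\mathfrak{g}$ over $K$. $\mathbb{C}^k$ denotes the $k$-dimensional abelian complex Lie algebra. For $k-\ell\le 0$ the symbol $\mu(\mathbb{C}^{k-\ell})$ is by convention $0$. *)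

theory Defs
  imports
    Complex_Main
    "HOL-Library.FuncSet"
    "HOL-Library.Function_Algebras"
    "Jordan_Normal_Form.Matrix"
begin

text \<open>
  A Lie algebra is carried by a linear subspace \<open>L\<close> of an ambient vector space, so that ideals
  and centers of \<open>L\<close> are again Lie algebras for the same scalar multiplication and bracket.
  Taking \<open>L = UNIV\<close> is allowed. The bracket is only constrained on \<open>L\<close>.
\<close>

locale lie_algebra = vector_space scale
  for scale :: "'k::field \<Rightarrow> 'a::ab_group_add \<Rightarrow> 'a" +
  fixes bracket :: "'a \<Rightarrow> 'a \<Rightarrow> 'a" and L :: "'a set"
  assumes subspace_carrier: "subspace L"
    and bracket_closed: "\<lbrakk>x \<in> L; y \<in> L\<rbrakk> \<Longrightarrow> bracket x y \<in> L"
    and bracket_add_left: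
      "\<lbrakk>x \<in> L; y \<in> L; z \<in> L\<rbrakk> \<Longrightarrow> bracket (x + y) z = bracket x z + bracket y z"
    and bracket_add_right:
      "\<lbrakk>x \<in> L; y \<in> L; z \<in> L\<rbrakk> \<Longrightarrow> bracket x (y + z) = bracket x y + bracket x z"
    and bracket_scale_left:
      "\<lbrakk>x \<in> L; y \<in> L\<rbrakk> \<Longrightarrow> bracket (scale c x) y = scale c (bracket x y)"
    and bracket_scale_right:
      "\<lbrakk>x \<in> L; y \<in> L\<rbrakk> \<Longrightarrow> bracket x (scale c y) = scale c (bracket x y)"
    and bracket_self: "x \<in> L \<Longrightarrow> bracket x x = 0"
    and jacobi: "\<lbrakk>x \<in> L; y \<in> L; z \<in> L\<rbrakk> \<Longrightarrow>
      bracket x (bracket y z) + bracket y (bracket z x) + bracket z (bracket x y) = 0"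

definition finite_dim :: "('k::field \<Rightarrow> 'a::ab_group_add \<Rightarrow> 'a) \<Rightarrow> 'a set \<Rightarrow> bool" where
  "finite_dim scale L \<longleftrightarrow> (\<exists>B. finite B \<and> L = Modules.module.span scale B)"

definition lie_ideal ::
    "('k::field \<Rightarrow> 'a::ab_group_add \<Rightarrow> 'a) \<Rightarrow> ('a \<Rightarrow> 'a \<Rightarrow> 'a) \<Rightarrow> 'a set \<Rightarrow> 'a set \<Rightarrow> bool" where
  "lie_ideal scale bracket L I \<longleftrightarrow>
     Modules.module.subspace scale I \<and> I \<subseteq> L \<and> (\<forall>x\<in>L. \<forall>y\<in>I. bracket x y \<in> I)"

definition lie_abelian :: "('a::zero \<Rightarrow> 'a \<Rightarrow> 'a) \<Rightarrow> 'a set \<Rightarrow> bool" where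
  "lie_abelian bracket L \<longleftrightarrow> (\<forall>x\<in>L. \<forall>y\<in>L. bracket x y = 0)"

definition lie_center :: "('a::zero \<Rightarrow> 'a \<Rightarrow> 'a) \<Rightarrow> 'a set \<Rightarrow> 'a set" where
  "lie_center bracket L = {x \<in> L. \<forall>y\<in>L. bracket x y = 0}"

definition lie_simple ::
    "('k::field \<Rightarrow> 'a::ab_group_add \<Rightarrow> 'a) \<Rightarrow> ('a \<Rightarrow> 'a \<Rightarrow> 'a) \<Rightarrow> 'a set \<Rightarrow> bool" where
  "lie_simple scale bracket L \<longleftrightarrow>
     \<not> lie_abelian bracket L \<and> (\<forall>I. lie_ideal scale bracket L I \<longrightarrow> I = {0} \<or> I = L)"

primrec derived_series ::
    "('k::field \<Rightarrow> 'a::ab_group_add \<Rightarrow> 'a) \<Rightarrow> ('a \<Rightarrow> 'a \<Rightarrow> 'a) \<Rightarrow> 'a set \<Rightarrow> nat \<Rightarrow> 'a set" where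
  "derived_series scale bracket L 0 = L"
| "derived_series scale bracket L (Suc n) =
     Modules.module.span scale
       {bracket x y | x y. x \<in> derived_series scale bracket L n \<and>
                           y \<in> derived_series scale bracket L n}"

definition lie_solvable ::
    "('k::field \<Rightarrow> 'a::ab_group_add \<Rightarrow> 'a) \<Rightarrow> ('a \<Rightarrow> 'a \<Rightarrow> 'a) \<Rightarrow> 'a set \<Rightarrow> bool" where
  "lie_solvable scale bracket L \<longleftrightarrow> (\<exists>n. derived_series scale bracket L n = {0})"

text \<open>The sum of all solvable ideals; in finite dimension, the largest solvable ideal.\<close>

definition lie_radical ::
    "('k::field \<Rightarrow> 'a::ab_group_add \<Rightarrow> 'a) \<Rightarrow> ('a \<Rightarrow> 'a \<Rightarrow> 'a) \<Rightarrow> 'a set \<Rightarrow> 'a set" where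
  "lie_radical scale bracket L =
     Modules.module.span scale
       (\<Union>{I. lie_ideal scale bracket L I \<and> lie_solvable scale bracket I})"

definition lie_reductive ::
    "('k::field \<Rightarrow> 'a::ab_group_add \<Rightarrow> 'a) \<Rightarrow> ('a \<Rightarrow> 'a \<Rightarrow> 'a) \<Rightarrow> 'a set \<Rightarrow> bool" where
  "lie_reductive scale bracket L \<longleftrightarrow> lie_radical scale bracket L = lie_center bracket L"

text \<open>
  Internal direct sum \<open>L = V\<^sub>1 \<oplus> \<dots> \<oplus> V\<^sub>l \<oplus> Z\<close>: every element of \<open>L\<close> has exactly one
  decomposition into components. For ideals the brackets between distinct summands then
  vanish automatically, since they lie in the intersection of the two summands.
\<close>

definition internal_direct_sum ::
    "'a::comm_monoid_add set \<Rightarrow> nat \<Rightarrow> (nat \<Rightarrow> 'a set) \<Rightarrow> 'a set \<Rightarrow> bool" where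
  "internal_direct_sum L l V Z \<longleftrightarrow>
     bij_betw (\<lambda>(v, z). (\<Sum>i = 1..l. v i) + z) ((\<Pi>\<^sub>E i\<in>{1..l}. V i) \<times> Z) L"

text \<open>
  A representation of dimension \<open>n\<close> is a homomorphism of Lie algebras into \<open>gl\<^sub>n\<close>, the
  \<open>n \<times> n\<close> matrices with the commutator bracket; \<open>n = 0\<close> is allowed.
\<close>

definition lie_representation ::
    "('k::field \<Rightarrow> 'a::ab_group_add \<Rightarrow> 'a) \<Rightarrow> ('a \<Rightarrow> 'a \<Rightarrow> 'a) \<Rightarrow> 'a set \<Rightarrow> nat \<Rightarrow> ('a \<Rightarrow> 'k mat) \<Rightarrow> bool"
  where
  "lie_representation scale bracket L n \<rho> \<longleftrightarrow>
     (\<forall>x\<in>L. \<rho> x \<in> carrier_mat n n) \<and>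
     (\<forall>x\<in>L. \<forall>y\<in>L. \<rho> (x + y) = \<rho> x + \<rho> y) \<and>
     (\<forall>c. \<forall>x\<in>L. \<rho> (scale c x) = c \<cdot>\<^sub>m \<rho> x) \<and>
     (\<forall>x\<in>L. \<forall>y\<in>L. \<rho> (bracket x y) = \<rho> x * \<rho> y - \<rho> y * \<rho> x)"

definition faithful_representation ::
    "('k::field \<Rightarrow> 'a::ab_group_add \<Rightarrow> 'a) \<Rightarrow> ('a \<Rightarrow> 'a \<Rightarrow> 'a) \<Rightarrow> 'a set \<Rightarrow> nat \<Rightarrow> ('a \<Rightarrow> 'k mat) \<Rightarrow> bool"
  where
  "faithful_representation scale bracket L n \<rho> \<longleftrightarrow>
     lie_representation scale bracket L n \<rho> \<and> inj_on \<rho> L"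

text \<open>
  For finite-dimensional \<open>L\<close> a faithful representation exists by the theorems of Ado and
  Iwasawa, so the minimum is taken over a nonempty set.
\<close>

definition lie_mu ::
    "('k::field \<Rightarrow> 'a::ab_group_add \<Rightarrow> 'a) \<Rightarrow> ('a \<Rightarrow> 'a \<Rightarrow> 'a) \<Rightarrow> 'a set \<Rightarrow> nat" where
  "lie_mu scale bracket L = (LEAST n. \<exists>\<rho>. faithful_representation scale bracket L n \<rho>)"

text \<open>The abelian Lie algebra \<open>K\<^sup>m\<close>, as the space of sequences supported on \<open>{..<m}\<close>.\<close>

definition coord_space :: "nat \<Rightarrow> (nat \<Rightarrow> 'k::field) set" where
  "coord_space m = {v. \<forall>i\<ge>m. v i = 0}"

definition coord_scale :: "'k::field \<Rightarrow> (nat \<Rightarrow> 'k) \<Rightarrow> nat \<Rightarrow> 'k" where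
  "coord_scale c v = (\<lambda>i. c * v i)"

definition zero_bracket :: "'a::zero \<Rightarrow> 'a \<Rightarrow> 'a" where
  "zero_bracket x y = 0"

lemma vector_space_coord_scale: "vector_space coord_scale"
  by unfold_locales (auto simp: coord_scale_def fun_eq_iff algebra_simps)

lemma lie_algebra_coord_space: "lie_algebra coord_scale zero_bracket (coord_space m)"
proof -
  interpret vector_space coord_scale by (rule vector_space_coord_scale)
  show ?thesis
    by unfold_locales
      (auto simp: subspace_def coord_space_def zero_bracket_def coord_scale_def)
qed

text \<open>
  \<open>mu_complex_abelian m\<close> is \<open>\<mu>(\<complex>\<^sup>m)\<close>, with the convention that it is \<open>0\<close> for every integer
  \<open>m \<le> 0\<close>.
\<close>

definition mu_complex_abelian :: "int \<Rightarrow> nat" where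
  "mu_complex_abelian m =
     (if m \<le> 0 then 0
      else lie_mu coord_scale zero_bracket (coord_space (nat m) :: (nat \<Rightarrow> complex) set))"

end

theory Submission
  imports Defs "HOL-Computational_Algebra.Fundamental_Theorem_Algebra"
begin

text \<open>
  For the upper bound, add to a minimal representation of each simple ideal one linear form on the
  center as a scalar; traces show that the sum is still faithful on \<open>s\<^sub>i \<oplus> \<complex>\<close>. The remaining
  \<open>k - l\<close> central dimensions act by scalars plus an off-diagonal block.

  The lower bound avoids complete reducibility. Given a simple ideal \<open>S\<close> acting nontrivially on
  \<open>V\<close>, let \<open>R\<close> be the commutant of all the other operators. A subquotient of \<open>V\<close> irreducible over
  \<open>R\<close> and nontrivial over \<open>S\<close> has dimension \<open>d \<ge> \<mu>(S)\<close>, and decomposing the identity into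
  idempotents of \<open>R\<close> that are primitive on it gives subspaces \<open>E = e V\<close> and \<open>E' = g V\<close>, stable under
  the other operators, with \<open>dim V \<ge> d dim E + dim E'\<close>, on whose sum these operators still act
  faithfully. Induction on the number of simple ideals reduces to Schur's bound: a commuting space
  of operators on \<open>\<complex>\<^sup>n\<close> has dimension at most \<open>n\<^sup>2 div 4 + 1\<close>.
\<close>

section \<open>Finite-dimensional subspaces\<close>

text \<open>If \<open>V\<close> is completely reducible over a simple ideal, it is a sum of tensor
  products of irreducible modules with multiplicity spaces, and the other operators act on the
  latter. The commutant replaces this picture: its idempotents of rank one on a fixed irreducible
  subquotient have images that play the part of the multiplicity space, and an operator that
  vanishes on the smallest of them, \<open>E\<close>, vanishes on all. The last idempotent
  \<open>g\<close> is zero on the subquotient; its image \<open>E'\<close> keeps whatever else the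
  other operators see.

  The obstacle is that the centre need not act semisimply and that each simple ideal may absorb one
  central dimension as a scalar. The accounting rests on \<open>\<mu>(S) \<ge> 2\<close>. If
  \<open>dim E \<ge> 2\<close>, then \<open>(\<mu>(S) - 1) (dim E - 1) \<ge> 1\<close>, so passing
  to \<open>E + E'\<close> frees \<open>\<mu>(S)\<close> dimensions at no cost to the centre. If
  \<open>dim E = 1\<close>, passing to \<open>E'\<close> frees them as well but costs one central
  dimension. Over \<open>l\<close> ideals at most \<open>l\<close> central dimensions are lost,
  which is where \<open>k - l\<close> comes from.\<close>

definition sub_sum :: "'b::plus set \<Rightarrow> 'b set \<Rightarrow> 'b set" where
  "sub_sum A B = {x + y |x y. x \<in> A \<and> y \<in> B}"

text \<open>Operators are total functions that are linear only on \<open>S\<close>. The same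
  function then serves on every stable subspace, and equality of operators is always stated
  pointwise on the space in question.\<close>

definition endo :: "('k \<Rightarrow> 'b::plus \<Rightarrow> 'b) \<Rightarrow> 'b set \<Rightarrow> ('b \<Rightarrow> 'b) \<Rightarrow> bool" where
  "endo scale S f \<longleftrightarrow> f ` S \<subseteq> S \<and> (\<forall>x\<in>S. \<forall>y\<in>S. f (x + y) = f x + f y) \<and>
     (\<forall>c. \<forall>x\<in>S. f (scale c x) = scale c (f x))"

definition functional_on :: "('k::{plus,times} \<Rightarrow> 'b::plus \<Rightarrow> 'b) \<Rightarrow> 'b set \<Rightarrow> ('b \<Rightarrow> 'k::{plus,times}) \<Rightarrow> bool" where
  "functional_on scale S f \<longleftrightarrow> (\<forall>x\<in>S. \<forall>y\<in>S. f (x + y) = f x + f y) \<and>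
     (\<forall>c. \<forall>x\<in>S. f (scale c x) = c * f x)"

lemma functional_on_add: "functional_on scale S f \<Longrightarrow> x \<in> S \<Longrightarrow> y \<in> S \<Longrightarrow> f (x + y) = f x + f y"
  and functional_on_scale: "functional_on scale S f \<Longrightarrow> x \<in> S \<Longrightarrow> f (scale c x) = c * f x"
  unfolding functional_on_def by auto

lemma endo_mem: "endo scale S f \<Longrightarrow> x \<in> S \<Longrightarrow> f x \<in> S"
  and endo_add: "endo scale S f \<Longrightarrow> x \<in> S \<Longrightarrow> y \<in> S \<Longrightarrow> f (x + y) = f x + f y"
  and endo_scale: "endo scale S f \<Longrightarrow> x \<in> S \<Longrightarrow> f (scale c x) = scale c (f x)"
  unfolding endo_def by auto

context vector_space
begin

lemma functional_on_zero:
  assumes "functional_on scale S f" "subspace S" shows "f 0 = 0"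
  using functional_on_scale[OF assms(1) subspace_0[OF assms(2)], of 0] by simp

lemma functional_on_diff:
  assumes "functional_on scale S f" "subspace S" "x \<in> S" "y \<in> S"
  shows "f (x - y) = f x - f y"
  using functional_on_add[OF assms(1,3) subspace_neg[OF assms(2,4)]]
    functional_on_scale[OF assms(1,4), of "-1"] by simp

lemma functional_on_sum:
  assumes "functional_on scale S f" "subspace S" "\<And>i. i \<in> I \<Longrightarrow> x i \<in> S"
  shows "f (sum x I) = (\<Sum>i\<in>I. f (x i))"
  using assms(3)
proof (induction I rule: infinite_finite_induct)
  case (insert i I)
  then have "sum x I \<in> S" using subspace_sum[OF assms(2), of I x] by auto
  then show ?case using insert functional_on_add[OF assms(1)] by simp
qed (use functional_on_zero[OF assms(1,2)] in auto)

lemma endo_zero: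
  assumes "endo scale S f" "subspace S" shows "f 0 = 0"
  using endo_scale[OF assms(1) subspace_0[OF assms(2)], of 0] by simp

lemma endo_diff:
  assumes "endo scale S f" "subspace S" "x \<in> S" "y \<in> S"
  shows "f (x - y) = f x - f y"
  using endo_add[OF assms(1,3) subspace_neg[OF assms(2,4)]]
    endo_scale[OF assms(1,4), of "-1"] by simp

lemma endo_sum:
  assumes "endo scale S f" "subspace S" "\<And>i. i \<in> I \<Longrightarrow> x i \<in> S"
  shows "f (sum x I) = (\<Sum>i\<in>I. f (x i))"
  using assms(3)
proof (induction I rule: infinite_finite_induct)
  case (insert i I)
  then have "sum x I \<in> S" using subspace_sum[OF assms(2), of I x] by auto
  then show ?case using insert endo_add[OF assms(1)] by simp
qed (use endo_zero[OF assms(1,2)] in auto)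

lemma finite_dim_basis:
  assumes "finite_dim scale S"
  obtains B where "finite B" "independent B" "span B = S" "card B = dim S" "B \<subseteq> S"
proof -
  obtain A where A: "finite A" "S = span A"
    using assms unfolding finite_dim_def by auto
  obtain B where B: "B \<subseteq> S" "independent B" "S \<subseteq> span B" "card B = dim S"
    using basis_exists[of S] by blast
  have "finite B"
    using independent_span_bound[OF A(1) B(2)] B(1) A(2) by auto
  moreover have "span B = S"
    using B span_minimal[OF B(1)] A(2) by auto
  ultimately show thesis using B that by blast
qed

lemma finite_dim_subspace: "finite_dim scale S \<Longrightarrow> subspace S"
  unfolding finite_dim_def by auto

lemma finite_dim_subset:
  assumes "finite_dim scale S" "subspace T" "T \<subseteq> S"
  shows "finite_dim scale T"
proof -
  obtain A where A: "finite A" "S = span A"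
    using assms unfolding finite_dim_def by auto
  obtain B where B: "B \<subseteq> T" "independent B" "T \<subseteq> span B" "card B = dim T"
    using basis_exists[of T] by blast
  have "finite B"
    using independent_span_bound[OF A(1) B(2)] B(1) A(2) assms(3) by auto
  moreover have "span B = T"
    using B span_minimal[OF B(1)] assms(2) by auto
  ultimately show ?thesis unfolding finite_dim_def by auto
qed

lemma independent_card_le_dim_finite_dim:
  assumes "finite_dim scale S" "independent B" "B \<subseteq> S"
  shows "finite B \<and> card B \<le> dim S"
proof -
  obtain A where "finite A" "independent A" "span A = S" "card A = dim S"
    using finite_dim_basis[OF assms(1)] by blast
  then show ?thesis using independent_span_bound[of A B] assms by auto
qed

lemma finite_dim_extend_basis:
  assumes "finite_dim scale S" "independent B" "B \<subseteq> S"
  obtains C where "finite C" "B \<inter> C = {}" "C \<subseteq> S" "independent (B \<union> C)" "span (B \<union> C) = S"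
    "dim S = card B + card C"
proof -
  obtain A where A: "B \<subseteq> A" "A \<subseteq> S" "independent A" "S \<subseteq> span A"
    using maximal_independent_subset_extend[OF assms(3,2)] by blast
  have sA: "span A = S"
    using A(2,4) span_minimal[OF A(2)] finite_dim_subspace[OF assms(1)] by auto
  have fA: "finite A"
    using independent_card_le_dim_finite_dim[OF assms(1) A(3,2)] by auto
  have "card A = card B + card (A - B)"
    using fA A(1) by (metis card_mono card_Diff_subset finite_subset le_add_diff_inverse)
  moreover have "dim S = card A"
    using dim_span_eq_card_independent[OF A(3)] sA by simp
  moreover have "B \<union> (A - B) = A" using A(1) by blast
  ultimately show thesis
    using that[of "A - B"] A fA sA by auto
qed

lemma dim_mono_finite_dim:
  assumes "finite_dim scale S" "subspace T" "T \<subseteq> S"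
  shows "dim T \<le> dim S"
proof -
  obtain B where "finite B" "independent B" "span B = T" "card B = dim T" "B \<subseteq> T"
    using finite_dim_basis[OF finite_dim_subset[OF assms]] by blast
  then show ?thesis
    using independent_card_le_dim_finite_dim[OF assms(1), of B] assms by auto
qed

lemma finite_dim_eqI:
  assumes "finite_dim scale S" "subspace T" "T \<subseteq> S" "dim S \<le> dim T"
  shows "T = S"
proof -
  obtain B where B: "finite B" "independent B" "span B = T" "card B = dim T" "B \<subseteq> T"
    using finite_dim_basis[OF finite_dim_subset[OF assms(1-3)]] by blast
  have "B \<subseteq> S" using B(5) assms(3) by auto
  then obtain C where C: "finite C" "span (B \<union> C) = S" "dim S = card B + card C"
    using finite_dim_extend_basis[OF assms(1) B(2)] by metis
  then have "C = {}" using assms(4) B(4) by auto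
  then show ?thesis using C B by auto
qed

lemma dim_zero_singleton: "dim {0} = 0"
  using dim_span_eq_card_independent[OF independent_empty] by simp

lemma dim_pos_iff:
  assumes "finite_dim scale S"
  shows "0 < dim S \<longleftrightarrow> S \<noteq> {0}"
proof -
  have "{0} \<subseteq> S" using subspace_0[OF finite_dim_subspace[OF assms]] by simp
  then show ?thesis
    using finite_dim_eqI[OF assms subspace_single_0] dim_zero_singleton by auto
qed

lemma finite_dim_span: "finite A \<Longrightarrow> finite_dim scale (span A)"
  unfolding finite_dim_def by auto

lemma complement_exists:
  assumes "finite_dim scale S" "subspace T" "T \<subseteq> S"
  obtains C where "subspace C" "C \<subseteq> S" "T \<inter> C = {0}" "dim S = dim T + dim C"
proof -
  obtain B where B: "finite B" "independent B" "span B = T" "card B = dim T" "B \<subseteq> T"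
    using finite_dim_basis[OF finite_dim_subset[OF assms(1-3)]] by blast
  have "B \<subseteq> S" using B(5) assms(3) by auto
  then obtain C where C: "finite C" "B \<inter> C = {}" "C \<subseteq> S" "independent (B \<union> C)"
      "span (B \<union> C) = S" "dim S = card B + card C"
    using finite_dim_extend_basis[OF assms(1) B(2)] by metis
  have "x = 0" if x: "x \<in> span B" "x \<in> span C" for x
  proof -
    have 1: "representation (B \<union> C) x b = 0" if "b \<in> C" for b
    proof -
      have "representation (B \<union> C) x = representation B x"
        by (rule representation_extend[OF C(4) x(1)]) auto
      then show ?thesis using representation_ne_zero[of B x b] that C(2) by auto
    qed
    have 2: "representation (B \<union> C) x b = 0" if "b \<in> B" for b
    proof -
      have "representation (B \<union> C) x = representation C x"
        by (rule representation_extend[OF C(4) x(2)]) auto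
      then show ?thesis using representation_ne_zero[of C x b] that C(2) by auto
    qed
    have "x \<in> span (B \<union> C)" using x(1) span_mono[of B "B \<union> C"] by auto
    then have "x = (\<Sum>b\<in>B \<union> C. representation (B \<union> C) x b *s b)"
      using sum_representation_eq[OF C(4) _ _ subset_refl] B(1) C(1) by auto
    also have "\<dots> = 0" by (rule sum.neutral) (use 1 2 in auto)
    finally show ?thesis .
  qed
  then have "T \<inter> span C = {0}" using B(3) span_zero by blast
  moreover have "independent C" using C(4) independent_mono by blast
  then have "dim (span C) = card C" by (rule dim_span_eq_card_independent)
  moreover have "span C \<subseteq> S"
    using span_minimal[OF C(3)] finite_dim_subspace[OF assms(1)] by auto
  ultimately show thesis using that[of "span C"] C(6) B(4) by auto
qed

lemma sub_sumI: "x \<in> A \<Longrightarrow> y \<in> B \<Longrightarrow> x + y \<in> sub_sum A B"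
  unfolding sub_sum_def by auto

lemma subspace_sub_sum: "subspace A \<Longrightarrow> subspace B \<Longrightarrow> subspace (sub_sum A B)"
  unfolding sub_sum_def by (rule subspace_sums)

lemma sub_sum_superset:
  assumes "subspace A" "subspace B"
  shows "A \<subseteq> sub_sum A B" "B \<subseteq> sub_sum A B"
  using sub_sumI[of _ A 0 B] sub_sumI[of 0 A _ B] subspace_0[OF assms(1)] subspace_0[OF assms(2)]
  by auto

lemma sub_sum_minimal:
  "A \<subseteq> S \<Longrightarrow> B \<subseteq> S \<Longrightarrow> subspace S \<Longrightarrow> sub_sum A B \<subseteq> S"
  unfolding sub_sum_def using subspace_add by blast

lemma sub_sum_span: "sub_sum (span A) (span B) = span (A \<union> B)"
  unfolding sub_sum_def span_Un ..

lemma finite_dim_sub_sum: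
  assumes "finite_dim scale A" "finite_dim scale B"
  shows "finite_dim scale (sub_sum A B) \<and> dim (sub_sum A B) \<le> dim A + dim B"
proof -
  obtain X where X: "finite X" "span X = A" "card X = dim A"
    using finite_dim_basis[OF assms(1)] by metis
  obtain Y where Y: "finite Y" "span Y = B" "card Y = dim B"
    using finite_dim_basis[OF assms(2)] by metis
  have e: "sub_sum A B = span (X \<union> Y)" using sub_sum_span X Y by metis
  have "dim (sub_sum A B) \<le> card (X \<union> Y)"
    using dim_le_card[of "sub_sum A B" "X \<union> Y"] e X Y by auto
  also have "\<dots> \<le> dim A + dim B" using card_Un_le[of X Y] X Y by simp
  finally show ?thesis using e finite_dim_span[of "X \<union> Y"] X Y by auto
qed

text \<open>The last clause characterises \<open>p\<close> by uniqueness of the decomposition, and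
  linearity is read off from it. The same clause later shows that such a projection commutes with
  other operators.\<close>

lemma projection_exists:
  assumes "subspace S" "subspace A" "subspace B" "A \<subseteq> S" "A \<inter> B = {0}"
    "\<forall>x\<in>S. \<exists>a\<in>A. \<exists>b\<in>B. x = a + b"
  obtains p where "endo scale S p" "\<And>x. x \<in> S \<Longrightarrow> p x \<in> A" "\<And>x. x \<in> S \<Longrightarrow> x - p x \<in> B"
    "\<And>x a. x \<in> S \<Longrightarrow> a \<in> A \<Longrightarrow> x - a \<in> B \<Longrightarrow> p x = a"
proof -
  obtain p where p: "\<And>x. x \<in> S \<Longrightarrow> p x \<in> A \<and> x - p x \<in> B"
    using assms(6) by (metis add_diff_cancel_left')
  have uniq: "p x = a" if "x \<in> S" "a \<in> A" "x - a \<in> B" for x a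
  proof -
    have "(x - a) - (x - p x) \<in> B" using p that assms(3) subspace_diff by blast
    moreover have "p x - a \<in> A" using p that assms(2) subspace_diff by blast
    ultimately have "p x - a \<in> {0}" unfolding assms(5)[symmetric] by simp
    then show ?thesis by simp
  qed
  have add: "p (x + y) = p x + p y" if "x \<in> S" "y \<in> S" for x y
  proof (rule uniq)
    have "(x - p x) + (y - p y) \<in> B" using p that assms(3) subspace_add by blast
    then show "(x + y) - (p x + p y) \<in> B" by (simp add: algebra_simps)
  qed (use that p subspace_add[OF assms(1)] subspace_add[OF assms(2)] in auto)
  have scl: "p (a *s x) = a *s p x" if "x \<in> S" for a x
  proof (rule uniq)
    have "a *s (x - p x) \<in> B" using p that assms(3) subspace_scale by blast
    then show "(a *s x) - (a *s p x) \<in> B" by (simp add: scale_right_diff_distrib)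
  qed (use that p subspace_scale[OF assms(1)] subspace_scale[OF assms(2)] in auto)
  have "endo scale S p" unfolding endo_def using add scl p assms(4) by blast
  then show thesis using that p uniq by blast
qed

lemma finite_dim_maximal:
  assumes "finite_dim scale S" "P T0" "\<And>T. P T \<Longrightarrow> subspace T \<and> T \<subseteq> S"
  obtains T where "P T" "\<And>T'. P T' \<Longrightarrow> T \<subseteq> T' \<Longrightarrow> T' = T"
proof -
  have b: "\<forall>T. P T \<longrightarrow> dim T < Suc (dim S)"
    using assms dim_mono_finite_dim[OF assms(1)] by (simp add: le_imp_less_Suc)
  obtain T where T: "P T" "\<And>T'. P T' \<Longrightarrow> dim T' \<le> dim T"
    using ex_has_greatest_nat[of P T0 dim, OF assms(2) b] by blast
  have "T' = T" if T': "P T'" "T \<subseteq> T'" for T'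
  proof -
    have "finite_dim scale T'" using finite_dim_subset[OF assms(1)] assms(3)[OF T'(1)] by blast
    then have "T = T'" using finite_dim_eqI[of T' T] assms(3)[OF T(1)] T'(2) T(2)[OF T'(1)] by blast
    then show ?thesis ..
  qed
  then show thesis using that T by blast
qed

lemma finite_dim_minimal:
  assumes "P T0" "\<And>T. P T \<Longrightarrow> finite_dim scale T"
  obtains T where "P T" "\<And>T'. P T' \<Longrightarrow> T' \<subseteq> T \<Longrightarrow> T' = T"
proof -
  obtain T where T: "P T" "\<And>T'. P T' \<Longrightarrow> dim T \<le> dim T'"
    using ex_has_least_nat[of P T0 dim, OF assms(1)] by blast
  have "T' = T" if "P T'" "T' \<subseteq> T" for T'
    using finite_dim_eqI[OF assms(2)[OF T(1)] finite_dim_subspace[OF assms(2)[OF that(1)]] that(2)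
        T(2)[OF that(1)]] .
  then show thesis using that T by blast
qed

section \<open>Linear functionals and coordinates on a quotient\<close>

lemma dim_functional_kernel:
  assumes "finite_dim scale S" "functional_on scale S f"
  shows "subspace {x\<in>S. f x = 0} \<and> dim S \<le> dim {x\<in>S. f x = 0} + 1"
proof -
  let ?K = "{x\<in>S. f x = 0}"
  have sS: "subspace S" using assms(1) finite_dim_subspace by auto
  have f0: "f 0 = 0" using functional_on_zero[OF assms(2) sS] .
  have K: "subspace ?K"
    using assms(2) sS f0 unfolding functional_on_def subspace_def by auto
  obtain C where C: "subspace C" "C \<subseteq> S" "?K \<inter> C = {0}" "dim S = dim ?K + dim C"
    by (rule complement_exists[OF assms(1) K]) auto
  have "dim C \<le> 1"
  proof (cases "C = {0}")
    case True then show ?thesis using dim_zero_singleton by simp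
  next
    case False
    then obtain c where c: "c \<in> C" "c \<noteq> 0" using subspace_0[OF C(1)] by blast
    then have "c \<notin> ?K" using C(3) by blast
    then have fc: "f c \<noteq> 0" using C(2) c(1) by auto
    have "C \<subseteq> span {c}"
    proof
      fix x assume x: "x \<in> C"
      let ?y = "x - (f x / f c) *s c"
      have "?y \<in> C" using x c C(1) by (simp add: subspace_diff subspace_scale)
      moreover have "f ?y = f x - f ((f x / f c) *s c)"
        by (rule functional_on_diff[OF assms(2) sS]) (use x c C(2) subspace_scale[OF sS] in auto)
      then have "f ?y = 0"
        using functional_on_scale[OF assms(2), of c] c(1) C(2) fc by auto
      ultimately have "?y \<in> ?K \<inter> C" using C(2) by auto
      then have "?y = 0" unfolding C(3) by simp
      then show "x \<in> span {c}" by (simp add: span_singleton)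
    qed
    then show ?thesis using dim_le_card[of C "{c}"] by simp
  qed
  then show ?thesis using K C by simp
qed

text \<open>Each functional cuts the dimension by at most one, so intersecting the kernels one after
  the other arrives at \<open>{0}\<close>. The nilpotent case of Schur's bound applies this to
  matrix entries.\<close>

lemma dim_le_card_functionals:
  assumes "finite J" "finite_dim scale S" "\<And>j. j \<in> J \<Longrightarrow> functional_on scale S (\<phi> j)"
    "\<And>x. x \<in> S \<Longrightarrow> (\<And>j. j \<in> J \<Longrightarrow> \<phi> j x = 0) \<Longrightarrow> x = 0"
  shows "dim S \<le> card J"
  using assms
proof (induction J arbitrary: S rule: finite_induct)
  case empty
  then have "S = {0}" using subspace_0[OF finite_dim_subspace] by blast
  then show ?case using dim_zero_singleton by simp
next
  case (insert j J)
  let ?K = "{x\<in>S. \<phi> j x = 0}"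
  have K: "subspace ?K" "dim S \<le> dim ?K + 1"
    using dim_functional_kernel[OF insert(4), of "\<phi> j"] insert(5) by auto
  have "functional_on scale ?K (\<phi> i)" if "i \<in> J" for i
    using insert(5)[of i] that unfolding functional_on_def by auto
  moreover have "finite_dim scale ?K" using finite_dim_subset[OF insert(4) K(1)] by auto
  ultimately have "dim ?K \<le> card J" using insert(3)[of ?K] insert(6) by blast
  then show ?case using K insert by simp
qed

text \<open>Coordinates on \<open>S / T\<close> without a quotient type: the \<open>c i\<close>
  complete a basis of \<open>T\<close> to one of \<open>S\<close>, and the \<open>\<kappa> i\<close>
  are the matching coordinates, hence vanish on \<open>T\<close>. With \<open>T = {0}\<close> they
  are ordinary coordinates on \<open>S\<close>.\<close>

lemma quotient_coordinates:
  assumes "finite_dim scale S" "subspace T" "T \<subseteq> S"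
  obtains q :: nat and c \<kappa> where "q + dim T = dim S" "\<And>i. i < q \<Longrightarrow> c i \<in> S"
    "\<And>i. i < q \<Longrightarrow> functional_on scale S (\<kappa> i)" "\<And>i t. i < q \<Longrightarrow> t \<in> T \<Longrightarrow> \<kappa> i t = 0"
    "\<And>x. x \<in> S \<Longrightarrow> x - (\<Sum>i<q. \<kappa> i x *s c i) \<in> T"
proof -
  obtain B where B: "finite B" "independent B" "span B = T" "card B = dim T" "B \<subseteq> T"
    using finite_dim_basis[OF finite_dim_subset[OF assms(1-3)]] by blast
  have "B \<subseteq> S" using B(5) assms(3) by auto
  then obtain C where C: "finite C" "B \<inter> C = {}" "C \<subseteq> S" "independent (B \<union> C)"
      "span (B \<union> C) = S" "dim S = card B + card C"
    using finite_dim_extend_basis[OF assms(1) B(2)] by metis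
  obtain c where c: "bij_betw c {..<card C} C"
    using ex_bij_betw_nat_finite[OF C(1)] by (auto simp: atLeast0LessThan)
  define \<kappa> where "\<kappa> i x = representation (B \<union> C) x (c i)" for i x
  have ci: "c i \<in> C" if "i < card C" for i using c that bij_betwE by auto
  have 1: "functional_on scale S (\<kappa> i)" for i
    unfolding functional_on_def \<kappa>_def
    using representation_add[OF C(4)] representation_scale[OF C(4)] C(5) by auto
  have 2: "\<kappa> i t = 0" if "i < card C" "t \<in> T" for i t
  proof -
    have "representation (B \<union> C) t = representation B t"
      by (rule representation_extend[OF C(4)]) (use that B(3) in auto)
    then show ?thesis
      unfolding \<kappa>_def using representation_ne_zero[of B t "c i"] ci[OF that(1)] C(2) by auto
  qed
  have 3: "x - (\<Sum>i<card C. \<kappa> i x *s c i) \<in> T" if x: "x \<in> S" for x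
  proof -
    let ?r = "representation (B \<union> C) x"
    have "x = (\<Sum>b\<in>B \<union> C. ?r b *s b)"
      using sum_representation_eq[OF C(4) _ _ subset_refl] B(1) C(1,5) x by auto
    also have "\<dots> = (\<Sum>b\<in>B. ?r b *s b) + (\<Sum>b\<in>C. ?r b *s b)"
      by (rule sum.union_disjoint) (use B C in auto)
    also have "(\<Sum>b\<in>C. ?r b *s b) = (\<Sum>i<card C. \<kappa> i x *s c i)"
      unfolding \<kappa>_def by (rule sum.reindex_bij_betw[OF c, symmetric])
    finally have "x - (\<Sum>i<card C. \<kappa> i x *s c i) = (\<Sum>b\<in>B. ?r b *s b)"
      by (simp add: algebra_simps)
    also have "\<dots> \<in> T" using B(5) assms(2) by (intro subspace_sum subspace_scale) auto
    finally show ?thesis .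
  qed
  show thesis
  proof (rule that[of "card C" c \<kappa>])
    show "card C + dim T = dim S" using C(6) B(4) by simp
    show "c i \<in> S" if "i < card C" for i using ci[OF that] C(3) by auto
  qed (use 1 2 3 in auto)
qed

text \<open>Coordinates modulo \<open>A\<close> separate the points of \<open>B\<close>: a common
  zero lies in \<open>A\<close>, and \<open>B\<close> meets \<open>A\<close> only in
  \<open>0\<close>.\<close>

lemma dim_direct_le:
  assumes "finite_dim scale S" "subspace A" "subspace B" "A \<subseteq> S" "B \<subseteq> S" "A \<inter> B = {0}"
  shows "dim A + dim B \<le> dim S"
proof -
  obtain q c \<kappa> where q: "q + dim A = dim S" "\<And>i. i < q \<Longrightarrow> c i \<in> S"
      "\<And>i. i < q \<Longrightarrow> functional_on scale S (\<kappa> i)" "\<And>i t. i < q \<Longrightarrow> t \<in> A \<Longrightarrow> \<kappa> i t = 0"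
      "\<And>x. x \<in> S \<Longrightarrow> x - (\<Sum>i<q. \<kappa> i x *s c i) \<in> A"
    by (fact quotient_coordinates[OF assms(1,2,4)])
  have "dim B \<le> card {..<q}"
  proof (rule dim_le_card_functionals[OF _ finite_dim_subset[OF assms(1,3,5)], where \<phi> = \<kappa>])
    show "functional_on scale B (\<kappa> i)" if "i \<in> {..<q}" for i
      using functional_on_add[OF q(3)[of i]] functional_on_scale[OF q(3)[of i]] that subsetD[OF assms(5)]
      unfolding functional_on_def[of scale B] by auto
    fix x assume x: "x \<in> B" and "\<And>i. i \<in> {..<q} \<Longrightarrow> \<kappa> i x = 0"
    then have "x \<in> A" using q(5)[of x] assms(5) by auto
    then show "x = 0" using x assms(6) by auto
  qed simp
  then show ?thesis using q(1) by simp
qed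

end

section \<open>Fitting decomposition and eigenvectors\<close>

context vector_space
begin

lemma endo_id: "endo scale S (\<lambda>x. x)"
  unfolding endo_def by auto

lemma endo_comp: "endo scale S f \<Longrightarrow> endo scale S g \<Longrightarrow> endo scale S (\<lambda>x. f (g x))"
  unfolding endo_def by (auto simp: image_subset_iff)

lemma endo_funpow: "endo scale S f \<Longrightarrow> endo scale S (f ^^ n)"
  by (induction n) (auto simp: endo_def image_subset_iff)

lemma endo_plus:
  "subspace S \<Longrightarrow> endo scale S f \<Longrightarrow> endo scale S g \<Longrightarrow> endo scale S (\<lambda>x. f x + g x)"
  unfolding endo_def
  by (auto simp: image_subset_iff subspace_add algebra_simps scale_right_distrib)

lemma endo_smult:
  "subspace S \<Longrightarrow> endo scale S f \<Longrightarrow> endo scale S (\<lambda>x. c *s f x)"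
  unfolding endo_def
  by (auto simp: image_subset_iff subspace_scale scale_right_distrib scale_left_commute)

lemma endo_minus:
  "subspace S \<Longrightarrow> endo scale S f \<Longrightarrow> endo scale S g \<Longrightarrow> endo scale S (\<lambda>x. f x - g x)"
  unfolding endo_def
  by (auto simp: image_subset_iff subspace_diff algebra_simps scale_right_diff_distrib)

lemma endo_subset: "endo scale S f \<Longrightarrow> T \<subseteq> S \<Longrightarrow> f ` T \<subseteq> T \<Longrightarrow> endo scale T f"
  unfolding endo_def by blast

lemma subspace_endo_image:
  assumes "endo scale S f" "subspace T" "T \<subseteq> S" shows "subspace (f ` T)"
proof (rule subspaceI)
  show "0 \<in> f ` T"
  proof
    show "0 \<in> T" using subspace_0[OF assms(2)] .
    then show "0 = f 0" using endo_scale[OF assms(1), of 0 0] assms(3) by auto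
  qed
next
  fix x y assume "x \<in> f ` T" "y \<in> f ` T"
  then obtain a b where "x = f a" "y = f b" "a \<in> T" "b \<in> T" by auto
  then show "x + y \<in> f ` T"
    using endo_add[OF assms(1), of a b] subspace_add[OF assms(2), of a b] subsetD[OF assms(3)]
    by (metis image_eqI)
next
  fix c x assume "x \<in> f ` T"
  then obtain a where "x = f a" "a \<in> T" by auto
  then show "c *s x \<in> f ` T"
    using endo_scale[OF assms(1), of a c] subspace_scale[OF assms(2), of a c] subsetD[OF assms(3)]
    by (metis image_eqI)
qed

lemma subspace_endo_preimage:
  assumes "endo scale S f" "subspace T" "subspace S" shows "subspace {x\<in>S. f x \<in> T}"
  by (rule subspaceI)
    (use assms endo_zero[OF assms(1,3)] endo_add[OF assms(1)] endo_scale[OF assms(1)]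
      subspace_0 subspace_add subspace_scale in auto)

lemma subspace_endo_kernel:
  assumes "endo scale S f" "subspace S" shows "subspace {x\<in>S. f x = 0}"
  using subspace_endo_preimage[OF assms(1) subspace_single_0 assms(2)] by simp

text \<open>Images of powers decrease and kernels increase, so both are constant from some exponent
  on. Beyond it, equal kernels for \<open>N\<close> and \<open>N + N\<close> give the trivial
  intersection, and equal images give the decomposition.\<close>

lemma fitting:
  assumes fin: "finite_dim scale S" and x: "endo scale S x"
  obtains N where "{v\<in>S. (x ^^ N) v = 0} \<inter> (x ^^ N) ` S = {0}"
    "\<And>v. v \<in> S \<Longrightarrow> \<exists>a\<in>(x ^^ N) ` S. \<exists>b\<in>{v\<in>S. (x ^^ N) v = 0}. v = a + b" "0 < N"
proof -
  have sS: "subspace S" using finite_dim_subspace[OF fin] .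
  note xe = endo_funpow[OF x]
  define I where "I j = (x ^^ j) ` S" for j
  define K where "K j = {v\<in>S. (x ^^ j) v = 0}" for j
  have sI: "subspace (I j)" for j unfolding I_def by (rule subspace_endo_image[OF xe sS order_refl])
  have IS: "I j \<subseteq> S" for j unfolding I_def using endo_mem[OF xe] by auto
  have sK: "subspace (K j)" for j unfolding K_def by (rule subspace_endo_kernel[OF xe sS])
  have KS: "K j \<subseteq> S" for j unfolding K_def by auto
  have Idec: "I (j + i) \<subseteq> I j" for i j
    unfolding I_def using endo_mem[OF xe, of _ i] by (auto simp: funpow_add)
  have Kinc: "K j \<subseteq> K (i + j)" for i j
    unfolding K_def using endo_zero[OF xe sS] by (auto simp: funpow_add)
  obtain n where n: "\<And>j. dim (I n) \<le> dim (I j)"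
    using ex_has_least_nat[of "\<lambda>_. True" 0 "\<lambda>j. dim (I j)"] by auto
  have b: "\<forall>j. True \<longrightarrow> dim (K j) < Suc (dim S)"
    using dim_mono_finite_dim[OF fin sK KS] by (simp add: le_imp_less_Suc)
  obtain m where m: "\<And>j. dim (K j) \<le> dim (K m)"
    using ex_has_greatest_nat[of "\<lambda>_. True" 0 "\<lambda>j. dim (K j)", OF _ b] by auto
  \<comment> \<open>\<open>Suc\<close> makes the exponent positive, so that the image part lies in
    the image of \<open>x\<close> itself and a vector killed by \<open>x\<close> is killed by
    \<open>x ^^ N\<close>.\<close>
  define N where "N = Suc (n + m)"
  have I1: "I (n + i) = I n" for i
    by (rule finite_dim_eqI[OF finite_dim_subset[OF fin sI IS] sI Idec n])
  have I2: "I (N + N) = I N" using I1[of "Suc m"] I1[of "Suc m + N"] unfolding N_def by (simp add: algebra_simps)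
  have K1: "K m = K (i + m)" for i
    by (rule finite_dim_eqI[OF finite_dim_subset[OF fin sK KS] sK Kinc m])
  have K2: "K (N + N) = K N" using K1[of "Suc n"] K1[of "Suc n + N"] unfolding N_def by (simp add: algebra_simps)
  have A: "v = 0" if v: "v \<in> K N" "v \<in> I N" for v
  proof -
    obtain w where w: "w \<in> S" "v = (x ^^ N) w" using v(2) unfolding I_def by auto
    then have "w \<in> K (N + N)" using v(1) unfolding K_def by (auto simp: funpow_add)
    then show ?thesis using w K2 unfolding K_def by auto
  qed
  have B: "\<exists>a\<in>I N. \<exists>b\<in>K N. v = a + b" if v: "v \<in> S" for v
  proof -
    have "(x ^^ N) v \<in> I (N + N)" unfolding I2 unfolding I_def using v by auto
    then obtain w where w: "w \<in> S" "(x ^^ N) v = (x ^^ (N + N)) w" unfolding I_def by auto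
    have m: "(x ^^ N) w \<in> S" using endo_mem[OF xe w(1)] .
    have "(x ^^ N) (v - (x ^^ N) w) = 0"
      using endo_diff[OF xe sS v m, of N] w(2) by (simp add: funpow_add)
    then have "v - (x ^^ N) w \<in> K N" unfolding K_def using subspace_diff[OF sS v m] by auto
    moreover have "(x ^^ N) w \<in> I N" unfolding I_def using w by auto
    moreover have "v = (x ^^ N) w + (v - (x ^^ N) w)" by simp
    ultimately show ?thesis by blast
  qed
  have "0 \<in> K N" "0 \<in> I N" using subspace_0 sK sI by auto
  then have "K N \<inter> I N = {0}" using A by blast
  then show thesis using that[of N] B unfolding I_def K_def N_def by auto
qed

text \<open>Injectivity makes the kernel part of the Fitting decomposition trivial; what remains is
  the image part, which lies in the image of \<open>x\<close>.\<close>

lemma endo_surj_of_inj: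
  assumes "finite_dim scale S" "endo scale S x" "\<And>v. v \<in> S \<Longrightarrow> x v = 0 \<Longrightarrow> v = 0"
  shows "x ` S = S"
proof -
  obtain N where N: "\<And>v. v \<in> S \<Longrightarrow> \<exists>a\<in>(x ^^ N) ` S. \<exists>b\<in>{v\<in>S. (x ^^ N) v = 0}. v = a + b" "0 < N"
    using fitting[OF assms(1,2)] by metis
  have k: "v = 0" if "v \<in> S" "(x ^^ n) v = 0" for v n
    using that
  proof (induction n)
    case (Suc n)
    then show ?case using assms(3)[of "(x ^^ n) v"] endo_mem[OF endo_funpow[OF assms(2)], of v n] by auto
  qed simp
  have "S \<subseteq> x ` S"
  proof
    fix v assume "v \<in> S"
    then obtain a b where ab: "a \<in> S" "b \<in> S" "(x ^^ N) b = 0" "v = (x ^^ N) a + b" using N(1) by blast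
    then have "v = (x ^^ N) a" using k by auto
    then have "v = x ((x ^^ (N - 1)) a)" using N(2) by (cases N) auto
    then show "v \<in> x ` S" using endo_mem[OF endo_funpow[OF assms(2)] ab(1)] by blast
  qed
  then show ?thesis using endo_mem[OF assms(2)] by auto
qed

end

locale complex_vector_space = vector_space scale
  for scale :: "complex \<Rightarrow> 'v::ab_group_add \<Rightarrow> 'v" (infixr "*s" 75)
begin

text \<open>A nonzero polynomial \<open>p\<close> of least degree with \<open>ev p v = 0\<close> is
  nonconstant. Splitting off a root \<open>l\<close> leaves a \<open>q\<close> of smaller degree,
  and \<open>ev q v\<close> is the eigenvector.\<close>

lemma eigenvector_exists:
  assumes fin: "finite_dim scale S" and x: "endo scale S x" and S: "S \<noteq> {0}"
  obtains l v where "v \<in> S" "v \<noteq> 0" "x v = l *s v"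
proof -
  have sS: "subspace S" using finite_dim_subspace[OF fin] .
  define ev where "ev p v = (\<Sum>i\<le>degree p. coeff p i *s (x ^^ i) v)" for p v
  note xe = endo_funpow[OF x]
  have ev_ge: "ev p v = (\<Sum>i\<le>n. coeff p i *s (x ^^ i) v)" if "degree p \<le> n" for p n v
    unfolding ev_def by (rule sum.mono_neutral_left) (use that in \<open>auto intro: coeff_eq_0\<close>)
  have ev_mem: "ev p v \<in> S" if "v \<in> S" for p v
    unfolding ev_def by (intro subspace_sum[OF sS] subspace_scale[OF sS] endo_mem[OF xe that])
  have ev_linear: "ev ([:- l, 1:] * q) v = x (ev q v) - l *s ev q v" if v: "v \<in> S" for q l v
  proof -
    let ?n = "degree q"
    have e: "[:- l, 1:] * q = pCons 0 q - smult l q" by simp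
    have "ev ([:- l, 1:] * q) v = (\<Sum>i\<le>Suc ?n. coeff ([:- l, 1:] * q) i *s (x ^^ i) v)"
      by (rule ev_ge) (metis degree_mult_le degree_pCons_eq_if One_nat_def degree_pCons_0 plus_1_eq_Suc one_neq_zero pCons_one)
    also have "\<dots> = (\<Sum>i\<le>Suc ?n. coeff (pCons 0 q) i *s (x ^^ i) v) - (\<Sum>i\<le>Suc ?n. coeff (smult l q) i *s (x ^^ i) v)"
      unfolding e by (simp add: scale_left_diff_distrib sum_subtractf del: sum.atMost_Suc)
    also have "(\<Sum>i\<le>Suc ?n. coeff (pCons 0 q) i *s (x ^^ i) v) = (\<Sum>i\<le>?n. coeff q i *s x ((x ^^ i) v))"
      by (subst sum.atMost_Suc_shift) simp
    also have "\<dots> = x (ev q v)"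
      unfolding ev_def using endo_sum[OF x sS, of "{..?n}" "\<lambda>i. coeff q i *s (x ^^ i) v"]
        subspace_scale[OF sS] endo_mem[OF xe v] endo_scale[OF x] by simp
    also have "(\<Sum>i\<le>Suc ?n. coeff (smult l q) i *s (x ^^ i) v) = l *s (\<Sum>i\<le>Suc ?n. coeff q i *s (x ^^ i) v)"
      by (simp only: scale_sum_right coeff_smult scale_scale)
    also have "(\<Sum>i\<le>Suc ?n. coeff q i *s (x ^^ i) v) = ev q v"
      by (rule ev_ge[symmetric]) simp
    finally show ?thesis .
  qed
  obtain v where v: "v \<in> S" "v \<noteq> 0" using S subspace_0[OF sS] by auto
  have "\<exists>p. p \<noteq> 0 \<and> ev p v = 0"
  \<comment> \<open>If two powers of \<open>x\<close> agree on \<open>v\<close>, the difference of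
    two monomials is the polynomial; otherwise the powers give \<open>dim S + 1\<close> distinct
    vectors, which must be dependent.\<close>
  proof (cases "inj_on (\<lambda>i. (x ^^ i) v) {..dim S}")
    case False
    then obtain i j where ij: "i \<noteq> j" "(x ^^ i) v = (x ^^ j) v" unfolding inj_on_def by auto
    define p where "p = monom (1::complex) i - monom 1 j"
    have p: "degree p \<le> i + j" unfolding p_def
      by (rule degree_diff_le) (auto intro: order_trans[OF degree_monom_le])
    have "coeff p i = 1" using ij unfolding p_def by simp
    then have "p \<noteq> 0" by auto
    moreover have "ev p v = (\<Sum>k\<le>i+j. (if k = i then (x ^^ i) v else 0) - (if k = j then (x ^^ j) v else 0))"
      unfolding ev_ge[OF p] by (rule sum.cong) (auto simp: p_def)
    then have "ev p v = 0" using ij(2) by (simp add: sum_subtractf)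
    ultimately show ?thesis by auto
  next
    case True
    let ?A = "(\<lambda>i. (x ^^ i) v) ` {..dim S}"
    have A: "?A \<subseteq> S" using endo_mem[OF xe v(1)] by auto
    have "card ?A = Suc (dim S)" using card_image[OF True] by simp
    then have "dependent ?A" using independent_card_le_dim_finite_dim[OF fin _ A] by auto
    then obtain u where u: "\<exists>w\<in>?A. u w \<noteq> 0" "(\<Sum>w\<in>?A. u w *s w) = 0"
      unfolding dependent_finite[OF finite_imageI[OF finite_atMost]] by blast
    define p where "p = (\<Sum>i\<le>dim S. monom (u ((x ^^ i) v)) i)"
    have c: "coeff p i = (if i \<le> dim S then u ((x ^^ i) v) else 0)" for i
      unfolding p_def coeff_sum coeff_monom by simp
    have d: "degree p \<le> dim S" by (rule degree_le) (use c in auto)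
    have "p \<noteq> 0" using u(1) c by (metis (mono_tags, lifting) atMost_iff coeff_0 image_iff)
    moreover have "ev p v = (\<Sum>i\<le>dim S. u ((x ^^ i) v) *s (x ^^ i) v)"
      unfolding ev_ge[OF d] by (rule sum.cong) (auto simp: c)
    then have "ev p v = 0" using u(2) sum.reindex[OF True, of "\<lambda>w. u w *s w"] by (simp add: o_def)
    ultimately show ?thesis by auto
  qed
  then obtain p where p: "p \<noteq> 0" "ev p v = 0" "\<And>q. q \<noteq> 0 \<Longrightarrow> ev q v = 0 \<Longrightarrow> degree p \<le> degree q"
    using ex_has_least_nat[of "\<lambda>p. p \<noteq> 0 \<and> ev p v = 0" _ degree] by (metis (no_types, lifting))
  have "degree p \<noteq> 0"
  proof
    assume "degree p = 0"
    then obtain c where c: "p = [:c:]" by (metis degree_eq_zeroE)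
    then have "ev p v = c *s v" unfolding ev_def by simp
    then show False using p v c by auto
  qed
  then have "\<not> constant (poly p)" by (simp add: constant_degree)
  then obtain l where "poly p l = 0" using fundamental_theorem_of_algebra by blast
  then obtain q where q: "p = [:- l, 1:] * q" by (meson poly_eq_0_iff_dvd dvdE)
  have q0: "q \<noteq> 0" using p(1) q by auto
  have "degree p = Suc (degree q)" unfolding q using q0 by (subst degree_mult_eq) auto
  then have "ev q v \<noteq> 0" using p(3)[OF q0] by auto
  moreover have "x (ev q v) = l *s ev q v" using ev_linear[OF v(1), of l q] p(2) q by simp
  ultimately show thesis using that ev_mem[OF v(1)] by blast
qed

end

section \<open>Schur's bound for commuting operators\<close>

text \<open>Schur's maximal dimension of a commuting space of \<open>n \<times> n\<close> matrices.
  The value at \<open>0\<close> is set by hand, since the formula would give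
  \<open>1\<close>.\<close>

definition comm_bound :: "nat \<Rightarrow> nat" where
  "comm_bound n = (if n = 0 then 0 else n\<^sup>2 div 4 + 1)"

lemma comm_bound_mono: "m \<le> n \<Longrightarrow> comm_bound m \<le> comm_bound n"
  unfolding comm_bound_def by (auto intro!: div_le_mono power_mono)

text \<open>The cross term \<open>2 * a * b\<close> of the square pays for the second
  \<open>+ 1\<close> as soon as \<open>a * b \<ge> 2\<close>; the remaining case
  \<open>a = b = 1\<close> needs the rounding of the divisions.\<close>

lemma comm_bound_superadditive: "comm_bound a + comm_bound b \<le> comm_bound (a + b)"
proof (cases "a = 0 \<or> b = 0")
  case True
  then show ?thesis by (auto simp: comm_bound_def)
next
  case False
  have "a\<^sup>2 div 4 + b\<^sup>2 div 4 + 1 \<le> (a + b)\<^sup>2 div 4"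
  proof (cases "a = 1 \<and> b = 1")
    case True
    then show ?thesis by (simp add: power2_eq_square)
  next
    case ne: False
    have "a * b \<ge> 2"
    proof -
      have "a \<ge> 2 \<or> b \<ge> 2" using ne False by auto
      then show ?thesis
        using False mult_le_mono[of 2 a 1 b] mult_le_mono[of 1 a 2 b] by auto
    qed
    then have "4 * (a\<^sup>2 div 4 + b\<^sup>2 div 4 + 1) \<le> (a + b)\<^sup>2"
      using times_div_less_eq_dividend[of 4 "a\<^sup>2"] times_div_less_eq_dividend[of 4 "b\<^sup>2"]
      by (simp add: power2_sum)
    then show ?thesis by simp
  qed
  then show ?thesis using False by (auto simp: comm_bound_def)
qed

lemma mult_le_square_div4: "s * t \<le> (s + t)\<^sup>2 div (4::nat)"
proof -
  have "4 * (s * t) \<le> (s + t)\<^sup>2"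
  proof -
    have "int (4 * (s * t)) \<le> int ((s + t)\<^sup>2)"
      using zero_le_power2[of "int s - int t"] by (simp add: power2_eq_square algebra_simps)
    then show ?thesis by linarith
  qed
  then show ?thesis by simp
qed

text \<open>Linearity in both arguments and no bracket: enough for a commuting space of operators.
  \<open>lie_action\<close> adds compatibility with the bracket.\<close>

definition acts_on ::
    "('k \<Rightarrow> 'g::plus \<Rightarrow> 'g) \<Rightarrow> ('k \<Rightarrow> 'v::plus \<Rightarrow> 'v) \<Rightarrow> 'g set \<Rightarrow> 'v set \<Rightarrow> ('g \<Rightarrow> 'v \<Rightarrow> 'v) \<Rightarrow> bool" where
  "acts_on gscale scale Z V act \<longleftrightarrow> (\<forall>z\<in>Z. endo scale V (act z)) \<and>
     (\<forall>v\<in>V. \<forall>z\<in>Z. \<forall>w\<in>Z. act (z + w) v = act z v + act w v) \<and>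
     (\<forall>v\<in>V. \<forall>c. \<forall>z\<in>Z. act (gscale c z) v = scale c (act z v))"

lemma acts_on_endo: "acts_on gscale scale Z V act \<Longrightarrow> z \<in> Z \<Longrightarrow> endo scale V (act z)"
  and acts_on_add:
    "acts_on gscale scale Z V act \<Longrightarrow> v \<in> V \<Longrightarrow> z \<in> Z \<Longrightarrow> w \<in> Z \<Longrightarrow> act (z + w) v = act z v + act w v"
  and acts_on_scale:
    "acts_on gscale scale Z V act \<Longrightarrow> v \<in> V \<Longrightarrow> z \<in> Z \<Longrightarrow> act (gscale c z) v = scale c (act z v)"
  unfolding acts_on_def by auto

lemma acts_on_subset:
  assumes "acts_on gscale scale Z V act" "Z' \<subseteq> Z" "V' \<subseteq> V" "\<And>z v. z \<in> Z' \<Longrightarrow> v \<in> V' \<Longrightarrow> act z v \<in> V'"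
  shows "acts_on gscale scale Z' V' act"
  using assms(1-3) unfolding acts_on_def endo_def
  by (auto simp: subset_iff image_subset_iff intro: assms(4))

locale space_pair = complex_vector_space scale + g: vector_space gscale
  for scale :: "complex \<Rightarrow> 'v::ab_group_add \<Rightarrow> 'v" (infixr "*s" 75)
    and gscale :: "complex \<Rightarrow> 'g::ab_group_add \<Rightarrow> 'g" (infixr "*g" 75)
begin

lemma subspace_annihilator:
  assumes "acts_on gscale scale Z V act" "g.subspace Z" "subspace V" "X \<subseteq> V"
  shows "g.subspace {z\<in>Z. \<forall>v\<in>X. act z v = 0}"
proof (rule g.subspaceI)
  have "act 0 v = 0" if "v \<in> V" for v
    using acts_on_scale[OF assms(1) that g.subspace_0[OF assms(2)], of 0] by simp
  then show "0 \<in> {z\<in>Z. \<forall>v\<in>X. act z v = 0}" using g.subspace_0[OF assms(2)] assms(4) by auto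
next
  fix x y assume "x \<in> {z\<in>Z. \<forall>v\<in>X. act z v = 0}" "y \<in> {z\<in>Z. \<forall>v\<in>X. act z v = 0}"
  then show "x + y \<in> {z\<in>Z. \<forall>v\<in>X. act z v = 0}"
    using g.subspace_add[OF assms(2)] acts_on_add[OF assms(1)] subsetD[OF assms(4)] by auto
next
  fix c x assume "x \<in> {z\<in>Z. \<forall>v\<in>X. act z v = 0}"
  then show "c *g x \<in> {z\<in>Z. \<forall>v\<in>X. act z v = 0}"
    using g.subspace_scale[OF assms(2)] acts_on_scale[OF assms(1)] subsetD[OF assms(4)] by auto
qed

text \<open>On a minimal nonzero stable subspace every operator is a scalar, because an eigenspace
  of one operator is stable under all the others. The scalar depends linearly on the
  operator.\<close>

lemma common_eigenvector:
  assumes fin: "finite_dim scale V" and V: "V \<noteq> {0}"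
    and act: "acts_on gscale scale Z V act" and Z: "g.subspace Z"
    and comm: "\<And>z w v. z \<in> Z \<Longrightarrow> w \<in> Z \<Longrightarrow> v \<in> V \<Longrightarrow> act z (act w v) = act w (act z v)"
  obtains v l where "v \<in> V" "v \<noteq> 0" "functional_on gscale Z l" "\<And>z. z \<in> Z \<Longrightarrow> act z v = l z *s v"
proof -
  have sV: "subspace V" using finite_dim_subspace[OF fin] .
  define P where "P T \<longleftrightarrow> subspace T \<and> T \<subseteq> V \<and> T \<noteq> {0} \<and> (\<forall>z\<in>Z. \<forall>v\<in>T. act z v \<in> T)" for T
  have PV: "P V" unfolding P_def using sV V endo_mem[OF acts_on_endo[OF act]] by blast
  obtain M where M: "P M" "\<And>T. P T \<Longrightarrow> T \<subseteq> M \<Longrightarrow> T = M"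
    by (rule finite_dim_minimal[of P, OF PV]) (use finite_dim_subset[OF fin] in \<open>auto simp: P_def\<close>)
  have sM: "subspace M" and MV: "M \<subseteq> V" and M0: "M \<noteq> {0}"
    and stab: "\<And>z v. z \<in> Z \<Longrightarrow> v \<in> M \<Longrightarrow> act z v \<in> M" using M(1) unfolding P_def by auto
  have "\<exists>c. \<forall>v\<in>M. act z v = c *s v" if z: "z \<in> Z" for z
  proof -
    have e: "endo scale M (act z)"
      using endo_subset[OF acts_on_endo[OF act z] MV] stab[OF z] by auto
    obtain c v where cv: "v \<in> M" "v \<noteq> 0" "act z v = c *s v"
      using eigenvector_exists[OF finite_dim_subset[OF fin sM MV] e M0] by metis
    let ?E = "{v\<in>M. act z v - c *s v = 0}"
    have "endo scale M (\<lambda>v. act z v - c *s v)"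
      by (rule endo_minus[OF sM e endo_smult[OF sM endo_id]])
    then have "subspace ?E" using subspace_endo_kernel[OF _ sM] by blast
    moreover have "act w v \<in> ?E" if w: "w \<in> Z" "v \<in> ?E" for w v
      using comm[OF z w(1), of v] w MV endo_scale[OF acts_on_endo[OF act w(1)], of v c] stab by auto
    ultimately have "P ?E" unfolding P_def using cv MV by auto
    then have "?E = M" using M(2) by auto
    then show ?thesis by auto
  qed
  then obtain l where l: "\<And>z v. z \<in> Z \<Longrightarrow> v \<in> M \<Longrightarrow> act z v = l z *s v" by metis
  obtain v where v: "v \<in> M" "v \<noteq> 0" using M0 subspace_0[OF sM] by auto
  have "l (z + w) = l z + l w" if "z \<in> Z" "w \<in> Z" for z w
  proof -
    have "l (z + w) *s v = (l z + l w) *s v"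
      using l[OF g.subspace_add[OF Z that] v(1)] acts_on_add[OF act _ that, of v] l v(1) MV that
      by (auto simp: scale_left_distrib)
    then show ?thesis using v(2) by simp
  qed
  moreover have "l (c *g z) = c * l z" if "z \<in> Z" for c z
  proof -
    have "l (c *g z) *s v = (c * l z) *s v"
      using l[OF g.subspace_scale[OF Z that] v(1), of c] acts_on_scale[OF act _ that, of v] l v(1) MV that
      by auto
    then show ?thesis using v(2) by simp
  qed
  ultimately have "functional_on gscale Z l" unfolding functional_on_def by blast
  then show thesis using that v l MV by blast
qed

text \<open>
  A commuting space of nilpotent operators is determined by its components from \<open>V / K\<close> to the
  common kernel \<open>K\<close>: a nonzero image would be stable, hence would meet \<open>K\<close>.
\<close>

lemma commuting_nilpotent_dim_bound:
  assumes fin: "finite_dim scale V" and finZ: "finite_dim gscale Z"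
    and act: "acts_on gscale scale Z V act"
    and comm: "\<And>z w v. z \<in> Z \<Longrightarrow> w \<in> Z \<Longrightarrow> v \<in> V \<Longrightarrow> act z (act w v) = act w (act z v)"
    and faithful: "\<And>z. z \<in> Z \<Longrightarrow> (\<And>v. v \<in> V \<Longrightarrow> act z v = 0) \<Longrightarrow> z = 0"
    and nil: "\<And>z. z \<in> Z \<Longrightarrow> \<exists>n. \<forall>v\<in>V. (act z ^^ n) v = 0"
  shows "g.dim Z \<le> (dim V)\<^sup>2 div 4"
proof -
  have sV: "subspace V" using finite_dim_subspace[OF fin] .
  have sZ: "g.subspace Z" using g.finite_dim_subspace[OF finZ] .
  note end_act = acts_on_endo[OF act]
  define K where "K = {v\<in>V. \<forall>z\<in>Z. act z v = 0}"
  have K: "subspace K"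
    by (rule subspaceI)
      (use sV endo_zero[OF end_act sV] endo_add[OF end_act] endo_scale[OF end_act]
        subspace_0 subspace_add subspace_scale in \<open>auto simp: K_def\<close>)
  have KV: "K \<subseteq> V" unfolding K_def by auto
  obtain C where C: "subspace C" "C \<subseteq> V" "K \<inter> C = {0}" "dim V = dim K + dim C"
    by (fact complement_exists[OF fin K KV])
  obtain q c \<kappa> where c: "q + dim K = dim V" "\<And>i. i < q \<Longrightarrow> c i \<in> V"
      "\<And>i. i < q \<Longrightarrow> functional_on scale V (\<kappa> i)" "\<And>i t. i < q \<Longrightarrow> t \<in> K \<Longrightarrow> \<kappa> i t = 0"
      "\<And>x. x \<in> V \<Longrightarrow> x - (\<Sum>i<q. \<kappa> i x *s c i) \<in> K"
    by (fact quotient_coordinates[OF fin K KV])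
  obtain t d \<pi> where d: "t + dim C = dim V" "\<And>i. i < t \<Longrightarrow> d i \<in> V"
      "\<And>i. i < t \<Longrightarrow> functional_on scale V (\<pi> i)" "\<And>i x. i < t \<Longrightarrow> x \<in> C \<Longrightarrow> \<pi> i x = 0"
      "\<And>x. x \<in> V \<Longrightarrow> x - (\<Sum>i<t. \<pi> i x *s d i) \<in> C"
    by (fact quotient_coordinates[OF fin C(1,2)])
  \<comment> \<open>The functionals are the matrix entries of the map from \<open>V / K\<close> to
    \<open>V / C\<close> induced by \<open>z\<close>. Here \<open>t = dim K\<close> and
    \<open>q = dim C\<close>.\<close>
  have "g.dim Z \<le> card ({..<t} \<times> {..<q})"
  proof (rule g.dim_le_card_functionals[OF _ finZ, where \<phi> = "\<lambda>(i, j) z. \<pi> i (act z (c j))"])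
    show "finite ({..<t} \<times> {..<q})" by simp
  next
    fix p assume "p \<in> {..<t} \<times> {..<q}"
    then obtain i j where p: "p = (i, j)" "i < t" "j < q" by auto
    show "functional_on gscale Z (case p of (i, j) \<Rightarrow> \<lambda>z. \<pi> i (act z (c j)))"
      unfolding functional_on_def p prod.case
      using acts_on_add[OF act c(2)[OF p(3)]] acts_on_scale[OF act c(2)[OF p(3)]]
        functional_on_add[OF d(3)[OF p(2)]] functional_on_scale[OF d(3)[OF p(2)]]
        endo_mem[OF end_act c(2)[OF p(3)]] by simp
  next
    fix z assume z: "z \<in> Z" and "\<And>p. p \<in> {..<t} \<times> {..<q} \<Longrightarrow> (case p of (i, j) \<Rightarrow> \<lambda>z. \<pi> i (act z (c j))) z = 0"
    then have z0: "\<pi> i (act z (c j)) = 0" if "i < t" "j < q" for i j using that by fastforce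
    have zc: "act z (c j) \<in> C" if "j < q" for j
      using d(5)[OF endo_mem[OF end_act[OF z] c(2)[OF that]]] z0 that by simp
    have zC: "act z v \<in> C" if v: "v \<in> V" for v
    proof -
      let ?s = "\<Sum>i<q. \<kappa> i v *s c i"
      have s: "?s \<in> V" by (intro subspace_sum[OF sV] subspace_scale[OF sV]) (use c(2) in auto)
      have "act z v - act z ?s = 0"
        using endo_diff[OF end_act[OF z] sV v s] c(5)[OF v] z unfolding K_def by auto
      moreover have "act z ?s = (\<Sum>i<q. \<kappa> i v *s act z (c i))"
        using endo_sum[OF end_act[OF z] sV, of "{..<q}" "\<lambda>i. \<kappa> i v *s c i"]
          subspace_scale[OF sV] c(2) endo_scale[OF end_act[OF z]] by simp
      moreover have "\<dots> \<in> C"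
        by (intro subspace_sum[OF C(1)] subspace_scale[OF C(1)]) (use zc in auto)
      ultimately show ?thesis by simp
    qed
    let ?Y = "act z ` V"
    have Y: "subspace ?Y" "?Y \<subseteq> V" using subspace_endo_image[OF end_act[OF z] sV] endo_mem[OF end_act[OF z]] by auto
    have "?Y = {0}"
    proof (rule ccontr)
      assume Y0: "?Y \<noteq> {0}"
      have stab: "act w v \<in> ?Y" if w: "w \<in> Z" "v \<in> ?Y" for w v
        using comm[OF w(1) z] w endo_mem[OF end_act[OF w(1)]] by auto
      have "act z (act w v) = act w (act z v)" if "z \<in> Z" "w \<in> Z" "v \<in> ?Y" for z w v
        using comm that Y(2) by blast
      then obtain v l where v: "v \<in> ?Y" "v \<noteq> 0" "\<And>z. z \<in> Z \<Longrightarrow> act z v = l z *s v"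
        using common_eigenvector[OF finite_dim_subset[OF fin Y] Y0 acts_on_subset[OF act order_refl Y(2) stab] sZ]
        by metis
      \<comment> \<open>A nilpotent operator has only the eigenvalue \<open>0\<close>, so
        \<open>v\<close> lies in the common kernel \<open>K\<close>. It also lies in the image of
        \<open>z\<close>, which is contained in \<open>C\<close>.\<close>
      have "act w v = 0" if w: "w \<in> Z" for w
      proof -
        obtain n where n: "(act w ^^ n) v = 0" using nil[OF w] v(1) Y(2) by blast
        have "(act w ^^ k) v = (l w ^ k) *s v" for k
          by (induction k) (use v Y(2) endo_scale[OF end_act[OF w], of v] w in \<open>auto simp: mult.commute\<close>)
        then have "l w = 0" using n v(2) by auto
        then show ?thesis using v(3)[OF w] by simp
      qed
      then have "v \<in> K \<inter> C" using v(1) Y(2) zC unfolding K_def by auto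
      then show False using v(2) C(3) by auto
    qed
    then show "z = 0" using faithful[OF z] by auto
  qed
  also have "\<dots> = t * q" by simp
  also have "\<dots> \<le> (t + q)\<^sup>2 div 4" by (rule mult_le_square_div4)
  also have "t + q = dim V" using c(1) d(1) C(4) by simp
  finally show ?thesis .
qed

text \<open>If some operator has a Fitting decomposition with two nonzero parts, the operators are
  distributed over the parts and superadditivity of \<open>comm_bound\<close> applies. Otherwise
  every operator is nilpotent or invertible, and giving up one dimension for the eigenvalue on a
  common eigenvector leaves only nilpotent ones.\<close>

theorem commuting_dim_bound:
  assumes "finite_dim scale V" "finite_dim gscale Z" "acts_on gscale scale Z V act"
    and "\<And>z w v. z \<in> Z \<Longrightarrow> w \<in> Z \<Longrightarrow> v \<in> V \<Longrightarrow> act z (act w v) = act w (act z v)"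
    and "\<And>z. z \<in> Z \<Longrightarrow> (\<And>v. v \<in> V \<Longrightarrow> act z v = 0) \<Longrightarrow> z = 0"
  shows "g.dim Z \<le> comm_bound (dim V)"
  using assms
proof (induction "dim V" arbitrary: V Z rule: less_induct)
  case less
  note fin = less.prems(1) and finZ = less.prems(2) and act = less.prems(3)
    and comm = less.prems(4) and faithful = less.prems(5)
  have sV: "subspace V" using finite_dim_subspace[OF fin] .
  have sZ: "g.subspace Z" using g.finite_dim_subspace[OF finZ] .
  note end_act = acts_on_endo[OF act]
  show ?case
  proof (cases "V = {0}")
    case True
    then have "Z = {0}" using faithful endo_zero[OF end_act sV] g.subspace_0[OF sZ] by auto
    then show ?thesis using g.dim_zero_singleton by simp
  next
    case V0: False
    define K where "K z n = {v\<in>V. (act z ^^ n) v = 0}" for z n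
    define I where "I z n = (act z ^^ n) ` V" for z n
    have sK: "subspace (K z n)" if "z \<in> Z" for z n
      unfolding K_def by (rule subspace_endo_kernel[OF endo_funpow[OF end_act[OF that]] sV])
    have sI: "subspace (I z n)" if "z \<in> Z" for z n
      unfolding I_def by (rule subspace_endo_image[OF endo_funpow[OF end_act[OF that]] sV order_refl])
    have KV: "K z n \<subseteq> V" for z n unfolding K_def by auto
    have IV: "I z n \<subseteq> V" if "z \<in> Z" for z n
      unfolding I_def using endo_mem[OF endo_funpow[OF end_act[OF that]]] by auto
    have commp: "(act z ^^ n) (act w v) = act w ((act z ^^ n) v)" if "z \<in> Z" "w \<in> Z" "v \<in> V" for z w v n
      by (induction n) (use that comm endo_mem[OF endo_funpow[OF end_act[OF that(1)]] that(3)] in auto)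
    have stK: "act w v \<in> K z n" if "z \<in> Z" "w \<in> Z" "v \<in> K z n" for z w n v
      using that commp[of z w v n] endo_mem[OF end_act] endo_zero[OF end_act sV] unfolding K_def by auto
    have stI: "act w v \<in> I z n" if zw: "z \<in> Z" "w \<in> Z" "v \<in> I z n" for z w n v
    proof -
      obtain u where u: "u \<in> V" "v = (act z ^^ n) u" using zw(3) unfolding I_def by auto
      then have "act w v = (act z ^^ n) (act w u)" using commp[OF zw(1,2) u(1)] by simp
      then show ?thesis unfolding I_def using endo_mem[OF end_act[OF zw(2)] u(1)] by auto
    qed
    show ?thesis
    proof (cases "\<exists>z\<in>Z. \<exists>n. K z n \<inter> I z n = {0} \<and> (\<forall>v\<in>V. \<exists>a\<in>I z n. \<exists>b\<in>K z n. v = a + b) \<and> K z n \<noteq> {0} \<and> I z n \<noteq> {0}")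
      case True
      then obtain z n where z: "z \<in> Z" and KI: "K z n \<inter> I z n = {0}"
          "\<And>v. v \<in> V \<Longrightarrow> \<exists>a\<in>I z n. \<exists>b\<in>K z n. v = a + b" "K z n \<noteq> {0}" "I z n \<noteq> {0}" by blast
      let ?K = "K z n" and ?I = "I z n"
      have fK: "finite_dim scale ?K" using finite_dim_subset[OF fin sK[OF z] KV] .
      have fI: "finite_dim scale ?I" using finite_dim_subset[OF fin sI[OF z] IV[OF z]] .
      have d: "dim ?K + dim ?I \<le> dim V" using dim_direct_le[OF fin sK[OF z] sI[OF z] KV IV[OF z] KI(1)] .
      have "0 < dim ?K" "0 < dim ?I" using KI(3,4) dim_pos_iff fK fI by auto
      then have lt: "dim ?K < dim V" "dim ?I < dim V" using d by auto
      \<comment> \<open>Operators that vanish on \<open>?K\<close> are faithful on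
        \<open>?I\<close>, and a complement of them in \<open>Z\<close> is faithful on
        \<open>?K\<close>, so each part bounds its own share of \<open>Z\<close>.\<close>
      let ?A = "{w\<in>Z. \<forall>v\<in>?K. act w v = 0}"
      have sA: "g.subspace ?A" by (rule subspace_annihilator[OF act sZ sV KV])
      have AZ: "?A \<subseteq> Z" by auto
      obtain C where C: "g.subspace C" "C \<subseteq> Z" "?A \<inter> C = {0}" "g.dim Z = g.dim ?A + g.dim C"
        by (fact g.complement_exists[OF finZ sA AZ])
      have "g.dim C \<le> comm_bound (dim ?K)"
      proof (rule less.hyps[OF lt(1) fK g.finite_dim_subset[OF finZ C(1,2)]])
        show "acts_on gscale scale C ?K act" 
          by (rule acts_on_subset[OF act C(2) KV]) (use stK[OF z] C(2) in auto)
        show "act w (act w' v) = act w' (act w v)" if "w \<in> C" "w' \<in> C" "v \<in> ?K" for w w' v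
          using comm that C(2) KV by blast
        show "w = 0" if "w \<in> C" "\<And>v. v \<in> ?K \<Longrightarrow> act w v = 0" for w
          using that C(2,3) by blast
      qed
      moreover have "g.dim ?A \<le> comm_bound (dim ?I)"
      proof (rule less.hyps[OF lt(2) fI g.finite_dim_subset[OF finZ sA AZ]])
        show "acts_on gscale scale ?A ?I act" 
          by (rule acts_on_subset[OF act AZ IV[OF z]]) (use stI[OF z] in auto)
        show "act w (act w' v) = act w' (act w v)" if "w \<in> ?A" "w' \<in> ?A" "v \<in> ?I" for w w' v
          using comm that IV[OF z] by blast
        show "w = 0" if w: "w \<in> ?A" "\<And>v. v \<in> ?I \<Longrightarrow> act w v = 0" for w
        proof (rule faithful)
          show "w \<in> Z" using w by auto
          fix v assume "v \<in> V"
          then obtain a b where ab: "a \<in> ?I" "b \<in> ?K" "v = a + b" using KI(2) by blast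
          then have "a \<in> V" "b \<in> V" using IV[OF z, of n] KV[of z n] by blast+
          then show "act w v = 0"
            using ab endo_add[OF end_act[OF \<open>w \<in> Z\<close>], of a b] w by auto
        qed
      qed
      ultimately have "g.dim Z \<le> comm_bound (dim ?K) + comm_bound (dim ?I)" using C(4) by simp
      also have "\<dots> \<le> comm_bound (dim ?K + dim ?I)" by (rule comm_bound_superadditive)
      also have "\<dots> \<le> comm_bound (dim V)" by (rule comm_bound_mono[OF d])
      finally show ?thesis .
    next
      case nosplit: False
      obtain v l where v: "v \<in> V" "v \<noteq> 0" "functional_on gscale Z l" "\<And>z. z \<in> Z \<Longrightarrow> act z v = l z *s v"
        by (rule common_eigenvector[OF fin V0 act sZ]) (use comm in blast)+
      \<comment> \<open>Every \<open>z\<close> in \<open>?N\<close> kills \<open>v\<close>, so the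
        kernel part of its Fitting decomposition is nonzero. The image part must then be zero, which
        makes \<open>z\<close> nilpotent.\<close>
      let ?N = "{z\<in>Z. l z = 0}"
      have N: "g.subspace ?N" "g.dim Z \<le> g.dim ?N + 1" using g.dim_functional_kernel[OF finZ v(3)] by auto
      have NZ: "?N \<subseteq> Z" by auto
      have "g.dim ?N \<le> (dim V)\<^sup>2 div 4"
      proof (rule commuting_nilpotent_dim_bound[OF fin g.finite_dim_subset[OF finZ N(1) NZ]])
        show "acts_on gscale scale ?N V act"
          by (rule acts_on_subset[OF act NZ order_refl]) (use endo_mem[OF end_act] in auto)
        show "act z (act w u) = act w (act z u)" if "z \<in> ?N" "w \<in> ?N" "u \<in> V" for z w u
          using comm that by auto
        show "z = 0" if "z \<in> ?N" "\<And>v. v \<in> V \<Longrightarrow> act z v = 0" for z using that faithful by auto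
        show "\<exists>n. \<forall>v\<in>V. (act z ^^ n) v = 0" if zN: "z \<in> ?N" for z
        proof -
          have z: "z \<in> Z" using zN by auto
          obtain n where n: "K z n \<inter> I z n = {0}" "\<And>v. v \<in> V \<Longrightarrow> \<exists>a\<in>I z n. \<exists>b\<in>K z n. v = a + b" "0 < n"
            by (rule fitting[OF fin end_act[OF z]]) (rule that[unfolded K_def I_def]; blast)
          have "act z v = 0" using v(4)[OF z] zN by auto
          then have "(act z ^^ k) v = 0" if "0 < k" for k
            using that endo_zero[OF endo_funpow[OF end_act[OF z]] sV]
            by (cases k) (auto simp: funpow_Suc_right simp del: funpow.simps)
          then have "v \<in> K z n" using n(3) v(1) unfolding K_def by auto
          then have "K z n \<noteq> {0}" using v(2) by auto
          then have "I z n = {0}" using nosplit z n(1,2) by blast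
          then have "u \<in> K z n" if "u \<in> V" for u using n(2)[OF that] by auto
          then show ?thesis unfolding K_def by blast
        qed
      qed
      moreover have "0 < dim V" using dim_pos_iff[OF fin] V0 by simp
      ultimately show ?thesis using N(2) unfolding comm_bound_def by auto
    qed
  qed
qed

end

section \<open>Idempotents of a commutant\<close>

text \<open>To be applied with \<open>B\<close> the operators of the other simple ideals and of the
  centre, so that the chosen simple ideal acts inside the commutant.\<close>

definition commutant ::
    "('k \<Rightarrow> 'v::plus \<Rightarrow> 'v) \<Rightarrow> 'v set \<Rightarrow> ('v \<Rightarrow> 'v) set \<Rightarrow> ('v \<Rightarrow> 'v) set" where
  "commutant scale V B = {x. endo scale V x \<and> (\<forall>b\<in>B. \<forall>v\<in>V. x (b v) = b (x v))}"

text \<open>\<open>E\<close> and \<open>E'\<close> may overlap. The last clause is faithfulness in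
  the form that the induction uses: it concerns one operator of \<open>B\<close> at a time.\<close>

definition (in complex_vector_space) splits ::
    "'v set \<Rightarrow> ('v \<Rightarrow> 'v) set \<Rightarrow> 'v set \<Rightarrow> 'v set \<Rightarrow> bool" where
  "splits V B E E' \<longleftrightarrow> subspace E \<and> E \<subseteq> V \<and> E \<noteq> {0} \<and> subspace E' \<and> E' \<subseteq> V \<and>
    (\<forall>b\<in>B. b ` E \<subseteq> E \<and> b ` E' \<subseteq> E' \<and>
      ((\<forall>w\<in>E. b w = 0) \<longrightarrow> (\<forall>w\<in>E'. b w = 0) \<longrightarrow> (\<forall>v\<in>V. b v = 0)))"

text \<open>A composition factor \<open>U1 / U2\<close> of \<open>V\<close> over the commutant, kept
  as a pair of subspaces; statements about the factor become congruences modulo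
  \<open>U2\<close>.\<close>

locale commutant_subquotient = complex_vector_space scale
  for scale :: "complex \<Rightarrow> 'v::ab_group_add \<Rightarrow> 'v" (infixr "*s" 75) +
  fixes V :: "'v set" and B :: "('v \<Rightarrow> 'v) set" and U1 U2 :: "'v set"
  assumes fin: "finite_dim scale V"
    and B_endo: "b \<in> B \<Longrightarrow> endo scale V b"
    and sU1: "subspace U1" and sU2: "subspace U2"
    and U2_sub: "U2 \<subseteq> U1" and U1_sub: "U1 \<subseteq> V" and U_neq: "U2 \<noteq> U1"
    and U1_stable: "x \<in> commutant scale V B \<Longrightarrow> u \<in> U1 \<Longrightarrow> x u \<in> U1"
    and U2_stable: "x \<in> commutant scale V B \<Longrightarrow> u \<in> U2 \<Longrightarrow> x u \<in> U2"
    and irreducible: "\<lbrakk>subspace X; U2 \<subseteq> X; X \<subseteq> U1;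
      \<And>x u. x \<in> commutant scale V B \<Longrightarrow> u \<in> X \<Longrightarrow> x u \<in> X\<rbrakk> \<Longrightarrow> X = U2 \<or> X = U1"
begin

abbreviation "R \<equiv> commutant scale V B"

lemma sV: "subspace V" using finite_dim_subspace[OF fin] .

lemma R_endo: "x \<in> R \<Longrightarrow> endo scale V x" unfolding commutant_def by auto

lemma R_comm: "x \<in> R \<Longrightarrow> b \<in> B \<Longrightarrow> v \<in> V \<Longrightarrow> x (b v) = b (x v)" unfolding commutant_def by auto

lemma R_mem: "x \<in> R \<Longrightarrow> v \<in> V \<Longrightarrow> x v \<in> V" using endo_mem[OF R_endo] .

lemma R_diff: "x \<in> R \<Longrightarrow> v \<in> V \<Longrightarrow> w \<in> V \<Longrightarrow> x (v - w) = x v - x w"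
  using endo_diff[OF R_endo sV] .

lemma id_R: "(\<lambda>v. v) \<in> R" unfolding commutant_def using endo_id by auto

lemma comp_R: "x \<in> R \<Longrightarrow> y \<in> R \<Longrightarrow> (\<lambda>v. x (y v)) \<in> R"
  using R_comm R_mem endo_comp[OF R_endo R_endo] unfolding commutant_def[of scale V B] by auto

lemma smult_R: "x \<in> R \<Longrightarrow> (\<lambda>v. c *s x v) \<in> R"
  using endo_smult[OF sV R_endo] endo_scale[OF B_endo] R_mem R_comm
  by (auto simp: commutant_def[of scale V B])

lemma plus_R: "x \<in> R \<Longrightarrow> y \<in> R \<Longrightarrow> (\<lambda>v. x v + y v) \<in> R"
  using endo_plus[OF sV R_endo R_endo] endo_add[OF B_endo] R_mem R_comm
  by (auto simp: commutant_def[of scale V B])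

lemma minus_R: "x \<in> R \<Longrightarrow> y \<in> R \<Longrightarrow> (\<lambda>v. x v - y v) \<in> R"
  using endo_minus[OF sV R_endo R_endo] endo_diff[OF B_endo sV] R_mem R_comm
  by (auto simp: commutant_def[of scale V B])

text \<open>The vectors congruent modulo \<open>U2\<close> to some \<open>r u\<close> form a stable
  subspace containing \<open>u\<close>, so irreducibility makes it all of \<open>U1\<close>.\<close>

lemma generates:
  assumes u: "u \<in> U1" "u \<notin> U2" and w: "w \<in> U1"
  obtains r where "r \<in> R" "w - r u \<in> U2"
proof -
  define X where "X = {r u + t |r t. r \<in> R \<and> t \<in> U2}"
  have uV: "u \<in> V" using u U1_sub by auto
  have XI: "r u + t \<in> X" if "r \<in> R" "t \<in> U2" for r t using that unfolding X_def by blast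
  have XE: "\<exists>r\<in>R. \<exists>t\<in>U2. v = r u + t" if "v \<in> X" for v using that unfolding X_def by blast
  have U2X: "t \<in> X" if "t \<in> U2" for t
    using XI[OF minus_R[OF id_R id_R] that] by simp
  have X: "subspace X"
  proof (rule subspaceI)
    show "0 \<in> X" using U2X subspace_0[OF sU2] .
  next
    fix x y assume xy: "x \<in> X" "y \<in> X"
    obtain r t where r: "x = r u + t" "r \<in> R" "t \<in> U2" using XE[OF xy(1)] by blast
    obtain r' t' where r': "y = r' u + t'" "r' \<in> R" "t' \<in> U2" using XE[OF xy(2)] by blast
    show "x + y \<in> X" using XI[OF plus_R[OF r(2) r'(2)] subspace_add[OF sU2 r(3) r'(3)]]
      unfolding r(1) r'(1) by (simp add: algebra_simps)
  next
    fix c x assume "x \<in> X"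
    then obtain r t where *: "x = r u + t" "r \<in> R" "t \<in> U2" using XE by blast
    show "c *s x \<in> X" using XI[OF smult_R[OF *(2), of c] subspace_scale[OF sU2 *(3), of c]]
      unfolding *(1) by (simp add: scale_right_distrib)
  qed
  have uX: "u \<in> X" using XI[OF id_R subspace_0[OF sU2]] by simp
  have XU: "X \<subseteq> U1" unfolding X_def using U1_stable u(1) U2_sub subspace_add[OF sU1] by auto
  have "x v \<in> X" if x: "x \<in> R" and v: "v \<in> X" for x v
  proof -
    obtain r t where *: "v = r u + t" "r \<in> R" "t \<in> U2" using XE[OF v] by blast
    have "x v = x (r u) + x t"
      using *(1) endo_add[OF R_endo[OF x] R_mem[OF *(2) uV]] *(3) U2_sub U1_sub by auto
    then show ?thesis using XI[OF comp_R[OF x *(2)] U2_stable[OF x *(3)]] by simp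
  qed
  then have "X = U1" using irreducible[OF X _ XU] U2X uX u(2) by blast
  then have "w \<in> X" using w by simp
  from XE[OF this] obtain r t where "w = r u + t" "r \<in> R" "t \<in> U2" by blast
  then show thesis using that[of r] by simp
qed

section \<open>Idempotents that survive on the subquotient\<close>

definition idem :: "('v \<Rightarrow> 'v) \<Rightarrow> bool" where
  "idem e \<longleftrightarrow> e \<in> R \<and> (\<forall>v\<in>V. e (e v) = e v)"

definition live :: "('v \<Rightarrow> 'v) \<Rightarrow> bool" where
  "live e \<longleftrightarrow> (\<exists>u\<in>U1. e u \<notin> U2)"

text \<open>For idempotents this is the usual order; in general it says that \<open>h\<close> lies
  in the corner ring \<open>f R f\<close> once \<open>h\<close> is in \<open>R\<close>, and it is
  applied to such elements too.\<close>

definition below :: "('v \<Rightarrow> 'v) \<Rightarrow> ('v \<Rightarrow> 'v) \<Rightarrow> bool" where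
  "below h f \<longleftrightarrow> (\<forall>v\<in>V. f (h v) = h v \<and> h (f v) = h v)"

text \<open>Rank on \<open>V\<close> is compared among live idempotents only. In an orthogonal
  splitting of a live \<open>f\<close> into two idempotents of \<open>R\<close> some summand is
  live, hence of full rank by minimality, so the other one vanishes: this is primitivity in the
  usual sense.\<close>

definition primitive :: "('v \<Rightarrow> 'v) \<Rightarrow> bool" where
  "primitive f \<longleftrightarrow> idem f \<and> live f \<and> (\<forall>h. idem h \<longrightarrow> live h \<longrightarrow> below h f \<longrightarrow> dim (f ` V) \<le> dim (h ` V))"

definition nilp :: "('v \<Rightarrow> 'v) \<Rightarrow> bool" where
  "nilp x \<longleftrightarrow> (\<exists>n. \<forall>v\<in>V. (x ^^ n) v = 0)"

lemma idem_R: "idem f \<Longrightarrow> f \<in> R" and idem_idem: "idem f \<Longrightarrow> v \<in> V \<Longrightarrow> f (f v) = f v"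
  unfolding idem_def by auto

lemma primitive_idem: "primitive f \<Longrightarrow> idem f" and primitive_live: "primitive f \<Longrightarrow> live f"
  unfolding primitive_def by auto

lemma belowD: "below h f \<Longrightarrow> v \<in> V \<Longrightarrow> f (h v) = h v" "below h f \<Longrightarrow> v \<in> V \<Longrightarrow> h (f v) = h v"
  unfolding below_def by auto

lemma image_R: "x \<in> R \<Longrightarrow> subspace (x ` V) \<and> x ` V \<subseteq> V \<and> finite_dim scale (x ` V)"
  using subspace_endo_image[OF R_endo sV order_refl] R_mem finite_dim_subset[OF fin] by (auto simp: image_subset_iff)

lemma fixed_of_image: "idem f \<Longrightarrow> v \<in> f ` V \<Longrightarrow> f v = v"
  using idem_idem by auto

lemma live_image_nonzero:
  assumes "live f" "f \<in> R" shows "f ` V \<noteq> {0}"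
proof -
  obtain u where "u \<in> U1" "f u \<notin> U2" using assms(1) unfolding live_def by auto
  then have "f u \<noteq> 0" "f u \<in> f ` V" using subspace_0[OF sU2] U1_sub by auto
  then show ?thesis by auto
qed

text \<open>Both parts of the Fitting decomposition of \<open>y\<close> are stable under
  \<open>B\<close>, so by uniqueness of components the projection onto the image part commutes with
  \<open>B\<close> and lies in the commutant again.\<close>

lemma fitting_idempotent:
  assumes y: "y \<in> R"
  obtains q n where "idem q" "\<And>v. v \<in> V \<Longrightarrow> q v \<in> (y ^^ n) ` V" "\<And>v. v \<in> V \<Longrightarrow> (y ^^ n) (v - q v) = 0"
    "\<And>v a. v \<in> V \<Longrightarrow> a \<in> (y ^^ n) ` V \<Longrightarrow> (y ^^ n) (v - a) = 0 \<Longrightarrow> q v = a" "0 < n"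
proof -
  note ye = endo_funpow[OF R_endo[OF y]]
  obtain n where n: "{v\<in>V. (y ^^ n) v = 0} \<inter> (y ^^ n) ` V = {0}"
    "\<And>v. v \<in> V \<Longrightarrow> \<exists>a\<in>(y ^^ n) ` V. \<exists>b\<in>{v\<in>V. (y ^^ n) v = 0}. v = a + b" "0 < n"
    by (fact fitting[OF fin R_endo[OF y]])
  define I where "I = (y ^^ n) ` V"
  define K where "K = {v\<in>V. (y ^^ n) v = 0}"
  have sI: "subspace I" unfolding I_def by (rule subspace_endo_image[OF ye sV order_refl])
  have IV: "I \<subseteq> V" unfolding I_def using endo_mem[OF ye] by auto
  have sK: "subspace K" unfolding K_def by (rule subspace_endo_kernel[OF ye sV])
  have IK: "I \<inter> K = {0}" using n(1) unfolding I_def K_def by (simp add: Int_commute)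
  have dec: "\<forall>v\<in>V. \<exists>a\<in>I. \<exists>b\<in>K. v = a + b" using n(2) unfolding I_def K_def by blast
  obtain q where q: "endo scale V q" "\<And>x. x \<in> V \<Longrightarrow> q x \<in> I" "\<And>x. x \<in> V \<Longrightarrow> x - q x \<in> K"
    "\<And>x a. x \<in> V \<Longrightarrow> a \<in> I \<Longrightarrow> x - a \<in> K \<Longrightarrow> q x = a"
    by (fact projection_exists[OF sV sI sK IV IK dec])
  have yb: "(y ^^ k) (b v) = b ((y ^^ k) v)" if "b \<in> B" "v \<in> V" for b v k
    using that R_comm[OF y that(1) endo_mem[OF endo_funpow[OF R_endo[OF y]] that(2)]] by (induction k) auto
  have "q (b v) = b (q v)" if b: "b \<in> B" and v: "v \<in> V" for b v
  proof (rule q(4))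
    note be = B_endo[OF b]
    show "b v \<in> V" using endo_mem[OF be v] .
    obtain a where a: "a \<in> V" "q v = (y ^^ n) a" using q(2)[OF v] unfolding I_def by auto
    then have "b (q v) = (y ^^ n) (b a)" using yb[OF b a(1)] by simp
    then show "b (q v) \<in> I" unfolding I_def using endo_mem[OF be a(1)] by auto
    have "v - q v \<in> K" using q(3)[OF v] .
    then have "b (v - q v) \<in> K"
      unfolding K_def using yb[OF b] endo_mem[OF be] endo_zero[OF be sV] by auto
    then show "b v - b (q v) \<in> K" using endo_diff[OF be sV v] q(2)[OF v] IV by auto
  qed
  then have qR: "q \<in> R" unfolding commutant_def using q(1) by auto
  have "q (q v) = q v" if v: "v \<in> V" for v
    by (rule q(4)) (use q(2)[OF v] IV subspace_0[OF sK] in auto)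
  then have "idem q" unfolding idem_def using qR by blast
  moreover have "(y ^^ n) (v - q v) = 0" if "v \<in> V" for v using q(3)[OF that] unfolding K_def by auto
  moreover have "q v = a" if "v \<in> V" "a \<in> (y ^^ n) ` V" "(y ^^ n) (v - a) = 0" for v a
    using q(4)[of v a] that subspace_diff[OF sV, of v a] IV unfolding I_def K_def by blast
  moreover have "q v \<in> (y ^^ n) ` V" if "v \<in> V" for v using q(2)[OF that] unfolding I_def .
  ultimately show thesis using that n(3) by blast
qed

text \<open>Otherwise the Fitting projections of \<open>x - l f\<close> would split \<open>f\<close>.\<close>

lemma primitive_single_eigenvalue:
  assumes f: "primitive f" and x: "x \<in> R" "below x f"
  obtains l where "nilp (\<lambda>v. x v - l *s f v)"
proof -
  have fi: "idem f" using f primitive_idem by auto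
  note fR = idem_R[OF fi]
  have fV: "f ` V \<noteq> {0}" using live_image_nonzero[OF primitive_live[OF f] fR] .
  note fI = image_R[OF fR]
  have "endo scale (f ` V) x"
    by (rule endo_subset[OF R_endo[OF x(1)]])
      (use fI belowD[OF x(2)] R_mem[OF x(1)] in \<open>auto simp: image_iff\<close>, metis)
  then obtain l v0 where v0: "v0 \<in> f ` V" "v0 \<noteq> 0" "x v0 = l *s v0"
    using eigenvector_exists fI fV by metis
  define y where "y = (\<lambda>v. x v - l *s f v)"
  have yR: "y \<in> R" unfolding y_def by (rule minus_R[OF x(1) smult_R[OF fR]])
  have yf: "f (y v) = y v" "y (f v) = y v" if v: "v \<in> V" for v
    using that belowD[OF x(2) v] idem_idem[OF fi v]
      R_diff[OF fR R_mem[OF x(1) v] subspace_scale[OF sV R_mem[OF fR v]]]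
      endo_scale[OF R_endo[OF fR] R_mem[OF fR v]] unfolding y_def by auto
  obtain q n where q: "idem q" "\<And>v. v \<in> V \<Longrightarrow> q v \<in> (y ^^ n) ` V" "\<And>v. v \<in> V \<Longrightarrow> (y ^^ n) (v - q v) = 0"
    "\<And>v a. v \<in> V \<Longrightarrow> a \<in> (y ^^ n) ` V \<Longrightarrow> (y ^^ n) (v - a) = 0 \<Longrightarrow> q v = a" "0 < n"
    by (fact fitting_idempotent[OF yR])
  obtain k where nk: "n = Suc k" using q(5) by (cases n) auto
  have yfix: "f v = v" if v: "v \<in> (y ^^ n) ` V" for v
  proof -
    obtain a where a: "a \<in> V" "v = (y ^^ n) a" using v by auto
    then show ?thesis using yf(1)[OF endo_mem[OF endo_funpow[OF R_endo[OF yR]] a(1)], of k] nk by auto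
  qed
  have y0: "y 0 = 0" using endo_zero[OF R_endo[OF yR] sV] .
  have yn0: "(y ^^ n) v = 0" if "y v = 0" for v
    unfolding nk funpow_Suc_right o_apply that
    using endo_zero[OF endo_funpow[OF R_endo[OF yR]] sV] .
  note qR = idem_R[OF q(1)]
  have fq: "f (q v) = q v" if v: "v \<in> V" for v using yfix[OF q(2)[OF v]] .
  have qf: "q (f v) = q v" if v: "v \<in> V" for v
  proof (rule q(4))
    show "f v \<in> V" "q v \<in> (y ^^ n) ` V" using R_mem[OF fR v] q(2)[OF v] .
    have "y (v - f v) = 0" using R_diff[OF yR v R_mem[OF fR v]] yf(2)[OF v] by simp
    then have "(y ^^ n) (v - f v) = 0" by (rule yn0)
    moreover have "(y ^^ n) (v - q v) = 0" using q(3)[OF v] .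
    moreover have "f v - q v = (v - q v) - (v - f v)" by simp
    moreover have "v - q v \<in> V" "v - f v \<in> V" using v R_mem[OF fR v] R_mem[OF qR v] subspace_diff[OF sV] by auto
    ultimately show "(y ^^ n) (f v - q v) = 0"
      using endo_diff[OF endo_funpow[OF R_endo[OF yR]] sV, of "v - q v" "v - f v" n] by simp
  qed
  have bq: "below q f" unfolding below_def using fq qf by auto
  \<comment> \<open>A live \<open>q\<close> would have the same image as \<open>f\<close> by
    minimality and would fix the eigenvector \<open>v0\<close>; but \<open>y\<close> kills
    \<open>v0\<close>, and therefore so does \<open>q\<close>.\<close>
  have "\<not> live q"
  proof
    assume "live q"
    then have "dim (f ` V) \<le> dim (q ` V)" using f q(1) bq unfolding primitive_def by blast
    moreover have "q ` V \<subseteq> f ` V" using fq R_mem[OF qR] by (metis image_eqI image_subsetI)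
    ultimately have "q ` V = f ` V" using finite_dim_eqI image_R[OF qR] fI by metis
    then have "q v0 = v0" using fixed_of_image[OF q(1), of v0] v0(1) by simp
    moreover have v0V: "v0 \<in> V" using v0(1) fI by auto
    have "y v0 = 0" unfolding y_def using fixed_of_image[OF fi v0(1)] v0(3) by simp
    then have "(y ^^ n) (v0 - 0) = 0" using yn0 by simp
    moreover have "0 \<in> (y ^^ n) ` V" using subspace_0 subspace_endo_image[OF endo_funpow[OF R_endo[OF yR]] sV order_refl] by blast
    ultimately show False using q(4)[OF v0V, of 0] v0(2) by simp
  qed
  then have q2: "q u \<in> U2" if "u \<in> U1" for u using that unfolding live_def by auto
  \<comment> \<open>As \<open>q\<close> is zero on the subquotient, \<open>f - q\<close> is live and
    thus of full rank. This forces \<open>q\<close> to vanish on \<open>V\<close>, so the kernel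
    part of \<open>y\<close> is everything.\<close>
  define h where "h = (\<lambda>v. f v - q v)"
  have hR: "h \<in> R" unfolding h_def by (rule minus_R[OF fR qR])
  have fh: "f (h v) = h v" and hf: "h (f v) = h v" and qh: "q (h v) = 0" if v: "v \<in> V" for v
    unfolding h_def using v R_mem[OF fR v] R_mem[OF qR v] idem_idem[OF fi v] idem_idem[OF q(1) v] fq[OF v] qf[OF v]
      R_diff[OF fR] R_diff[OF qR] by auto
  have hi: "idem h" unfolding idem_def
    using hR fh qh R_mem[OF hR] by (auto simp: h_def)
  have "live h"
  proof -
    obtain u where u: "u \<in> U1" "f u \<notin> U2" using primitive_live[OF f] unfolding live_def by auto
    then have "h u \<notin> U2" unfolding h_def using q2[OF u(1)] subspace_add[OF sU2, of "f u - q u" "q u"] by auto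
    then show ?thesis unfolding live_def using u by auto
  qed
  moreover have "below h f" unfolding below_def using fh hf by auto
  ultimately have "dim (f ` V) \<le> dim (h ` V)" using f hi unfolding primitive_def by blast
  moreover have "h ` V \<subseteq> f ` V" using fh R_mem[OF hR] by (metis image_eqI image_subsetI)
  ultimately have hV: "h ` V = f ` V" using finite_dim_eqI image_R[OF hR] fI by metis
  have q0: "q v = 0" if v: "v \<in> V" for v
  proof -
    obtain w where w: "w \<in> V" "f v = h w" using hV v by (metis imageE imageI)
    then show ?thesis using qf[OF v] qh[OF w(1)] by simp
  qed
  have "(y ^^ n) v = 0" if v: "v \<in> V" for v using q(3)[OF v] q0[OF v] by simp
  then show thesis using that[of l] unfolding nilp_def y_def by blast
qed

text \<open>On an eigenvector fixed by \<open>f\<close> the nilpotent operator is multiplication by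
  \<open>c - l\<close>, some power of which must be \<open>0\<close>.\<close>

lemma nilp_eigenvalue:
  assumes f: "idem f" and y: "nilp (\<lambda>v. x v - l *s f v)" and x: "x \<in> R"
    and v: "v \<in> V" "v \<noteq> 0" "f v = v" "x v = c *s v"
  shows "c = l"
proof -
  define y where "y = (\<lambda>v. x v - l *s f v)"
  have e: "endo scale V y" unfolding y_def using R_endo[OF minus_R[OF x smult_R[OF idem_R[OF f]]]] .
  have "(y ^^ n) v = ((c - l) ^ n) *s v" for n
  proof (induction n)
    case (Suc n)
    have "y v = (c - l) *s v" unfolding y_def using v by (simp add: scale_left_diff_distrib)
    then show ?case using Suc endo_scale[OF e v(1)] by (simp add: mult.commute)
  qed simp
  moreover obtain n where "\<forall>v\<in>V. (y ^^ n) v = 0" using assms(2) unfolding nilp_def y_def by blast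
  ultimately have "((c - l) ^ n) *s v = 0" using v(1) by metis
  then show ?thesis using v(2) by simp
qed

text \<open>If \<open>u\<close> is congruent to \<open>x u\<close>, then it is congruent to every
  \<open>(x ^^ n) u\<close>, and these are eventually \<open>0\<close>.\<close>

lemma nilp_mod:
  assumes x: "x \<in> R" "nilp x" and u: "u \<in> U1" "u - x u \<in> U2"
  shows "u \<in> U2"
proof -
  have "u - (x ^^ n) u \<in> U2" for n
  proof (induction n)
    case 0 then show ?case using subspace_0[OF sU2] by simp
  next
    case (Suc n)
    have m: "(x ^^ n) u \<in> V" using endo_mem[OF endo_funpow[OF R_endo[OF x(1)]]] u(1) U1_sub by auto
    have "x (u - (x ^^ n) u) \<in> U2" using U2_stable[OF x(1) Suc] .
    then have "x u - (x ^^ Suc n) u \<in> U2" using R_diff[OF x(1) _ m, of u] u(1) U1_sub by auto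
    then show ?case using subspace_add[OF sU2 u(2)] by fastforce
  qed
  moreover obtain n where "\<forall>v\<in>V. (x ^^ n) v = 0" using x(2) unfolding nilp_def by blast
  then have "(x ^^ n) u = 0" using u(1) U1_sub by auto
  ultimately show ?thesis by (metis diff_zero)
qed

text \<open>
  The nilpotent elements of \<open>f R f\<close> form an ideal, since every element of \<open>f R f\<close> has a single
  eigenvalue; as \<open>f U\<^sub>1 / f U\<^sub>2\<close> is irreducible over \<open>f R f\<close>, they act on it as zero.
\<close>

lemma primitive_nilp_kills:
  assumes f: "primitive f" and x: "x \<in> R" "below x f" "nilp x" and u: "u \<in> U1" "f u = u"
  shows "x u \<in> U2"
proof (rule ccontr)
  assume n: "x u \<notin> U2"
  have fi: "idem f" using f primitive_idem by auto
  note fR = idem_R[OF fi]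
  have uV: "u \<in> V" using u U1_sub by auto
  have u0: "u \<noteq> 0"
  proof
    assume "u = 0"
    then have "x u = 0" using endo_zero[OF R_endo[OF x(1)] sV] by simp
    then show False using n subspace_0[OF sU2] by simp
  qed
  \<comment> \<open>If \<open>x u\<close> is nonzero in the subquotient, some \<open>r\<close> sends
    it back to \<open>u\<close>. Then \<open>f r x\<close> fixes \<open>u\<close> modulo
    \<open>U2\<close>, while a kernel vector \<open>v0\<close> of \<open>x\<close> shows that its
    single eigenvalue is \<open>0\<close>.\<close>
  obtain r where r: "r \<in> R" "u - r (x u) \<in> U2" using generates[OF U1_stable[OF x(1) u(1)] n u(1)] by metis
  define y where "y = (\<lambda>v. f (r (x v)))"
  have yR: "y \<in> R" unfolding y_def by (rule comp_R[OF fR comp_R[OF r(1) x(1)]])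
  have yb: "below y f" unfolding below_def y_def
    using idem_idem[OF fi R_mem[OF r(1) R_mem[OF x(1)]]] belowD[OF x(2)] by auto
  have "f (u - r (x u)) \<in> U2" using U2_stable[OF fR r(2)] .
  then have uy: "u - y u \<in> U2" unfolding y_def
    using R_diff[OF fR uV R_mem[OF r(1) R_mem[OF x(1) uV]]] u(2) by simp
  obtain l where l: "nilp (\<lambda>v. y v - l *s f v)" using primitive_single_eigenvalue[OF f yR yb] .
  obtain v0 where v0: "v0 \<in> V" "v0 \<noteq> 0" "f v0 = v0" "x v0 = 0"
  proof -
    obtain n where "(x ^^ n) u = 0" using x(3) uV unfolding nilp_def by auto
    then obtain k where k: "(x ^^ k) u \<noteq> 0" "(x ^^ Suc k) u = 0"
      using u0 by (induction n) auto
    moreover have "f ((x ^^ k) u) = (x ^^ k) u"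
      using u(2) belowD(1)[OF x(2) endo_mem[OF endo_funpow[OF R_endo[OF x(1)]] uV]] by (cases k) auto
    ultimately show thesis using that[of "(x ^^ k) u"] endo_mem[OF endo_funpow[OF R_endo[OF x(1)]] uV] by auto
  qed
  have "y v0 = 0 *s v0" unfolding y_def v0(4)
    using endo_zero[OF R_endo[OF r(1)] sV] endo_zero[OF R_endo[OF fR] sV] by simp
  then have "l = 0" using nilp_eigenvalue[OF fi l yR v0(1-3)] by auto
  then have "nilp y" using l by simp
  then have "u \<in> U2" using nilp_mod[OF yR _ u(1) uy] by blast
  then show False using n U2_stable[OF x(1)] by auto
qed

text \<open>Choose \<open>r\<close> carrying \<open>f u\<close> to \<open>w\<close> modulo
  \<open>U2\<close>. The element \<open>f r f\<close> is a multiple of \<open>f\<close> plus a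
  nilpotent element, and the latter sends \<open>f u\<close> into \<open>U2\<close> by
  \<open>primitive_nilp_kills\<close>. So \<open>f\<close> has rank one on
  \<open>U1 / U2\<close>.\<close>

lemma primitive_rank_one:
  assumes f: "primitive f" and u: "u \<in> U1" "f u \<notin> U2" and w: "w \<in> U1"
  obtains c where "f w - c *s f u \<in> U2"
proof -
  have fi: "idem f" using f primitive_idem by auto
  note fR = idem_R[OF fi]
  have wV: "w \<in> V" and uV: "u \<in> V" using u w U1_sub by auto
  have fu: "f u \<in> U1" "f (f u) = f u" using U1_stable[OF fR u(1)] idem_idem[OF fi uV] .
  obtain r where r: "r \<in> R" "w - r (f u) \<in> U2" using generates[OF fu(1) u(2) w] .
  define x where "x = (\<lambda>v. f (r (f v)))"
  have xR: "x \<in> R" unfolding x_def by (rule comp_R[OF fR comp_R[OF r(1) fR]])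
  have xb: "f (x v) = x v" "x (f v) = x v" if v: "v \<in> V" for v unfolding x_def
    using idem_idem[OF fi R_mem[OF r(1) R_mem[OF fR v]]] idem_idem[OF fi v] by auto
  obtain l where l: "nilp (\<lambda>v. x v - l *s f v)"
    using primitive_single_eigenvalue[OF f xR] xb unfolding below_def by blast
  let ?y = "\<lambda>v. x v - l *s f v"
  have "?y \<in> R" by (rule minus_R[OF xR smult_R[OF fR]])
  moreover have "below ?y f" unfolding below_def
    using xb idem_idem[OF fi] R_diff[OF fR R_mem[OF xR] subspace_scale[OF sV R_mem[OF fR]]]
      endo_scale[OF R_endo[OF fR] R_mem[OF fR]] by auto
  ultimately have "?y (f u) \<in> U2" using primitive_nilp_kills[OF f _ _ l fu] by blast
  then have a: "f (r (f u)) - l *s f u \<in> U2" unfolding x_def fu(2) .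
  have "f (w - r (f u)) \<in> U2" using U2_stable[OF fR r(2)] .
  then have "f w - f (r (f u)) \<in> U2" using R_diff[OF fR wV R_mem[OF r(1) R_mem[OF fR uV]]] by simp
  then have "f w - l *s f u \<in> U2" using subspace_add[OF sU2 _ a] by fastforce
  then show thesis using that by blast
qed

text \<open>For suitable \<open>r\<close> and \<open>r'\<close> the element
  \<open>f r' e r f\<close> fixes a nonzero vector of \<open>U1 / U2\<close>, so its single
  eigenvalue is nonzero and it is invertible on the image of \<open>f\<close>. That image is thus
  reached through \<open>e\<close> by operators commuting with \<open>b\<close>.\<close>

lemma primitive_link:
  assumes f: "primitive f" and e: "e \<in> R" "live e"
    and b: "b \<in> B" "\<And>v. v \<in> V \<Longrightarrow> b (e v) = 0"
    and v: "v \<in> V"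
  shows "b (f v) = 0"
proof -
  have fi: "idem f" using f primitive_idem by auto
  note fR = idem_R[OF fi]
  obtain u0 where u0: "u0 \<in> U1" "f u0 \<notin> U2" using primitive_live[OF f] unfolding live_def by auto
  define u where "u = f u0"
  have u: "u \<in> U1" "u \<notin> U2" "f u = u" unfolding u_def
    using U1_stable[OF fR] u0 idem_idem[OF fi] U1_sub by auto
  have uV: "u \<in> V" using u U1_sub by auto
  obtain w where w: "w \<in> U1" "e w \<notin> U2" using e unfolding live_def by auto
  obtain r where r: "r \<in> R" "w - r u \<in> U2" using generates[OF u(1,2) w(1)] .
  have "e (w - r u) \<in> U2" using U2_stable[OF e(1) r(2)] .
  then have "e w - e (r u) \<in> U2" using R_diff[OF e(1) _ R_mem[OF r(1) uV], of w] w(1) U1_sub by auto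
  then have ne: "e (r u) \<notin> U2" using w(2) subspace_add[OF sU2, of "e w - e (r u)" "e (r u)"] by auto
  obtain r' where r': "r' \<in> R" "u - r' (e (r u)) \<in> U2"
    using generates[OF U1_stable[OF e(1) U1_stable[OF r(1) u(1)]] ne u(1)] .
  define z where "z = (\<lambda>v. f (r' (e (r (f v)))))"
  have zR: "z \<in> R" unfolding z_def by (rule comp_R[OF fR comp_R[OF r'(1) comp_R[OF e(1) comp_R[OF r(1) fR]]]])
  have zb: "f (z v) = z v" "z (f v) = z v" if v: "v \<in> V" for v unfolding z_def
    using idem_idem[OF fi R_mem[OF r'(1) R_mem[OF e(1) R_mem[OF r(1) R_mem[OF fR v]]]]] idem_idem[OF fi v] by auto
  obtain l where l: "nilp (\<lambda>v. z v - l *s f v)"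
    using primitive_single_eigenvalue[OF f zR] zb unfolding below_def by blast
  have "f (u - r' (e (r u))) \<in> U2" using U2_stable[OF fR r'(2)] .
  then have uz: "u - z u \<in> U2" unfolding z_def
    using R_diff[OF fR uV R_mem[OF r'(1) R_mem[OF e(1) R_mem[OF r(1) uV]]]] u(3) by simp
  have "l \<noteq> 0"
  proof
    assume "l = 0"
    then have "nilp z" using l by simp
    then show False using nilp_mod[OF zR _ u(1) uz] u(2) by blast
  qed
  note fI = image_R[OF fR]
  have ze: "endo scale (f ` V) z"
    by (rule endo_subset[OF R_endo[OF zR]]) (use fI zb R_mem[OF zR] in \<open>auto simp: image_iff\<close>, metis)
  have "z ` (f ` V) = f ` V"
  proof (rule endo_surj_of_inj[OF _ ze])
    show "finite_dim scale (f ` V)" using fI by auto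
    fix x assume x: "x \<in> f ` V" "z x = 0"
    show "x = 0"
    proof (rule ccontr)
      assume "x \<noteq> 0"
      then have "0 = l" using nilp_eigenvalue[OF fi l zR, of x 0] x fixed_of_image[OF fi x(1)] fI by auto
      then show False using \<open>l \<noteq> 0\<close> by simp
    qed
  qed
  then obtain y where y: "y \<in> V" "f v = z (f y)" using v by (metis (no_types, lifting) imageE imageI)
  then have "f v = z y" using zb(2)[OF y(1)] by simp
  moreover have m: "e (r (f y)) \<in> V" "r (f y) \<in> V" 
    using R_mem[OF e(1) R_mem[OF r(1) R_mem[OF fR y(1)]]] R_mem[OF r(1) R_mem[OF fR y(1)]] .
  have "b (z y) = f (r' (b (e (r (f y)))))"
    unfolding z_def using R_comm[OF fR b(1) R_mem[OF r'(1) m(1)]] R_comm[OF r'(1) b(1) m(1)] by simp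
  then have "b (z y) = 0" using b(2)[OF m(2)] endo_zero[OF R_endo[OF r'(1)] sV] endo_zero[OF R_endo[OF fR] sV] by simp
  ultimately show ?thesis by simp
qed

text \<open>The record of cutting \<open>p\<close> into primitive idempotents, \<open>d\<close> in
  number and of rank at least \<open>m\<close>, and a remainder \<open>g\<close>. \<open>T\<close>
  collects one vector per piece and is what will bound the dimension of \<open>U1 / U2\<close> by
  \<open>d\<close>.\<close>

definition decomposes ::
    "('v \<Rightarrow> 'v) \<Rightarrow> nat \<Rightarrow> ('v \<Rightarrow> 'v) \<Rightarrow> ('v \<Rightarrow> 'v) \<Rightarrow> nat \<Rightarrow> 'v set \<Rightarrow> bool" where
  "decomposes e m p g d T \<longleftrightarrow>
    idem g \<and> dim (g ` V) + d * m \<le> dim (p ` V) \<and> finite T \<and> card T \<le> d \<and>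
    (\<forall>w\<in>U1. p w \<in> span (U2 \<union> T)) \<and>
    (\<forall>b\<in>B. (\<forall>v\<in>V. b (e v) = 0) \<longrightarrow> (\<forall>v\<in>V. b (g v) = 0) \<longrightarrow> (\<forall>v\<in>V. b (p v) = 0))"

text \<open>Greedy choice: a live idempotent \<open>f\<close> of least rank below \<open>p\<close>
  is primitive, and \<open>p - f\<close> is an idempotent of smaller rank. The recursion stops when
  the remainder is no longer live.\<close>

lemma idempotent_decomposition:
  assumes e: "e \<in> R" "live e" and m: "\<And>h. idem h \<Longrightarrow> live h \<Longrightarrow> m \<le> dim (h ` V)"
    and p: "idem p"
  shows "\<exists>g d T. decomposes e m p g d T"
  using p
proof (induction "dim (p ` V)" arbitrary: p rule: less_induct)
  case less
  show ?case
  proof (cases "live p")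
    case False
    then have "\<forall>w\<in>U1. p w \<in> span (U2 \<union> {})" unfolding live_def by (auto intro: span_base)
    then have "decomposes e m p p 0 {}" using less.prems unfolding decomposes_def by simp
    then show ?thesis by blast
  next
    case True
    note pR = idem_R[OF less.prems]
    have "idem p \<and> live p \<and> below p p" using less.prems True unfolding below_def idem_def by auto
    then obtain f where f: "idem f" "live f" "below f p"
      and fmin: "\<And>h. idem h \<and> live h \<and> below h p \<Longrightarrow> dim (f ` V) \<le> dim (h ` V)"
      using ex_has_least_nat[of "\<lambda>h. idem h \<and> live h \<and> below h p" p "\<lambda>h. dim (h ` V)"] by blast
    note fR = idem_R[OF f(1)]
    have fprim: "primitive f" unfolding primitive_def
    proof (intro conjI allI impI f(1,2))
      fix h assume h: "idem h" "live h" "below h f"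
      have "below h p" unfolding below_def
      proof
        fix v assume v: "v \<in> V"
        have "p (h v) = p (f (h v))" using belowD(1)[OF h(3) v] by simp
        also have "\<dots> = h v" using belowD(1)[OF f(3) R_mem[OF idem_R[OF h(1)] v]] belowD(1)[OF h(3) v] by simp
        finally have "p (h v) = h v" .
        moreover have "h (p v) = h (f (p v))" using belowD(2)[OF h(3) R_mem[OF pR v]] by simp
        then have "h (p v) = h v" using belowD(2)[OF f(3) v] belowD(2)[OF h(3) v] by simp
        ultimately show "p (h v) = h v \<and> h (p v) = h v" ..
      qed
      then show "dim (f ` V) \<le> dim (h ` V)" using fmin h by blast
    qed
    define p' where "p' = (\<lambda>v. p v - f v)"
    have p'R: "p' \<in> R" unfolding p'_def by (rule minus_R[OF pR fR])
    have fp': "f (p' v) = 0" and pp': "p (p' v) = p' v" if v: "v \<in> V" for v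
      unfolding p'_def using R_diff[OF fR R_mem[OF pR v] R_mem[OF fR v]] R_diff[OF pR R_mem[OF pR v] R_mem[OF fR v]]
        belowD[OF f(3) v] idem_idem[OF f(1) v] idem_idem[OF less.prems v] by auto
    have p'i: "idem p'" unfolding idem_def
      using p'R fp' pp' R_mem[OF p'R] by (auto simp: p'_def)
    have "f ` V \<inter> p' ` V = {0}"
    proof -
      have "v = 0" if "v \<in> f ` V" "v \<in> p' ` V" for v
        using fixed_of_image[OF f(1) that(1)] fp' that(2) by auto
      then show ?thesis using subspace_0 image_R[OF fR] image_R[OF p'R] by blast
    qed
    moreover have "f ` V \<subseteq> p ` V" using belowD(1)[OF f(3)] R_mem[OF fR] by (metis image_eqI image_subsetI)
    moreover have "p' ` V \<subseteq> p ` V" using pp' R_mem[OF p'R] by (metis image_eqI image_subsetI)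
    ultimately have d: "dim (f ` V) + dim (p' ` V) \<le> dim (p ` V)"
      using dim_direct_le image_R[OF fR] image_R[OF p'R] image_R[OF pR] by metis
    have "0 < dim (f ` V)" using dim_pos_iff image_R[OF fR] live_image_nonzero[OF f(2) fR] by metis
    then have lt: "dim (p' ` V) < dim (p ` V)" using d by simp
    obtain g k T where G: "decomposes e m p' g k T" using less.hyps[OF lt p'i] by blast
    then have g: "idem g" "dim (g ` V) + k * m \<le> dim (p' ` V)" "finite T" "card T \<le> k"
      unfolding decomposes_def by auto
    have gspan: "p' w \<in> span (U2 \<union> T)" if "w \<in> U1" for w
      using G that unfolding decomposes_def by simp
    have gkill: "b (p' v) = 0" if "b \<in> B" "\<forall>v\<in>V. b (e v) = 0" "\<forall>v\<in>V. b (g v) = 0" "v \<in> V" for b v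
      using G that unfolding decomposes_def by simp
    obtain u where u: "u \<in> U1" "f u \<notin> U2" using f(2) unfolding live_def by auto
    let ?T = "insert (f u) T"
    have "p w \<in> span (U2 \<union> ?T)" if w: "w \<in> U1" for w
    proof -
      obtain c where c: "f w - c *s f u \<in> U2" using primitive_rank_one[OF fprim u w] .
      then have "f w - c *s f u \<in> span (U2 \<union> ?T)" by (auto intro: span_base)
      moreover have "c *s f u \<in> span (U2 \<union> ?T)" by (intro span_scale span_base) auto
      ultimately have "f w \<in> span (U2 \<union> ?T)" using span_add by fastforce
      moreover have "span (U2 \<union> T) \<subseteq> span (U2 \<union> ?T)" by (rule span_mono) auto
      then have "p' w \<in> span (U2 \<union> ?T)" using gspan[OF w] by auto
      moreover have "p w = f w + p' w" unfolding p'_def by simp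
      ultimately show ?thesis using span_add by auto
    qed
    moreover have "b (p v) = 0" if b: "b \<in> B" "\<forall>v\<in>V. b (e v) = 0" "\<forall>v\<in>V. b (g v) = 0" and v: "v \<in> V" for b v
    proof -
      have "b (p' v) = 0" using gkill[OF b v] .
      moreover have "b (f v) = 0" using primitive_link[OF fprim e b(1) _ v] b(2) by auto
      moreover have "p v = f v + p' v" unfolding p'_def by simp
      ultimately show ?thesis using endo_add[OF B_endo[OF b(1)] R_mem[OF fR v] R_mem[OF p'R v]] by simp
    qed
    moreover have "dim (g ` V) + Suc k * m \<le> dim (p ` V)" using g(2) d m[OF f(1,2)] by simp
    moreover have "card ?T \<le> Suc k" using g(3,4) by (simp add: card_insert_if)
    moreover have "finite ?T" using g(3) by simp
    ultimately have "decomposes e m p g (Suc k) ?T" unfolding decomposes_def using g(1) by simp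
    then show ?thesis by blast
  qed
qed

text \<open>The decomposition is applied to the identity, with \<open>e\<close> a live idempotent of
  least rank. As \<open>T\<close> spans \<open>U1\<close> modulo \<open>U2\<close>, there are at
  least \<open>dim U1 - dim U2\<close> pieces, and each has rank at least that of
  \<open>e\<close>.\<close>

theorem multiplicity_splitting:
  obtains E E' where "splits V B E E'" "dim E' + (dim U1 - dim U2) * dim E \<le> dim V"
proof -
  have idi: "idem (\<lambda>v. v)" unfolding idem_def using id_R by auto
  have "live (\<lambda>v. v)" unfolding live_def using U2_sub U_neq by auto
  then obtain e where e: "idem e" "live e" and emin: "\<And>h. idem h \<and> live h \<Longrightarrow> dim (e ` V) \<le> dim (h ` V)"
    using ex_has_least_nat[of "\<lambda>h. idem h \<and> live h" "\<lambda>v. v" "\<lambda>h. dim (h ` V)"] idi by blast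
  note eR = idem_R[OF e(1)]
  have "\<exists>g d T. decomposes e (dim (e ` V)) (\<lambda>v. v) g d T"
    by (rule idempotent_decomposition[OF eR e(2) _ idi]) (rule emin, simp)
  then obtain g d T where G: "decomposes e (dim (e ` V)) (\<lambda>v. v) g d T" by blast
  then have g: "idem g" "dim (g ` V) + d * dim (e ` V) \<le> dim V" "finite T" "card T \<le> d" "U1 \<subseteq> span (U2 \<union> T)"
    unfolding decomposes_def by auto
  have kill: "b v = 0" if "b \<in> B" "\<And>v. v \<in> V \<Longrightarrow> b (e v) = 0" "\<And>v. v \<in> V \<Longrightarrow> b (g v) = 0" "v \<in> V" for b v
    using G that unfolding decomposes_def by simp
  note gR = idem_R[OF g(1)]
  have "dim U1 \<le> dim U2 + card T"
  proof -
    obtain X where X: "finite X" "span X = U2" "card X = dim U2"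
      using finite_dim_basis[OF finite_dim_subset[OF fin sU2]] U2_sub U1_sub by (metis subset_trans)
    have "U2 \<union> T \<subseteq> span (X \<union> T)"
      using X(2) span_mono[of X "X \<union> T"] span_superset[of "X \<union> T"] by auto
    then have "span (U2 \<union> T) \<subseteq> span (X \<union> T)" by (rule span_minimal) simp
    then have "U1 \<subseteq> span (X \<union> T)" using g(5) by (rule order_trans[rotated])
    then have "dim U1 \<le> card (X \<union> T)" using dim_le_card X(1) g(3) by auto
    also have "\<dots> \<le> dim U2 + card T" using card_Un_le[of X T] X(3) by simp
    finally show ?thesis .
  qed
  then have "(dim U1 - dim U2) * dim (e ` V) \<le> d * dim (e ` V)" using g(4) by (intro mult_le_mono1) simp
  then have dimle: "dim (g ` V) + (dim U1 - dim U2) * dim (e ` V) \<le> dim V" using g(2) by linarith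
  have st: "b v \<in> x ` V" if x: "x \<in> R" and b: "b \<in> B" and v: "v \<in> x ` V" for x b v
  proof -
    obtain u where u: "u \<in> V" "v = x u" using v by auto
    then have "b v = x (b u)" using R_comm[OF x b u(1)] by simp
    then show ?thesis using endo_mem[OF B_endo[OF b] u(1)] by blast
  qed
  have "splits V B (e ` V) (g ` V)" unfolding splits_def
  proof (intro conjI ballI impI)
    show "e ` V \<noteq> {0}" by (rule live_image_nonzero[OF e(2) eR])
    fix b assume b: "b \<in> B"
    show "b ` e ` V \<subseteq> e ` V" "b ` g ` V \<subseteq> g ` V" using st[OF eR b] st[OF gR b] by blast+
    show "b v = 0" if "\<forall>w\<in>e ` V. b w = 0" "\<forall>w\<in>g ` V. b w = 0" "v \<in> V" for v
      by (rule kill[OF b _ _ that(3)]) (use that(1,2) in auto)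
  qed (use image_R[OF eR] image_R[OF gR] in blast)+
  then show thesis using that dimle by blast
qed

end

section \<open>Representations of simple Lie algebras\<close>

definition lie_action ::
    "('k \<Rightarrow> 'g::plus \<Rightarrow> 'g) \<Rightarrow> ('k \<Rightarrow> 'v::{plus,minus} \<Rightarrow> 'v) \<Rightarrow> ('g \<Rightarrow> 'g \<Rightarrow> 'g) \<Rightarrow> 'g set \<Rightarrow> 'v set \<Rightarrow>
      ('g \<Rightarrow> 'v \<Rightarrow> 'v) \<Rightarrow> bool" where
  "lie_action gscale scale bracket A V act \<longleftrightarrow> acts_on gscale scale A V act \<and>
     (\<forall>x\<in>A. \<forall>y\<in>A. \<forall>v\<in>V. act (bracket x y) v = act x (act y v) - act y (act x v))"

lemma lie_action_acts: "lie_action gscale scale bracket A V act \<Longrightarrow> acts_on gscale scale A V act"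
  and lie_action_bracket: "lie_action gscale scale bracket A V act \<Longrightarrow> x \<in> A \<Longrightarrow> y \<in> A \<Longrightarrow> v \<in> V \<Longrightarrow>
    act (bracket x y) v = act x (act y v) - act y (act x v)"
  unfolding lie_action_def by auto

lemma lie_action_subset:
  assumes "lie_action gscale scale bracket A V act" "W \<subseteq> V" "\<And>x v. x \<in> A \<Longrightarrow> v \<in> W \<Longrightarrow> act x v \<in> W"
  shows "lie_action gscale scale bracket A W act"
  using acts_on_subset[OF lie_action_acts[OF assms(1)] order_refl assms(2,3)]
    lie_action_bracket[OF assms(1)] assms(2) unfolding lie_action_def by blast

lemma mat_mult_index:
  assumes "i < p" "j < r"
  shows "(mat p q f * mat q r g) $$ (i, j) = (\<Sum>k<q. f (i, k) * (g (k, j) :: 'k::semiring_0))"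
  using assms by (simp add: scalar_prod_def atLeast0LessThan)

text \<open>The matrices are taken in quotient coordinates. Faithfulness will be extracted from the
  second conclusion: a zero matrix means that \<open>x\<close> acts as zero on
  \<open>U1 / U2\<close>.\<close>

lemma (in space_pair) subquotient_representation:
  assumes fin: "finite_dim scale U1" and U2: "subspace U2" "U2 \<subseteq> U1"
    and act: "lie_action gscale scale bracket A U1 act"
    and stable: "\<And>x u. x \<in> A \<Longrightarrow> u \<in> U2 \<Longrightarrow> act x u \<in> U2"
  obtains \<rho> where "lie_representation gscale bracket A (dim U1 - dim U2) \<rho>"
    "\<And>x u. x \<in> A \<Longrightarrow> \<rho> x = 0\<^sub>m (dim U1 - dim U2) (dim U1 - dim U2) \<Longrightarrow> u \<in> U1 \<Longrightarrow> act x u \<in> U2"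
proof -
  have sU: "subspace U1" using finite_dim_subspace[OF fin] .
  note ac = lie_action_acts[OF act]
  note en = acts_on_endo[OF ac]
  obtain q c \<kappa> where c: "q + dim U2 = dim U1" "\<And>i. i < q \<Longrightarrow> c i \<in> U1"
      "\<And>i. i < q \<Longrightarrow> functional_on scale U1 (\<kappa> i)" "\<And>i t. i < q \<Longrightarrow> t \<in> U2 \<Longrightarrow> \<kappa> i t = 0"
      "\<And>x. x \<in> U1 \<Longrightarrow> x - (\<Sum>i<q. \<kappa> i x *s c i) \<in> U2"
    by (fact quotient_coordinates[OF fin U2])
  have q: "dim U1 - dim U2 = q" using c(1) by simp
  define \<rho> where "\<rho> x = mat q q (\<lambda>(i, j). \<kappa> i (act x (c j)))" for x
  have \<rho>_carrier: "\<rho> x \<in> carrier_mat q q" for x unfolding \<rho>_def by simp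
  have sumU: "(\<Sum>k<q. f k *s c k) \<in> U1" for f
    by (intro subspace_sum[OF sU] subspace_scale[OF sU]) (use c(2) in auto)
  have act_sum: "act x (\<Sum>k<q. f k *s c k) = (\<Sum>k<q. f k *s act x (c k))" if x: "x \<in> A" for x f
    using endo_sum[OF en[OF x] sU, of "{..<q}" "\<lambda>k. f k *s c k"] subspace_scale[OF sU] c(2)
      endo_scale[OF en[OF x]] by simp
  \<comment> \<open>Replacing \<open>u\<close> by the combination of the \<open>c k\<close> with its
    coordinates changes \<open>act x u\<close> only by an element of the stable subspace
    \<open>U2\<close>, which \<open>\<kappa> i\<close> does not see.\<close>
  have \<kappa>_act: "\<kappa> i (act x u) = (\<Sum>k<q. \<kappa> i (act x (c k)) * \<kappa> k u)" if x: "x \<in> A" and i: "i < q" and u: "u \<in> U1" for x i u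
  proof -
    let ?s = "\<Sum>k<q. \<kappa> k u *s c k"
    have "act x u - act x ?s \<in> U2" using endo_diff[OF en[OF x] sU u sumU] stable[OF x c(5)[OF u]] by simp
    then have "\<kappa> i (act x u) - \<kappa> i (act x ?s) = 0"
      using c(4)[OF i] functional_on_diff[OF c(3)[OF i] sU endo_mem[OF en[OF x] u]
        endo_mem[OF en[OF x] sumU[of "\<lambda>k. \<kappa> k u"]]] by simp
    then have "\<kappa> i (act x u) = \<kappa> i (act x ?s)" by simp
    also have "\<dots> = (\<Sum>k<q. \<kappa> i (\<kappa> k u *s act x (c k)))" unfolding act_sum[OF x]
      by (rule functional_on_sum[OF c(3)[OF i] sU]) (use subspace_scale[OF sU] endo_mem[OF en[OF x] c(2)] in auto)
    also have "\<dots> = (\<Sum>k<q. \<kappa> i (act x (c k)) * \<kappa> k u)"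
      by (rule sum.cong) (use functional_on_scale[OF c(3)[OF i]] endo_mem[OF en[OF x] c(2)] in \<open>auto simp: mult.commute\<close>)
    finally show ?thesis .
  qed
  have prod: "(\<rho> x * \<rho> y) $$ (i, j) = \<kappa> i (act x (act y (c j)))"
    if "x \<in> A" "y \<in> A" "i < q" "j < q" for x y i j
    unfolding \<rho>_def mat_mult_index[OF that(3,4)] using \<kappa>_act[OF that(1,3) endo_mem[OF en[OF that(2)] c(2)[OF that(4)]]]
    by simp
  have "lie_representation gscale bracket A q \<rho>"
    unfolding lie_representation_def
  proof (intro conjI ballI allI)
    show "\<rho> x \<in> carrier_mat q q" for x by (rule \<rho>_carrier)
    show "\<rho> (x + y) = \<rho> x + \<rho> y" if "x \<in> A" "y \<in> A" for x y
      by (rule eq_matI) (use acts_on_add[OF ac c(2) that] functional_on_add[OF c(3) endo_mem[OF en[OF that(1)] c(2)] endo_mem[OF en[OF that(2)] c(2)]]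
        in \<open>auto simp: \<rho>_def\<close>)
    show "\<rho> (a *g x) = a \<cdot>\<^sub>m \<rho> x" if "x \<in> A" for a x
      by (rule eq_matI) (use acts_on_scale[OF ac c(2) that] functional_on_scale[OF c(3) endo_mem[OF en[OF that] c(2)]]
        in \<open>auto simp: \<rho>_def\<close>)
    show "\<rho> (bracket x y) = \<rho> x * \<rho> y - \<rho> y * \<rho> x" if xy: "x \<in> A" "y \<in> A" for x y
    proof (rule eq_matI)
      have cr: "\<rho> x * \<rho> y \<in> carrier_mat q q" "\<rho> y * \<rho> x \<in> carrier_mat q q" unfolding \<rho>_def by auto
      then show "dim_row (\<rho> (bracket x y)) = dim_row (\<rho> x * \<rho> y - \<rho> y * \<rho> x)"
        "dim_col (\<rho> (bracket x y)) = dim_col (\<rho> x * \<rho> y - \<rho> y * \<rho> x)" unfolding \<rho>_def by auto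
      fix i j assume "i < dim_row (\<rho> x * \<rho> y - \<rho> y * \<rho> x)" "j < dim_col (\<rho> x * \<rho> y - \<rho> y * \<rho> x)"
      then have ij: "i < q" "j < q" using cr by auto
      have "\<rho> (bracket x y) $$ (i, j) = \<kappa> i (act x (act y (c j)) - act y (act x (c j)))"
        unfolding \<rho>_def using ij lie_action_bracket[OF act xy c(2)[OF ij(2)]] by simp
      also have "\<dots> = (\<rho> x * \<rho> y) $$ (i, j) - (\<rho> y * \<rho> x) $$ (i, j)"
        unfolding prod[OF xy ij] prod[OF xy(2,1) ij]
        by (rule functional_on_diff[OF c(3)[OF ij(1)] sU]) (use endo_mem[OF en] xy c(2)[OF ij(2)] in auto)
      also have "\<dots> = (\<rho> x * \<rho> y - \<rho> y * \<rho> x) $$ (i, j)"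
        using \<rho>_carrier[of x] \<rho>_carrier[of y] ij by (simp del: index_mult_mat(1))
      finally show "\<rho> (bracket x y) $$ (i, j) = (\<rho> x * \<rho> y - \<rho> y * \<rho> x) $$ (i, j)" .
    qed
  qed
  moreover have "act x u \<in> U2" if x: "x \<in> A" and 0: "\<rho> x = 0\<^sub>m q q" and u: "u \<in> U1" for x u
  proof -
    have "\<kappa> i (act x (c j)) = 0" if "i < q" "j < q" for i j
    proof -
      have "\<rho> x $$ (i, j) = 0" unfolding 0 using that by simp
      then show ?thesis unfolding \<rho>_def using that by simp
    qed
    then have "\<kappa> i (act x u) = 0" if "i < q" for i using \<kappa>_act[OF x that u] that by simp
    then show ?thesis using c(5)[OF endo_mem[OF en[OF x] u]] by simp
  qed
  ultimately show thesis using that unfolding q by blast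
qed

section \<open>Faithfulness, minimal dimension and consequences of simplicity\<close>

lemma lie_representation_zero:
  assumes "vector_space scale" "Modules.module.subspace scale L" "lie_representation scale bracket L n \<rho>"
  shows "\<rho> 0 = 0\<^sub>m n n"
proof -
  interpret vector_space scale by (rule assms(1))
  have 0: "0 \<in> L" using subspace_0[OF assms(2)] .
  have "\<rho> (scale 0 0) = 0 \<cdot>\<^sub>m \<rho> 0" using assms(3) 0 unfolding lie_representation_def by blast
  moreover have "\<rho> 0 \<in> carrier_mat n n" using assms(3) 0 unfolding lie_representation_def by blast
  then have "0 \<cdot>\<^sub>m \<rho> 0 = 0\<^sub>m n n" by (auto intro!: eq_matI)
  ultimately show ?thesis by simp
qed

lemma faithful_representationI:
  assumes "vector_space scale" "Modules.module.subspace scale L" "lie_representation scale bracket L n \<rho>"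
    and ker: "\<And>x. x \<in> L \<Longrightarrow> \<rho> x = 0\<^sub>m n n \<Longrightarrow> x = 0"
  shows "faithful_representation scale bracket L n \<rho>"
proof -
  interpret vector_space scale by (rule assms(1))
  have "x = y" if xy: "x \<in> L" "y \<in> L" "\<rho> x = \<rho> y" for x y
  proof -
    have c: "\<rho> x \<in> carrier_mat n n" "\<rho> y \<in> carrier_mat n n" using assms(3) xy unfolding lie_representation_def by blast+
    have "\<rho> (x + scale (-1) y) = \<rho> x + (-1) \<cdot>\<^sub>m \<rho> y"
      using assms(3) xy subspace_scale[OF assms(2) xy(2)] unfolding lie_representation_def by metis
    also have "\<dots> = 0\<^sub>m n n" using c xy(3) by (auto intro!: eq_matI)
    finally have "x + scale (-1) y = 0" using ker subspace_add[OF assms(2) xy(1) subspace_scale[OF assms(2) xy(2)]] by blast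
    then show ?thesis by simp
  qed
  then show ?thesis unfolding faithful_representation_def inj_on_def using assms(3) by blast
qed

lemma lie_mu_le: "faithful_representation scale bracket L n \<rho> \<Longrightarrow> lie_mu scale bracket L \<le> n"
  unfolding lie_mu_def by (rule Least_le) blast

text \<open>\<open>LEAST\<close> carries information only once some faithful representation is
  known, so one has to be supplied.\<close>

lemma lie_mu_attained:
  assumes "faithful_representation scale bracket L n \<rho>"
  obtains \<rho>' where "faithful_representation scale bracket L (lie_mu scale bracket L) \<rho>'"
  using LeastI_ex[of "\<lambda>n. \<exists>\<rho>. faithful_representation scale bracket L n \<rho>"] assms
  unfolding lie_mu_def by blast

lemma lie_ideal_lie_algebra:
  assumes "lie_algebra scale bracket L" "lie_ideal scale bracket L I"
  shows "lie_algebra scale bracket I"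
proof -
  interpret lie_algebra scale bracket L by (rule assms(1))
  have I: "subspace I" "I \<subseteq> L" "\<And>x y. x \<in> L \<Longrightarrow> y \<in> I \<Longrightarrow> bracket x y \<in> I"
    using assms(2) unfolding lie_ideal_def by auto
  show ?thesis
  proof unfold_locales
    show "bracket x (bracket y z) + bracket y (bracket z x) + bracket z (bracket x y) = 0" if "x \<in> I" "y \<in> I" "z \<in> I" for x y z
      using jacobi that I(2) by blast
  qed (use I bracket_add_left bracket_add_right bracket_scale_left bracket_scale_right bracket_self in \<open>auto simp: subset_iff\<close>)
qed

lemma (in lie_algebra) bracket_anticomm:
  assumes "x \<in> L" "y \<in> L" shows "bracket x y = - bracket y x"
proof -
  have s: "x + y \<in> L" using subspace_add[OF subspace_carrier assms] .
  have "bracket (x + y) (x + y) = bracket x x + bracket x y + (bracket y x + bracket y y)"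
    using bracket_add_left[OF assms s] bracket_add_right[OF assms(1) assms] bracket_add_right[OF assms(2) assms] by simp
  then show ?thesis using bracket_self[OF s] bracket_self assms by (simp add: eq_neg_iff_add_eq_0)
qed

lemma (in lie_algebra) bracket_zero:
  assumes "x \<in> L" shows "bracket 0 x = 0" "bracket x 0 = 0"
  using bracket_scale_left[OF assms assms, of 0] bracket_scale_right[OF assms assms, of 0] by auto

text \<open>The span of the brackets is an ideal, and it is nonzero since a simple algebra is not
  abelian.\<close>

lemma (in lie_algebra) simple_span_brackets:
  assumes simple: "lie_simple scale bracket L"
  shows "span {bracket x y |x y. x \<in> L \<and> y \<in> L} = L" (is "span ?D = L")
proof -
  have "?D \<subseteq> L" using bracket_closed by auto
  then have sub: "span ?D \<subseteq> L" using span_minimal subspace_carrier by blast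
  have "bracket x y \<in> span ?D" if "x \<in> L" "y \<in> span ?D" for x y
    using that sub by (intro span_base) auto
  then have "lie_ideal scale bracket L (span ?D)" unfolding lie_ideal_def using sub by auto
  then have "span ?D = {0} \<or> span ?D = L" using simple unfolding lie_simple_def by blast
  moreover have "span ?D \<noteq> {0}"
  proof
    assume "span ?D = {0}"
    then have "bracket x y = 0" if "x \<in> L" "y \<in> L" for x y
      using span_base[of "bracket x y" ?D] that by auto
    then show False using simple unfolding lie_simple_def lie_abelian_def by blast
  qed
  ultimately show ?thesis by blast
qed

text \<open>A simple algebra equals its derived algebra, so a linear property has to be checked on
  brackets only.\<close>

lemma (in lie_algebra) simple_induct:
  assumes "lie_simple scale bracket L" "subspace T" "\<And>x y. x \<in> L \<Longrightarrow> y \<in> L \<Longrightarrow> bracket x y \<in> T" "x \<in> L"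
  shows "x \<in> T"
  using span_minimal[of "{bracket x y |x y. x \<in> L \<and> y \<in> L}" T] simple_span_brackets[OF assms(1)] assms by auto

lemma (in lie_algebra) subspace_representation_kernel:
  assumes "lie_representation scale bracket L n \<rho>"
  shows "subspace {x\<in>L. \<rho> x = 0\<^sub>m n n}"
proof (rule subspaceI)
  show "0 \<in> {x\<in>L. \<rho> x = 0\<^sub>m n n}"
    using lie_representation_zero[OF vector_space_axioms subspace_carrier assms] subspace_0[OF subspace_carrier] by simp
qed (use assms subspace_carrier in \<open>auto simp: lie_representation_def subspace_add subspace_scale\<close>)

text \<open>The kernel is an ideal, so a single nonzero operator decides.\<close>

lemma (in lie_algebra) simple_representation_faithful:
  assumes simple: "lie_simple scale bracket L" and \<rho>: "lie_representation scale bracket L n \<rho>"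
    and nz: "x0 \<in> L" "\<rho> x0 \<noteq> 0\<^sub>m n n"
  shows "faithful_representation scale bracket L n \<rho>"
proof -
  let ?K = "{x\<in>L. \<rho> x = 0\<^sub>m n n}"
  have "bracket x y \<in> ?K" if x: "x \<in> L" and y: "y \<in> ?K" for x y
  proof -
    have "\<rho> (bracket x y) = \<rho> x * 0\<^sub>m n n - 0\<^sub>m n n * \<rho> x" using \<rho> x y unfolding lie_representation_def by auto
    also have "\<dots> = 0\<^sub>m n n" using \<rho> x unfolding lie_representation_def by auto
    finally show ?thesis using bracket_closed x y by auto
  qed
  then have "lie_ideal scale bracket L ?K"
    unfolding lie_ideal_def using subspace_representation_kernel[OF \<rho>] by auto
  then have "?K = {0} \<or> ?K = L" using simple unfolding lie_simple_def by blast
  then have "?K = {0}" using nz by auto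
  then show ?thesis by (intro faithful_representationI[OF vector_space_axioms subspace_carrier \<rho>]) auto
qed

definition mat_trace :: "'k::comm_ring_1 mat \<Rightarrow> 'k" where
  "mat_trace M = (\<Sum>i<dim_row M. M $$ (i, i))"

lemma mat_trace_mult_comm:
  assumes "M \<in> carrier_mat n n" "N \<in> carrier_mat n n"
  shows "mat_trace (M * N) = mat_trace (N * M)"
proof -
  have "mat_trace (M * N) = (\<Sum>i<n. \<Sum>k<n. M $$ (i, k) * N $$ (k, i))"
    using assms by (auto simp: mat_trace_def scalar_prod_def atLeast0LessThan intro!: sum.cong)
  also have "\<dots> = (\<Sum>k<n. \<Sum>i<n. N $$ (k, i) * M $$ (i, k))"
    by (subst sum.swap) (simp add: mult.commute)
  also have "\<dots> = mat_trace (N * M)"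
    using assms by (auto simp: mat_trace_def scalar_prod_def atLeast0LessThan intro!: sum.cong)
  finally show ?thesis .
qed

text \<open>Commutators of matrices have trace zero, and brackets span the algebra.\<close>

lemma (in lie_algebra) simple_representation_trace:
  assumes simple: "lie_simple scale bracket L" and \<rho>: "lie_representation scale bracket L n \<rho>" and x: "x \<in> L"
  shows "mat_trace (\<rho> x) = 0"
proof -
  have c: "\<rho> x \<in> carrier_mat n n" if "x \<in> L" for x using \<rho> that unfolding lie_representation_def by blast
  let ?T = "{x\<in>L. mat_trace (\<rho> x) = 0}"
  have "x \<in> ?T"
  proof (rule simple_induct[OF simple _ _ x])
    show "subspace ?T"
    proof (rule subspaceI)
      show "0 \<in> ?T"
        using lie_representation_zero[OF vector_space_axioms subspace_carrier \<rho>] subspace_0[OF subspace_carrier]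
        by (simp add: mat_trace_def)
    next
      fix x y assume xy: "x \<in> ?T" "y \<in> ?T"
      then have "\<rho> (x + y) = \<rho> x + \<rho> y" using \<rho> unfolding lie_representation_def by blast
      then have "mat_trace (\<rho> (x + y)) = mat_trace (\<rho> x) + mat_trace (\<rho> y)"
        using c[of x] c[of y] xy by (auto simp: mat_trace_def sum.distrib)
      then show "x + y \<in> ?T" using xy subspace_add[OF subspace_carrier] by auto
    next
      fix a x assume xy: "x \<in> ?T"
      then have "\<rho> (scale a x) = a \<cdot>\<^sub>m \<rho> x" using \<rho> unfolding lie_representation_def by blast
      then have "mat_trace (\<rho> (scale a x)) = a * mat_trace (\<rho> x)"
        using c[of x] xy by (simp add: mat_trace_def sum_distrib_left del: sum_eq_0_iff) (simp add: sum_distrib_left[symmetric])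
      then show "scale a x \<in> ?T" using xy subspace_scale[OF subspace_carrier] by auto
    qed
    fix x y assume xy: "x \<in> L" "y \<in> L"
    have "\<rho> (bracket x y) = \<rho> x * \<rho> y - \<rho> y * \<rho> x" using \<rho> xy unfolding lie_representation_def by blast
    then have "mat_trace (\<rho> (bracket x y)) = mat_trace (\<rho> x * \<rho> y) - mat_trace (\<rho> y * \<rho> x)"
      using c[OF xy(1)] c[OF xy(2)] by (auto simp: mat_trace_def sum_subtractf)
    then show "bracket x y \<in> ?T" using mat_trace_mult_comm[OF c[OF xy(1)] c[OF xy(2)]] bracket_closed[OF xy] by simp
  qed
  then show ?thesis by simp
qed

lemma (in lie_algebra) simple_nonzero:
  assumes "lie_simple scale bracket L"
  obtains x where "x \<in> L" "x \<noteq> 0"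
proof -
  obtain x y where "x \<in> L" "y \<in> L" "bracket x y \<noteq> 0" using assms unfolding lie_simple_def lie_abelian_def by auto
  then show thesis using that bracket_closed by blast
qed

text \<open>A matrix of size at most \<open>1\<close> with trace zero is zero. The constant
  \<open>2\<close> is exactly what the comparison of \<open>dim E + \<mu>\<close> with
  \<open>\<mu> * dim E\<close> needs in the lower bound.\<close>

lemma (in lie_algebra) simple_faithful_dim_ge_2:
  assumes simple: "lie_simple scale bracket L" and \<rho>: "faithful_representation scale bracket L n \<rho>"
  shows "2 \<le> n"
proof (rule ccontr)
  assume "\<not> 2 \<le> n"
  then have n: "n = 0 \<or> n = 1" by auto
  have r: "lie_representation scale bracket L n \<rho>" and inj: "inj_on \<rho> L" using \<rho> unfolding faithful_representation_def by auto
  have c: "\<rho> x \<in> carrier_mat n n" if "x \<in> L" for x using r that unfolding lie_representation_def by blast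
  obtain x where x: "x \<in> L" "x \<noteq> 0" using simple_nonzero[OF simple] .
  have "\<rho> x = 0\<^sub>m n n"
  proof -
    have "\<rho> x $$ (i, j) = 0" if "i < n" "j < n" for i j
    proof -
      have ij: "i = 0" "j = 0" "n = 1" using n that by auto
      have "mat_trace (\<rho> x) = \<rho> x $$ (0, 0)" unfolding mat_trace_def using c[OF x(1)] ij by simp
      then show ?thesis using simple_representation_trace[OF simple r x(1)] ij by simp
    qed
    then show ?thesis using c[OF x(1)] by (auto intro!: eq_matI)
  qed
  then have "\<rho> x = \<rho> 0" using lie_representation_zero[OF vector_space_axioms subspace_carrier r] by simp
  then show False using inj x subspace_0[OF subspace_carrier] unfolding inj_on_def by blast
qed

text \<open>This is the adjoint representation, obtained as the subquotient \<open>L / {0}\<close>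
  under \<open>bracket\<close>; it is nonzero, hence faithful.\<close>

lemma simple_faithful_representation_exists:
  fixes scale :: "complex \<Rightarrow> 'a::ab_group_add \<Rightarrow> 'a"
  assumes L: "lie_algebra scale bracket L" and simple: "lie_simple scale bracket L" and fin: "finite_dim scale L"
  obtains n \<rho> where "faithful_representation scale bracket L n \<rho>"
proof -
  interpret lie_algebra scale bracket L by (rule L)
  interpret sp: space_pair scale scale by unfold_locales
  have "lie_action scale scale bracket L L bracket" 
    unfolding lie_action_def acts_on_def endo_def
  proof (intro conjI ballI allI)
    fix x y v assume xyv: "x \<in> L" "y \<in> L" "v \<in> L"
    have "bracket x (bracket y v) + bracket y (bracket v x) + bracket v (bracket x y) = 0" using jacobi xyv by blast
    moreover have "bracket y (bracket v x) = - bracket y (bracket x v)"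
      using bracket_anticomm[OF xyv(3,1)] bracket_scale_right[OF xyv(2) bracket_closed[OF xyv(1,3)], of "-1"] by simp
    moreover have "bracket v (bracket x y) = - bracket (bracket x y) v"
      using bracket_anticomm[OF xyv(3) bracket_closed[OF xyv(1,2)]] .
    ultimately show "bracket (bracket x y) v = bracket x (bracket y v) - bracket y (bracket x v)"
      by (simp add: algebra_simps)
  qed (use bracket_closed bracket_add_left bracket_add_right bracket_scale_left bracket_scale_right in auto)
  moreover have "bracket x u \<in> {0}" if "x \<in> L" "u \<in> {0}" for x u using that bracket_zero by auto
  moreover have "{0} \<subseteq> L" using subspace_0[OF subspace_carrier] by auto
  ultimately obtain \<rho> where \<rho>: "lie_representation scale bracket L (dim L - dim {0}) \<rho>"
    "\<And>x u. x \<in> L \<Longrightarrow> \<rho> x = 0\<^sub>m (dim L - dim {0}) (dim L - dim {0}) \<Longrightarrow> u \<in> L \<Longrightarrow> bracket x u \<in> {0}"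
    using sp.subquotient_representation[OF fin subspace_single_0] by blast
  obtain x y where "x \<in> L" "y \<in> L" "bracket x y \<noteq> 0" using simple unfolding lie_simple_def lie_abelian_def by auto
  then show thesis using that simple_representation_faithful[OF simple \<rho>(1), of x] \<rho>(2)[of x y] by auto
qed

section \<open>The lower bound\<close>

context space_pair
begin

text \<open>\<open>U1\<close> is minimal among stable subspaces on which \<open>A\<close> acts
  nontrivially, and \<open>U2\<close> is maximal among proper stable subspaces of \<open>U1\<close>.
  Since brackets span \<open>A\<close>, the action on the stable span of \<open>A U1\<close> is
  still nontrivial; by minimality that span is \<open>U1\<close>, so \<open>A U1\<close> cannot lie
  in \<open>U2\<close>.\<close>

lemma nontrivial_subquotient:
  assumes fin: "finite_dim scale V" and B: "\<And>b. b \<in> B \<Longrightarrow> endo scale V b"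
    and A: "lie_algebra gscale bracket A" and simple: "lie_simple gscale bracket A"
    and act: "lie_action gscale scale bracket A V act"
    and comm: "\<And>x. x \<in> A \<Longrightarrow> act x \<in> commutant scale V B"
    and nz: "x0 \<in> A" "v0 \<in> V" "act x0 v0 \<noteq> 0"
  obtains U1 U2 x u where "commutant_subquotient scale V B U1 U2" "x \<in> A" "u \<in> U1" "act x u \<notin> U2"
proof -
  let ?R = "commutant scale V B"
  have sV: "subspace V" using finite_dim_subspace[OF fin] .
  have Re: "endo scale V r" if "r \<in> ?R" for r using that unfolding commutant_def by auto
  have Rc: "(\<lambda>v. r (r' v)) \<in> ?R" if r: "r \<in> ?R" and r': "r' \<in> ?R" for r r'
    using endo_comp[OF Re[OF r] Re[OF r']] endo_mem[OF Re[OF r']] r r' unfolding commutant_def by auto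
  have idR: "(\<lambda>v. v) \<in> ?R" unfolding commutant_def using endo_id by auto
  define P where "P X \<longleftrightarrow> subspace X \<and> X \<subseteq> V \<and> (\<forall>r\<in>?R. \<forall>u\<in>X. r u \<in> X) \<and> (\<exists>x\<in>A. \<exists>u\<in>X. act x u \<noteq> 0)" for X
  have PV: "P V" unfolding P_def using sV endo_mem[OF Re] nz by blast
  have Pfin: "finite_dim scale X" if "P X" for X using that finite_dim_subset[OF fin] unfolding P_def by auto
  obtain U1 where PU: "P U1" and min: "\<And>X. P X \<Longrightarrow> X \<subseteq> U1 \<Longrightarrow> X = U1"
    by (rule finite_dim_minimal[of P, OF PV Pfin]) auto
  have sU1: "subspace U1" and U1V: "U1 \<subseteq> V" and stU1: "\<And>r u. r \<in> ?R \<Longrightarrow> u \<in> U1 \<Longrightarrow> r u \<in> U1"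
    using PU unfolding P_def by auto
  define G where "G = {r (act x u) |r x u. r \<in> ?R \<and> x \<in> A \<and> u \<in> U1}"
  have GI: "r (act x u) \<in> G" if "r \<in> ?R" "x \<in> A" "u \<in> U1" for r x u
    unfolding G_def by (intro CollectI exI[of _ r] exI[of _ x] exI[of _ u]) (use that in auto)
  have GU: "G \<subseteq> U1" unfolding G_def using stU1 comm by auto
  have spanGU: "span G \<subseteq> U1" using span_minimal[OF GU sU1] .
  have actG: "act x u \<in> span G" if "x \<in> A" "u \<in> U1" for x u
    using span_base[OF GI[OF idR that]] .
  have stG: "r w \<in> span G" if r: "r \<in> ?R" and w: "w \<in> span G" for r w
  proof -
    have "span G \<subseteq> {v\<in>V. r v \<in> span G}"
    proof (rule span_minimal)
      show "subspace {v\<in>V. r v \<in> span G}" by (rule subspace_endo_preimage[OF Re[OF r] subspace_span sV])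
      show "G \<subseteq> {v\<in>V. r v \<in> span G}"
      proof
        fix w assume "w \<in> G"
        moreover then obtain r' x u where *: "w = r' (act x u)" "r' \<in> ?R" "x \<in> A" "u \<in> U1" unfolding G_def by blast
        then have "r w \<in> G" using GI[OF Rc[OF r *(2)] *(3,4)] by simp
        ultimately show "w \<in> {v\<in>V. r v \<in> span G}" using GU U1V span_base by auto
      qed
    qed
    then show ?thesis using w by blast
  qed
  have "\<exists>x\<in>A. \<exists>u\<in>span G. act x u \<noteq> 0"
  proof (rule ccontr)
    assume "\<not> ?thesis"
    then have 0: "act x u = 0" if "x \<in> A" "u \<in> span G" for x u using that by blast
    interpret lie_algebra gscale bracket A by (rule A)
    have "x \<in> {x\<in>A. \<forall>v\<in>U1. act x v = 0}" if x: "x \<in> A" for x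
    proof (rule simple_induct[OF simple _ _ x])
      show "g.subspace {x\<in>A. \<forall>v\<in>U1. act x v = 0}"
        by (rule subspace_annihilator[OF lie_action_acts[OF act] subspace_carrier sV U1V])
      fix x y assume xy: "x \<in> A" "y \<in> A"
      have "act (bracket x y) u = 0" if u: "u \<in> U1" for u
        using lie_action_bracket[OF act xy, of u] u U1V 0[OF xy(1) actG[OF xy(2) u]] 0[OF xy(2) actG[OF xy(1) u]] by auto
      then show "bracket x y \<in> {x\<in>A. \<forall>v\<in>U1. act x v = 0}" using bracket_closed[OF xy] by auto
    qed
    moreover obtain x u where "x \<in> A" "u \<in> U1" "act x u \<noteq> 0" using PU unfolding P_def by blast
    ultimately show False by blast
  qed
  then have "P (span G)" unfolding P_def using spanGU U1V stG by blast
  then have G: "span G = U1" using min spanGU by blast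
  define Q where "Q X \<longleftrightarrow> subspace X \<and> X \<subseteq> U1 \<and> X \<noteq> U1 \<and> (\<forall>r\<in>?R. \<forall>u\<in>X. r u \<in> X)" for X
  have "U1 \<noteq> {0}"
  proof
    assume "U1 = {0}"
    moreover obtain x u where "x \<in> A" "u \<in> U1" "act x u \<noteq> 0" using PU unfolding P_def by blast
    ultimately show False using stU1[OF comm] by blast
  qed
  then have Q0: "Q {0}" unfolding Q_def using subspace_0[OF sU1] endo_zero[OF Re sV] by auto
  have Qsub: "subspace X \<and> X \<subseteq> U1" if "Q X" for X using that unfolding Q_def by auto
  obtain U2 where QU: "Q U2" and max: "\<And>X. Q X \<Longrightarrow> U2 \<subseteq> X \<Longrightarrow> X = U2"
    by (rule finite_dim_maximal[of U1 Q, OF Pfin[OF PU] Q0 Qsub]) auto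
  have cs: "commutant_subquotient scale V B U1 U2"
  proof unfold_locales
    show "X = U2 \<or> X = U1" if "subspace X" "U2 \<subseteq> X" "X \<subseteq> U1"
      "\<And>x u. x \<in> ?R \<Longrightarrow> u \<in> X \<Longrightarrow> x u \<in> X" for X
      using max[of X] that unfolding Q_def by blast
  qed (use fin B sU1 U1V stU1 QU in \<open>auto simp: Q_def\<close>)
  have "\<exists>x\<in>A. \<exists>u\<in>U1. act x u \<notin> U2"
  proof (rule ccontr)
    assume "\<not> ?thesis"
    then have "G \<subseteq> U2" using QU unfolding G_def Q_def by blast
    then have "span G \<subseteq> U2" using span_minimal QU unfolding Q_def by blast
    then show False using G QU unfolding Q_def by auto
  qed
  then show thesis using that[OF cs] by blast
qed

text \<open>The representation on the subquotient is nonzero, hence faithful, so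
  \<open>dim U1 - dim U2\<close> is at least \<open>lie_mu\<close> and may be replaced by it in the
  splitting estimate.\<close>

theorem simple_action_splitting:
  assumes fin: "finite_dim scale V" and Bend: "\<forall>b\<in>B. endo scale V b"
    and A: "lie_algebra gscale bracket A" and simple: "lie_simple gscale bracket A"
    and act: "lie_action gscale scale bracket A V act"
    and comm: "\<forall>x\<in>A. \<forall>b\<in>B. \<forall>v\<in>V. act x (b v) = b (act x v)"
    and nz: "x0 \<in> A" "v0 \<in> V" "act x0 v0 \<noteq> 0"
  obtains E E' where "splits V B E E'" "dim E' + lie_mu gscale bracket A * dim E \<le> dim V"
    "2 \<le> lie_mu gscale bracket A"
proof -
  interpret a: lie_algebra gscale bracket A by (rule A)
  have B: "endo scale V b" if "b \<in> B" for b using Bend that by blast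
  have cR: "act x \<in> commutant scale V B" if "x \<in> A" for x
    unfolding commutant_def using acts_on_endo[OF lie_action_acts[OF act] that] comm that by auto
  obtain U1 U2 x u where cs: "commutant_subquotient scale V B U1 U2" and x: "x \<in> A" "u \<in> U1" "act x u \<notin> U2"
    using nontrivial_subquotient[OF fin B A simple act cR nz] by blast
  interpret cs: commutant_subquotient scale V B U1 U2 by (rule cs)
  let ?q = "dim U1 - dim U2"
  have actU: "lie_action gscale scale bracket A U1 act"
    by (rule lie_action_subset[OF act cs.U1_sub]) (use cs.U1_stable cR in blast)
  have st: "act x u \<in> U2" if "x \<in> A" "u \<in> U2" for x u using cs.U2_stable cR that by blast
  obtain \<rho> where \<rho>: "lie_representation gscale bracket A ?q \<rho>"
    "\<And>x u. x \<in> A \<Longrightarrow> \<rho> x = 0\<^sub>m ?q ?q \<Longrightarrow> u \<in> U1 \<Longrightarrow> act x u \<in> U2"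
    using subquotient_representation[OF finite_dim_subset[OF fin cs.sU1 cs.U1_sub] cs.sU2 cs.U2_sub actU st] by blast
  have "\<rho> x \<noteq> 0\<^sub>m ?q ?q" using \<rho>(2)[OF x(1) _ x(2)] x(3) by blast
  then have faithful: "faithful_representation gscale bracket A ?q \<rho>"
    using a.simple_representation_faithful[OF simple \<rho>(1) x(1)] by blast
  have mu: "lie_mu gscale bracket A \<le> ?q" using lie_mu_le[OF faithful] .
  have mu2: "2 \<le> lie_mu gscale bracket A"
    using lie_mu_attained[OF faithful] a.simple_faithful_dim_ge_2[OF simple] by blast
  obtain E E' where E: "splits V B E E'" "dim E' + ?q * dim E \<le> dim V"
    by (fact cs.multiplicity_splitting)
  have "dim E' + lie_mu gscale bracket A * dim E \<le> dim V"
    using E(2) mult_le_mono1[OF mu, of "dim E"] by linarith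
  then show thesis using that[OF E(1) _ mu2] by blast
qed

text \<open>
  Pass from \<open>V\<close> to the multiplicity spaces \<open>E + E'\<close> of one simple ideal. If \<open>E\<close> is a line, then
  the other simple ideals vanish on it and only one dimension of \<open>Z\<close> is lost by dropping it.
\<close>

theorem reductive_action_bound:
  assumes "finite I" "finite_dim scale V" "finite_dim gscale Z"
    and "\<And>i. i \<in> I \<Longrightarrow> lie_algebra gscale bracket (s i)"
    and "\<And>i. i \<in> I \<Longrightarrow> lie_simple gscale bracket (s i)"
    and "\<And>i. i \<in> I \<Longrightarrow> lie_action gscale scale bracket (s i) V act"
    and "\<And>i. i \<in> I \<Longrightarrow> \<exists>x\<in>s i. \<exists>v\<in>V. act x v \<noteq> 0"
    and "acts_on gscale scale Z V act"
    and "\<And>i j x y v. i \<in> I \<Longrightarrow> j \<in> I \<Longrightarrow> i \<noteq> j \<Longrightarrow> x \<in> s i \<Longrightarrow> y \<in> s j \<Longrightarrow> v \<in> V \<Longrightarrow>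
      act x (act y v) = act y (act x v)"
    and "\<And>i x z v. i \<in> I \<Longrightarrow> x \<in> s i \<Longrightarrow> z \<in> Z \<Longrightarrow> v \<in> V \<Longrightarrow> act x (act z v) = act z (act x v)"
    and "\<And>z w v. z \<in> Z \<Longrightarrow> w \<in> Z \<Longrightarrow> v \<in> V \<Longrightarrow> act z (act w v) = act w (act z v)"
    and "\<And>z. z \<in> Z \<Longrightarrow> (\<And>v. v \<in> V \<Longrightarrow> act z v = 0) \<Longrightarrow> z = 0"
  shows "(\<Sum>i\<in>I. lie_mu gscale bracket (s i)) \<le> dim V \<and>
    g.dim Z \<le> card I + comm_bound (dim V - (\<Sum>i\<in>I. lie_mu gscale bracket (s i)))"
  using assms
proof (induction I arbitrary: V Z rule: finite_induct)
  case empty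
  then show ?case using commuting_dim_bound[of V Z act] by simp
next
  case (insert i I)
  note fin = insert.prems(1) and finZ = insert.prems(2) and alg = insert.prems(3) and simple = insert.prems(4)
    and act = insert.prems(5) and nz = insert.prems(6) and actZ = insert.prems(7) and comm = insert.prems(8)
    and commZ = insert.prems(9) and commZZ = insert.prems(10) and faithful = insert.prems(11)
  let ?\<mu> = "\<lambda>i. lie_mu gscale bracket (s i)"
  have sV: "subspace V" using finite_dim_subspace[OF fin] .
  have sZ: "g.subspace Z" using g.finite_dim_subspace[OF finZ] .
  note endZ = acts_on_endo[OF actZ]
  have endS: "endo scale V (act x)" if "j \<in> insert i I" "x \<in> s j" for j x
    using acts_on_endo[OF lie_action_acts[OF act[OF that(1)]] that(2)] .
  \<comment> \<open>The operators that have to survive the step: those of the remaining simple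
    ideals and of the centre.\<close>
  define B where "B = {act x |x. x \<in> (\<Union>j\<in>I. s j) \<union> Z}"
  have BS: "act x \<in> B" if "j \<in> I" "x \<in> s j" for j x using that unfolding B_def by blast
  have BZ: "act z \<in> B" if "z \<in> Z" for z using that unfolding B_def by blast
  have Bend: "endo scale V b" if b: "b \<in> B" for b
  proof -
    obtain x where x: "b = act x" "(\<exists>j\<in>I. x \<in> s j) \<or> x \<in> Z" using b unfolding B_def by blast
    then show ?thesis using endS endZ by blast
  qed
  have Bcomm: "act x (b v) = b (act x v)" if x: "x \<in> s i" and b: "b \<in> B" and v: "v \<in> V" for x b v
  proof -
    obtain y where y: "b = act y" "(\<exists>j\<in>I. y \<in> s j) \<or> y \<in> Z" using b unfolding B_def by blast
    from y(2) show ?thesis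
    proof
      assume "\<exists>j\<in>I. y \<in> s j"
      then obtain j where j: "j \<in> I" "y \<in> s j" by blast
      then have "i \<noteq> j" using insert.hyps by auto
      then show ?thesis unfolding y(1) using comm[of i j x y v] j x v by auto
    next
      assume "y \<in> Z"
      then show ?thesis unfolding y(1) using commZ[of i x y v] x v by auto
    qed
  qed
  have Bend': "\<forall>b\<in>B. endo scale V b"
    and Bcomm': "\<forall>x\<in>s i. \<forall>b\<in>B. \<forall>v\<in>V. act x (b v) = b (act x v)" using Bend Bcomm by blast+
  obtain x0 v0 where x0: "x0 \<in> s i" "v0 \<in> V" "act x0 v0 \<noteq> 0" using nz[of i] by blast
  obtain E E' where EE: "splits V B E E'" and dimE: "dim E' + ?\<mu> i * dim E \<le> dim V" and mu2: "2 \<le> ?\<mu> i"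
    by (fact simple_action_splitting[OF fin Bend' alg[OF insertI1] simple[OF insertI1] act[OF insertI1] Bcomm' x0])
  have E: "subspace E" "E \<subseteq> V" "E \<noteq> {0}" "subspace E'" "E' \<subseteq> V" using EE unfolding splits_def by auto
  have inE: "b v \<in> E" if "b \<in> B" "v \<in> E" for b v using EE that unfolding splits_def by blast
  have inE': "b v \<in> E'" if "b \<in> B" "v \<in> E'" for b v using EE that unfolding splits_def by blast
  have kill: "b v = 0" if "b \<in> B" "\<And>w. w \<in> E \<Longrightarrow> b w = 0" "\<And>w. w \<in> E' \<Longrightarrow> b w = 0" "v \<in> V" for b v
  proof -
    have "(\<forall>w\<in>E. b w = 0) \<longrightarrow> (\<forall>w\<in>E'. b w = 0) \<longrightarrow> (\<forall>v\<in>V. b v = 0)"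
      using EE that(1) unfolding splits_def by blast
    then show ?thesis using that(2-4) by simp
  qed
  have fE: "finite_dim scale E" and fE': "finite_dim scale E'" using finite_dim_subset[OF fin] E by auto
  \<comment> \<open>The induction hypothesis for a stable subspace \<open>W\<close>, where the
    centre may be shrunk to a part that is still faithful on \<open>W\<close>.\<close>
  have step: "(\<Sum>j\<in>I. ?\<mu> j) \<le> dim W \<and> g.dim Z' \<le> card I + comm_bound (dim W - (\<Sum>j\<in>I. ?\<mu> j))"
    if W: "subspace W" "W \<subseteq> V" "\<forall>b\<in>B. \<forall>v\<in>W. b v \<in> W"
      and nzW: "\<forall>j\<in>I. \<exists>x\<in>s j. \<exists>v\<in>W. act x v \<noteq> 0"
      and Z': "g.subspace Z'" "Z' \<subseteq> Z" "\<forall>z\<in>Z'. (\<forall>v\<in>W. act z v = 0) \<longrightarrow> z = 0" for W Z'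
  proof (rule insert.IH)
    show "finite_dim scale W" by (rule finite_dim_subset[OF fin W(1,2)])
    show "finite_dim gscale Z'" by (rule g.finite_dim_subset[OF finZ Z'(1,2)])
    show "lie_algebra gscale bracket (s j)" "lie_simple gscale bracket (s j)" if "j \<in> I" for j
      using alg[of j] simple[of j] that by auto
    show "lie_action gscale scale bracket (s j) W act" if j: "j \<in> I" for j
      by (rule lie_action_subset[OF act W(2)]) (use W(3) BS j in auto)
    show "\<exists>x\<in>s j. \<exists>v\<in>W. act x v \<noteq> 0" if "j \<in> I" for j using nzW that by blast
    show "acts_on gscale scale Z' W act"
      by (rule acts_on_subset[OF actZ Z'(2) W(2)]) (use W(3) BZ Z'(2) in auto)
    show "act x (act y v) = act y (act x v)" if "j \<in> I" "k \<in> I" "j \<noteq> k" "x \<in> s j" "y \<in> s k" "v \<in> W" for j k x y v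
      using comm[of j k x y v] that W(2) by auto
    show "act x (act z v) = act z (act x v)" if "j \<in> I" "x \<in> s j" "z \<in> Z'" "v \<in> W" for j x z v
      using commZ[of j x z v] that W(2) Z'(2) by auto
    show "act z (act w v) = act w (act z v)" if "z \<in> Z'" "w \<in> Z'" "v \<in> W" for z w v
      using commZZ[of z w v] that W(2) Z'(2) by auto
    show "z = 0" if "z \<in> Z'" "\<And>v. v \<in> W \<Longrightarrow> act z v = 0" for z using Z'(3) that by blast
  qed
  have sum: "(\<Sum>j\<in>insert i I. ?\<mu> j) = ?\<mu> i + (\<Sum>j\<in>I. ?\<mu> j)" using insert.hyps by simp
  have card: "card (insert i I) = Suc (card I)" using insert.hyps by simp
  have "0 < dim E" using dim_pos_iff[OF fE] E(3) by simp
  then consider "dim E = 1" | "2 \<le> dim E" by linarith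
  then show ?case
  proof cases
    case 2
    let ?W = "sub_sum E E'"
    have sW: "subspace ?W" by (rule subspace_sub_sum[OF E(1,4)])
    have WV: "?W \<subseteq> V" by (rule sub_sum_minimal[OF E(2,5) sV])
    have EW: "E \<subseteq> ?W" "E' \<subseteq> ?W" using sub_sum_superset[OF E(1,4)] by auto
    have st: "b v \<in> ?W" if b: "b \<in> B" and v: "v \<in> ?W" for b v
    proof -
      obtain e e' where e: "v = e + e'" "e \<in> E" "e' \<in> E'" using v unfolding sub_sum_def by blast
      then have "b v = b e + b e'" using endo_add[OF Bend[OF b], of e e'] E(2,5) by blast
      then show ?thesis using sub_sumI[OF inE[OF b e(2)] inE'[OF b e(3)]] by simp
    qed
    have zero: "b v = 0" if b: "b \<in> B" and 0: "\<And>w. w \<in> ?W \<Longrightarrow> b w = 0" and v: "v \<in> V" for b v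
      by (rule kill[OF b _ _ v]) (use 0 EW in blast)+
    have nzW: "\<forall>j\<in>I. \<exists>x\<in>s j. \<exists>v\<in>?W. act x v \<noteq> 0"
    proof
      fix j assume j: "j \<in> I"
      obtain x v where x: "x \<in> s j" "v \<in> V" "act x v \<noteq> 0" using nz[of j] j by blast
      then show "\<exists>x\<in>s j. \<exists>v\<in>?W. act x v \<noteq> 0" using zero[OF BS[OF j x(1)] _ x(2)] by blast
    qed
    have faithW: "\<forall>z\<in>Z. (\<forall>v\<in>?W. act z v = 0) \<longrightarrow> z = 0"
    proof (intro ballI impI)
      fix z assume z: "z \<in> Z" "\<forall>v\<in>?W. act z v = 0"
      show "z = 0" by (rule faithful[OF z(1)], rule zero[OF BZ[OF z(1)]]) (use z(2) in auto)
    qed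
    have stW: "\<forall>b\<in>B. \<forall>v\<in>?W. b v \<in> ?W" using st by blast
    have *: "(\<Sum>j\<in>I. ?\<mu> j) \<le> dim ?W" "g.dim Z \<le> card I + comm_bound (dim ?W - (\<Sum>j\<in>I. ?\<mu> j))"
      using step[OF sW WV stW nzW sZ order_refl faithW] by blast+
    have "dim ?W \<le> dim E + dim E'" using finite_dim_sub_sum[OF fE fE'] by blast
    \<comment> \<open>Equivalent to \<open>(\<mu> - 1) * (dim E - 1) \<ge> 1\<close>, where both
      factors are at least \<open>1\<close>.\<close>
    also have "dim E + ?\<mu> i \<le> ?\<mu> i * dim E"
    proof -
      have "0 \<le> (int (?\<mu> i) - 1) * (int (dim E) - 1) - 1"
        using mult_mono[of 1 "int (?\<mu> i) - 1" 1 "int (dim E) - 1"] mu2 2 by simp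
      then have "int (dim E + ?\<mu> i) \<le> int (?\<mu> i * dim E)" by (simp add: algebra_simps)
      then show ?thesis by linarith
    qed
    then have "dim E + dim E' + ?\<mu> i \<le> dim V" using dimE by linarith
    finally have d: "dim ?W + ?\<mu> i \<le> dim V" by linarith
    have "comm_bound (dim ?W - (\<Sum>j\<in>I. ?\<mu> j)) \<le> comm_bound (dim V - (\<Sum>j\<in>insert i I. ?\<mu> j))"
      unfolding sum by (rule comm_bound_mono) (use d in linarith)
    then show ?thesis using * d unfolding sum card by linarith
  next
    case 1
    have Zact: "acts_on gscale scale Z E act"
      by (rule acts_on_subset[OF actZ order_refl E(2)]) (use inE BZ in auto)
    obtain e l where e: "e \<in> E" "e \<noteq> 0" "functional_on gscale Z l" "\<And>z. z \<in> Z \<Longrightarrow> act z e = l z *s e"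
      by (rule common_eigenvector[OF fE E(3) Zact sZ]) (use commZZ E(2) in blast)+
    have "span {e} = E"
      by (rule finite_dim_eqI[OF fE])
        (use e 1 span_minimal[of "{e}" E] E(1) dim_span_eq_card_independent[of "{e}"] in auto)
    then have Ee: "\<exists>c. v = c *s e" if "v \<in> E" for v using that span_singleton by auto
    \<comment> \<open>The centre acts on the line through the eigenvalue \<open>l\<close>. The
      kernel of \<open>l\<close> vanishes on \<open>E\<close>, so it remains faithful on
      \<open>E'\<close>, and it has lost at most one dimension.\<close>
    let ?Z = "{z\<in>Z. l z = 0}"
    have Z': "g.subspace ?Z" "g.dim Z \<le> g.dim ?Z + 1" using g.dim_functional_kernel[OF finZ e(3)] by auto
    have ZE: "act z v = 0" if z: "z \<in> ?Z" and v: "v \<in> E" for z v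
    proof -
      obtain c where "v = c *s e" using Ee[OF v] by blast
      then show ?thesis using e(4)[of z] z endo_scale[OF endZ[of z], of e c] e(1) E(2) by auto
    qed
    \<comment> \<open>Operators on a line commute, so brackets of \<open>s j\<close> vanish on
      \<open>E\<close>, and brackets span \<open>s j\<close>.\<close>
    have SE: "act x v = 0" if j: "j \<in> I" and x: "x \<in> s j" and v: "v \<in> E" for j x v
    proof -
      have j': "j \<in> insert i I" using j by simp
      interpret a: lie_algebra gscale bracket "s j" by (rule alg[OF j'])
      have "x \<in> {x\<in>s j. \<forall>v\<in>E. act x v = 0}"
      proof (rule a.simple_induct[OF simple[OF j'] _ _ x])
        show "g.subspace {x\<in>s j. \<forall>v\<in>E. act x v = 0}"
          by (rule subspace_annihilator[OF lie_action_acts[OF act[OF j']] a.subspace_carrier sV E(2)])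
        fix x y assume xy: "x \<in> s j" "y \<in> s j"
        have "act (bracket x y) v = 0" if v: "v \<in> E" for v
        proof -
          have vV: "v \<in> V" and eV: "e \<in> V" using v e(1) E(2) by auto
          obtain c where c: "v = c *s e" using Ee[OF v] by blast
          obtain a where a: "act x e = a *s e" using Ee[OF inE[OF BS[OF j xy(1)] e(1)]] by blast
          obtain b where b: "act y e = b *s e" using Ee[OF inE[OF BS[OF j xy(2)] e(1)]] by blast
          note sx = endo_scale[OF endS[OF j' xy(1)] eV] and sy = endo_scale[OF endS[OF j' xy(2)] eV]
          show ?thesis
            using lie_action_bracket[OF act[OF j'] xy vV] by (simp add: c sx sy a b mult_ac)
        qed
        then show "bracket x y \<in> {x\<in>s j. \<forall>v\<in>E. act x v = 0}" using a.bracket_closed[OF xy] by blast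
      qed
      then show ?thesis using v by blast
    qed
    have nzE: "\<forall>j\<in>I. \<exists>x\<in>s j. \<exists>v\<in>E'. act x v \<noteq> 0"
    proof
      fix j assume j: "j \<in> I"
      obtain x v where x: "x \<in> s j" "v \<in> V" "act x v \<noteq> 0" using nz[of j] j by blast
      then show "\<exists>x\<in>s j. \<exists>v\<in>E'. act x v \<noteq> 0"
        using kill[OF BS[OF j x(1)] _ _ x(2)] SE[OF j x(1)] by blast
    qed
    have faithE: "\<forall>z\<in>?Z. (\<forall>v\<in>E'. act z v = 0) \<longrightarrow> z = 0"
    proof (intro ballI impI)
      fix z assume z: "z \<in> ?Z" "\<forall>v\<in>E'. act z v = 0"
      have zZ: "z \<in> Z" using z by simp
      show "z = 0" by (rule faithful[OF zZ], rule kill[OF BZ[OF zZ] ZE[OF z(1)]]) (use z(2) in auto)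
    qed
    have ZZ: "?Z \<subseteq> Z" by auto
    have stE: "\<forall>b\<in>B. \<forall>v\<in>E'. b v \<in> E'" using inE' by blast
    have *: "(\<Sum>j\<in>I. ?\<mu> j) \<le> dim E'" "g.dim ?Z \<le> card I + comm_bound (dim E' - (\<Sum>j\<in>I. ?\<mu> j))"
      using step[OF E(4,5) stE nzE Z'(1) ZZ faithE] by blast+
    have d: "dim E' + ?\<mu> i \<le> dim V" using dimE 1 by simp
    have "comm_bound (dim E' - (\<Sum>j\<in>I. ?\<mu> j)) \<le> comm_bound (dim V - (\<Sum>j\<in>insert i I. ?\<mu> j))"
      unfolding sum by (rule comm_bound_mono) (use d in linarith)
    then show ?thesis using * d Z'(2) unfolding sum card by linarith
  qed
qed

end

section \<open>Constructing representations\<close>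

lemma lie_representation_carrier: "lie_representation scale bracket L n \<rho> \<Longrightarrow> x \<in> L \<Longrightarrow> \<rho> x \<in> carrier_mat n n"
  and lie_representation_add:
    "lie_representation scale bracket L n \<rho> \<Longrightarrow> x \<in> L \<Longrightarrow> y \<in> L \<Longrightarrow> \<rho> (x + y) = \<rho> x + \<rho> y"
  and lie_representation_scale:
    "lie_representation scale bracket L n \<rho> \<Longrightarrow> x \<in> L \<Longrightarrow> \<rho> (scale c x) = c \<cdot>\<^sub>m \<rho> x"
  and lie_representation_bracket: "lie_representation scale bracket L n \<rho> \<Longrightarrow> x \<in> L \<Longrightarrow> y \<in> L \<Longrightarrow>
    \<rho> (bracket x y) = \<rho> x * \<rho> y - \<rho> y * \<rho> x"
  unfolding lie_representation_def by auto

section \<open>Block sums of representations\<close>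

definition block_diag :: "'k::zero mat \<Rightarrow> 'k mat \<Rightarrow> 'k mat" where
  "block_diag A B = four_block_mat A (0\<^sub>m (dim_row A) (dim_col B)) (0\<^sub>m (dim_row B) (dim_col A)) B"

lemma block_diag_carrier: "A \<in> carrier_mat n n \<Longrightarrow> B \<in> carrier_mat m m \<Longrightarrow> block_diag A B \<in> carrier_mat (n + m) (n + m)"
  unfolding block_diag_def by (intro four_block_carrier_mat) auto

lemma block_diag_add:
  fixes A :: "'k::monoid_add mat"
  assumes "A \<in> carrier_mat n n" "A' \<in> carrier_mat n n" "B \<in> carrier_mat m m" "B' \<in> carrier_mat m m"
  shows "block_diag (A + A') (B + B') = block_diag A B + block_diag A' B'"
  using assms by (intro eq_matI) (auto simp: block_diag_def)

lemma block_diag_minus: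
  fixes A :: "'k::group_add mat"
  assumes "A \<in> carrier_mat n n" "A' \<in> carrier_mat n n" "B \<in> carrier_mat m m" "B' \<in> carrier_mat m m"
  shows "block_diag (A - A') (B - B') = block_diag A B - block_diag A' B'"
  using assms by (intro eq_matI) (auto simp: block_diag_def)

lemma block_diag_smult:
  fixes A :: "'k::semiring_0 mat"
  assumes "A \<in> carrier_mat n n" "B \<in> carrier_mat m m"
  shows "block_diag (c \<cdot>\<^sub>m A) (c \<cdot>\<^sub>m B) = c \<cdot>\<^sub>m block_diag A B"
  using assms by (intro eq_matI) (auto simp: block_diag_def)

lemma block_diag_mult:
  fixes A :: "'k::semiring_1 mat"
  assumes "A \<in> carrier_mat n n" "A' \<in> carrier_mat n n" "B \<in> carrier_mat m m" "B' \<in> carrier_mat m m"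
  shows "block_diag (A * A') (B * B') = block_diag A B * block_diag A' B'"
proof -
  have "block_diag A B * block_diag A' B' = four_block_mat (A * A' + 0\<^sub>m n m * 0\<^sub>m m n) (A * 0\<^sub>m n m + 0\<^sub>m n m * B')
     (0\<^sub>m m n * A' + B * 0\<^sub>m m n) (0\<^sub>m m n * 0\<^sub>m n m + B * B')"
    unfolding block_diag_def using assms by (subst mult_four_block_mat[of _ n n _ m _ m _ _ n _ m]) auto
  also have "\<dots> = block_diag (A * A') (B * B')"
    unfolding block_diag_def using assms by auto
  finally show ?thesis by simp
qed

lemma block_diag_zeroD:
  assumes "A \<in> carrier_mat n n" "B \<in> carrier_mat m m" "block_diag A B = 0\<^sub>m (n + m) (n + m)"
  shows "A = 0\<^sub>m n n" "B = 0\<^sub>m m m"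
proof -
  have e: "block_diag A B $$ (i, j) = 0" if "i < n + m" "j < n + m" for i j
    unfolding assms(3) using that by simp
  show "A = 0\<^sub>m n n"
  proof (rule eq_matI)
    fix i j assume "i < dim_row (0\<^sub>m n n :: 'a mat)" "j < dim_col (0\<^sub>m n n :: 'a mat)"
    then show "A $$ (i, j) = 0\<^sub>m n n $$ (i, j)"
      using e[of i j] assms(1,2) by (simp add: block_diag_def)
  qed (use assms in auto)
  show "B = 0\<^sub>m m m"
  proof (rule eq_matI)
    fix i j assume "i < dim_row (0\<^sub>m m m :: 'a mat)" "j < dim_col (0\<^sub>m m m :: 'a mat)"
    then show "B $$ (i, j) = 0\<^sub>m m m $$ (i, j)"
      using e[of "n + i" "n + j"] assms(1,2) by (simp add: block_diag_def)
  qed (use assms in auto)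
qed

lemma lie_representation_block_diag:
  assumes "lie_algebra scale bracket L"
    and \<sigma>: "lie_representation scale bracket L n \<sigma>" and \<tau>: "lie_representation scale bracket L m \<tau>"
  shows "lie_representation scale bracket L (n + m) (\<lambda>x. block_diag (\<sigma> x) (\<tau> x))"
proof -
  interpret lie_algebra scale bracket L by (rule assms(1))
  note cs = lie_representation_carrier[OF \<sigma>] and ct = lie_representation_carrier[OF \<tau>]
  show ?thesis
    unfolding lie_representation_def
  proof (intro conjI ballI allI)
    show "block_diag (\<sigma> x) (\<tau> x) \<in> carrier_mat (n + m) (n + m)" if "x \<in> L" for x
      by (rule block_diag_carrier[OF cs[OF that] ct[OF that]])
    show "block_diag (\<sigma> (x + y)) (\<tau> (x + y)) = block_diag (\<sigma> x) (\<tau> x) + block_diag (\<sigma> y) (\<tau> y)"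
      if "x \<in> L" "y \<in> L" for x y
      unfolding lie_representation_add[OF \<sigma> that] lie_representation_add[OF \<tau> that]
      by (rule block_diag_add) (use cs ct that in auto)
    show "block_diag (\<sigma> (scale c x)) (\<tau> (scale c x)) = c \<cdot>\<^sub>m block_diag (\<sigma> x) (\<tau> x)" if "x \<in> L" for c x
      unfolding lie_representation_scale[OF \<sigma> that] lie_representation_scale[OF \<tau> that]
      by (rule block_diag_smult) (use cs ct that in auto)
    show "block_diag (\<sigma> (bracket x y)) (\<tau> (bracket x y)) =
      block_diag (\<sigma> x) (\<tau> x) * block_diag (\<sigma> y) (\<tau> y) - block_diag (\<sigma> y) (\<tau> y) * block_diag (\<sigma> x) (\<tau> x)"
      if xy: "x \<in> L" "y \<in> L" for x y
    proof -
      note c = cs[OF xy(1)] cs[OF xy(2)] ct[OF xy(1)] ct[OF xy(2)]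
      note m = block_diag_mult[OF c] block_diag_mult[OF c(2,1,4,3)]
      show ?thesis
        unfolding lie_representation_bracket[OF \<sigma> xy] lie_representation_bracket[OF \<tau> xy] m[symmetric]
        by (rule block_diag_minus) (use c in auto)
    qed
  qed
qed

text \<open>The summands to be used are not faithful on \<open>L\<close> one by one, so the
  conclusion tracks kernels: the kernel of the sum lies in every single kernel.\<close>

lemma direct_sum_representation:
  assumes "finite I" "lie_algebra scale bracket L"
    and "\<And>i. i \<in> I \<Longrightarrow> lie_representation scale bracket L (n i) (\<sigma> i)"
  shows "\<exists>\<rho>. lie_representation scale bracket L (\<Sum>i\<in>I. n i) \<rho> \<and>
    (\<forall>x\<in>L. \<rho> x = 0\<^sub>m (\<Sum>i\<in>I. n i) (\<Sum>i\<in>I. n i) \<longrightarrow> (\<forall>i\<in>I. \<sigma> i x = 0\<^sub>m (n i) (n i)))"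
  using assms
proof (induction I rule: finite_induct)
  case empty
  have "lie_representation scale bracket L 0 (\<lambda>_. 0\<^sub>m 0 0)"
    unfolding lie_representation_def by (auto intro!: eq_matI)
  then show ?case by auto
next
  case (insert i I)
  let ?N = "\<Sum>i\<in>I. n i"
  obtain \<rho> where \<rho>: "lie_representation scale bracket L ?N \<rho>"
    "\<And>x. x \<in> L \<Longrightarrow> \<rho> x = 0\<^sub>m ?N ?N \<Longrightarrow> \<forall>i\<in>I. \<sigma> i x = 0\<^sub>m (n i) (n i)"
    using insert.IH[OF insert.prems(1)] insert.prems(2) by (metis insertCI)
  have \<sigma>: "lie_representation scale bracket L (n i) (\<sigma> i)" using insert.prems(2) by simp
  let ?\<rho> = "\<lambda>x. block_diag (\<sigma> i x) (\<rho> x)"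
  have "lie_representation scale bracket L (n i + ?N) ?\<rho>"
    by (rule lie_representation_block_diag[OF insert.prems(1) \<sigma> \<rho>(1)])
  moreover have "\<forall>j\<in>insert i I. \<sigma> j x = 0\<^sub>m (n j) (n j)"
    if x: "x \<in> L" and 0: "?\<rho> x = 0\<^sub>m (n i + ?N) (n i + ?N)" for x
    using block_diag_zeroD[OF lie_representation_carrier[OF \<sigma> x] lie_representation_carrier[OF \<rho>(1) x] 0] \<rho>(2)[OF x]
    by auto
  ultimately show ?case using insert.hyps by auto
qed

text \<open>The trace separates \<open>\<sigma> (\<pi> x)\<close> from the scalar, so one central dimension is absorbed.\<close>

lemma twisted_representation:
  fixes scale :: "'k::field_char_0 \<Rightarrow> 'a::ab_group_add \<Rightarrow> 'a"
  assumes \<sigma>: "lie_representation scale bracket S n \<sigma>" and n: "0 < n"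
    and tr: "\<And>y. y \<in> S \<Longrightarrow> mat_trace (\<sigma> y) = 0"
    and p: "\<And>x. x \<in> L \<Longrightarrow> p x \<in> S" "\<And>x y. x \<in> L \<Longrightarrow> y \<in> L \<Longrightarrow> p (x + y) = p x + p y"
      "\<And>c x. x \<in> L \<Longrightarrow> p (scale c x) = scale c (p x)"
      "\<And>x y. x \<in> L \<Longrightarrow> y \<in> L \<Longrightarrow> p (bracket x y) = bracket (p x) (p y)"
    and f: "functional_on scale L f" "\<And>x y. x \<in> L \<Longrightarrow> y \<in> L \<Longrightarrow> f (bracket x y) = 0"
  shows "lie_representation scale bracket L n (\<lambda>x. \<sigma> (p x) + f x \<cdot>\<^sub>m 1\<^sub>m n) \<and>
    (\<forall>x\<in>L. \<sigma> (p x) + f x \<cdot>\<^sub>m 1\<^sub>m n = 0\<^sub>m n n \<longrightarrow> \<sigma> (p x) = 0\<^sub>m n n \<and> f x = 0)"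
proof
  have c: "\<sigma> (p x) \<in> carrier_mat n n" if "x \<in> L" for x using lie_representation_carrier[OF \<sigma> p(1)[OF that]] .
  show "lie_representation scale bracket L n (\<lambda>x. \<sigma> (p x) + f x \<cdot>\<^sub>m 1\<^sub>m n)"
    unfolding lie_representation_def
  proof (intro conjI ballI allI)
    show "\<sigma> (p x) + f x \<cdot>\<^sub>m 1\<^sub>m n \<in> carrier_mat n n" if "x \<in> L" for x using c[OF that] by simp
    show "\<sigma> (p (x + y)) + f (x + y) \<cdot>\<^sub>m 1\<^sub>m n = \<sigma> (p x) + f x \<cdot>\<^sub>m 1\<^sub>m n + (\<sigma> (p y) + f y \<cdot>\<^sub>m 1\<^sub>m n)"
      if xy: "x \<in> L" "y \<in> L" for x y
      unfolding p(2)[OF xy] lie_representation_add[OF \<sigma> p(1)[OF xy(1)] p(1)[OF xy(2)]] functional_on_add[OF f(1) xy]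
      using c[OF xy(1)] c[OF xy(2)] by (intro eq_matI) (auto simp: algebra_simps)
    show "\<sigma> (p (scale a x)) + f (scale a x) \<cdot>\<^sub>m 1\<^sub>m n = a \<cdot>\<^sub>m (\<sigma> (p x) + f x \<cdot>\<^sub>m 1\<^sub>m n)"
      if x: "x \<in> L" for a x
      unfolding p(3)[OF x] lie_representation_scale[OF \<sigma> p(1)[OF x]] functional_on_scale[OF f(1) x]
      using c[OF x] by (intro eq_matI) (auto simp: algebra_simps)
    show "\<sigma> (p (bracket x y)) + f (bracket x y) \<cdot>\<^sub>m 1\<^sub>m n =
      (\<sigma> (p x) + f x \<cdot>\<^sub>m 1\<^sub>m n) * (\<sigma> (p y) + f y \<cdot>\<^sub>m 1\<^sub>m n) - (\<sigma> (p y) + f y \<cdot>\<^sub>m 1\<^sub>m n) * (\<sigma> (p x) + f x \<cdot>\<^sub>m 1\<^sub>m n)"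
      if xy: "x \<in> L" "y \<in> L" for x y
    proof -
      let ?A = "\<sigma> (p x)" and ?B = "\<sigma> (p y)"
      note cc = c[OF xy(1)] c[OF xy(2)]
      have m: "(A + a \<cdot>\<^sub>m 1\<^sub>m n) * (B + b \<cdot>\<^sub>m 1\<^sub>m n) = A * B + (b \<cdot>\<^sub>m A + a \<cdot>\<^sub>m B + (a * b) \<cdot>\<^sub>m 1\<^sub>m n)"
        if "A \<in> carrier_mat n n" "B \<in> carrier_mat n n" for A B and a b :: 'k
      proof -
        have s: "A * (b \<cdot>\<^sub>m 1\<^sub>m n) = b \<cdot>\<^sub>m A" "(a \<cdot>\<^sub>m 1\<^sub>m n) * B = a \<cdot>\<^sub>m B"
          "(a \<cdot>\<^sub>m 1\<^sub>m n) * (b \<cdot>\<^sub>m 1\<^sub>m n) = a \<cdot>\<^sub>m (b \<cdot>\<^sub>m (1\<^sub>m n :: 'k mat))"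
          using that mult_smult_distrib[OF that(1) one_carrier_mat] mult_smult_assoc_mat[OF one_carrier_mat that(2)]
            mult_smult_assoc_mat[of "1\<^sub>m n" n n "b \<cdot>\<^sub>m 1\<^sub>m n" n a] by auto
        have "(A + a \<cdot>\<^sub>m 1\<^sub>m n) * (B + b \<cdot>\<^sub>m 1\<^sub>m n) = (A * B + a \<cdot>\<^sub>m B) + (b \<cdot>\<^sub>m A + a \<cdot>\<^sub>m (b \<cdot>\<^sub>m 1\<^sub>m n))"
          using that by (simp add: mult_add_distrib_mat[of _ n n _ n] add_mult_distrib_mat[of _ n n _ _ n] s)
        then show ?thesis using that by (auto intro!: eq_matI simp: algebra_simps)
      qed
      have "\<sigma> (p (bracket x y)) = ?A * ?B - ?B * ?A"
        unfolding p(4)[OF xy] by (rule lie_representation_bracket[OF \<sigma> p(1)[OF xy(1)] p(1)[OF xy(2)]])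
      then show ?thesis unfolding m[OF cc] m[OF cc(2,1)] f(2)[OF xy]
        using cc by (intro eq_matI) (auto simp: algebra_simps simp del: index_mult_mat(1))
    qed
  qed
  show "\<forall>x\<in>L. \<sigma> (p x) + f x \<cdot>\<^sub>m 1\<^sub>m n = 0\<^sub>m n n \<longrightarrow> \<sigma> (p x) = 0\<^sub>m n n \<and> f x = 0"
  proof (intro ballI impI)
    fix x assume x: "x \<in> L" and 0: "\<sigma> (p x) + f x \<cdot>\<^sub>m 1\<^sub>m n = 0\<^sub>m n n"
    have e: "\<sigma> (p x) $$ (i, j) + (if i = j then f x else 0) = 0" if "i < n" "j < n" for i j
      using arg_cong[OF 0, of "\<lambda>M. M $$ (i, j)"] c[OF x] that by (auto split: if_splits)
    \<comment> \<open>A vanishing sum puts \<open>- f x\<close> on the whole diagonal. The trace is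
      zero by assumption, so \<open>n * f x = 0\<close>, and characteristic \<open>0\<close> gives
      \<open>f x = 0\<close>.\<close>
    have "mat_trace (\<sigma> (p x)) = (\<Sum>i<n. - f x)"
    proof -
      have "\<sigma> (p x) $$ (i, i) = - f x" if "i < n" for i using e[OF that that] by (simp add: eq_neg_iff_add_eq_0)
      then show ?thesis unfolding mat_trace_def using c[OF x] by simp
    qed
    then have "of_nat n * f x = 0" using tr[OF p(1)[OF x]] by simp
    then have fx: "f x = 0" using n by simp
    moreover have "\<sigma> (p x) = 0\<^sub>m n n" 
    proof -
      have "\<sigma> (p x) $$ (i, j) = 0" if "i < n" "j < n" for i j using e[OF that] fx by (cases "i = j") simp_all
      then show ?thesis using c[OF x] by (intro eq_matI) auto
    qed
    ultimately show "\<sigma> (p x) = 0\<^sub>m n n \<and> f x = 0" by blast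
  qed
qed

section \<open>Commuting matrices that attain Schur's bound\<close>

definition corner_mat :: "nat \<Rightarrow> nat \<Rightarrow> 'k::zero \<Rightarrow> (nat \<Rightarrow> nat \<Rightarrow> 'k) \<Rightarrow> 'k mat" where
  "corner_mat n p a N = mat n n (\<lambda>(i, j). if i = j then a else if i < p \<and> p \<le> j then N i j else 0)"

text \<open>The product of two off-diagonal blocks is zero, because its inner index would have to be
  both at least \<open>p\<close> and less than \<open>p\<close>.\<close>

lemma corner_mat_commute:
  fixes a :: "'k::comm_ring_1"
  shows "corner_mat n p a N * corner_mat n p b M = corner_mat n p b M * corner_mat n p a N"
proof -
  let ?f = "\<lambda>a N (i, j). if i = j then a else if i < p \<and> p \<le> j then N i j else (0::'k)"
  have "(corner_mat n p a N * corner_mat n p b M) $$ (i, j) =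
      (if i = j then a * b else if i < p \<and> p \<le> j then a * M i j + N i j * b else 0)"
    if ij: "i < n" "j < n" for i j and a b :: 'k and N M
  proof -
    have "(corner_mat n p a N * corner_mat n p b M) $$ (i, j) = (\<Sum>k<n. ?f a N (i, k) * ?f b M (k, j))"
      unfolding corner_mat_def by (rule mat_mult_index[OF ij])
    \<comment> \<open>Only \<open>k = i\<close> and \<open>k = j\<close> contribute. For
      \<open>i = j\<close> the two coincide, and the second term is set to \<open>0\<close> so as
      not to count it twice.\<close>
    also have "\<dots> = (\<Sum>k<n. (if k = i then a * ?f b M (i, j) else 0) + (if k = j then (if i = j then 0 else ?f a N (i, j) * b) else 0))"
      by (rule sum.cong) auto
    also have "\<dots> = a * ?f b M (i, j) + (if i = j then 0 else ?f a N (i, j) * b)"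
      using ij by (simp add: sum.distrib)
    finally show ?thesis by auto
  qed
  note e = this
  have dim: "dim_row (corner_mat n p a N) = n" "dim_col (corner_mat n p a N) = n" for a :: 'k and N
    unfolding corner_mat_def by simp_all
  show ?thesis
    by (rule eq_matI) (auto simp: e mult.commute add.commute dim simp del: index_mult_mat(1))
qed

text \<open>The area of the largest off-diagonal block, which is the quotient occurring in
  \<open>comm_bound\<close>.\<close>

lemma half_mult: "(n div 2) * (n - n div 2) = n\<^sup>2 div (4::nat)"
proof (cases "even n")
  case True
  then obtain m where "n = 2 * m" by auto
  then show ?thesis by (simp add: power2_eq_square)
next
  case False
  then obtain m where m: "n = 2 * m + 1" by (auto elim: oddE)
  have "n\<^sup>2 = 4 * (m * (m + 1)) + 1" unfolding m by (simp add: power2_eq_square algebra_simps)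
  then have "n\<^sup>2 div 4 = m * (m + 1)" by simp
  then show ?thesis using m by (simp add: algebra_simps)
qed

text \<open>Scalars plus an off-diagonal block with \<open>n\<^sup>2 div 4\<close> entries.\<close>

lemma abelian_representation:
  assumes f: "\<And>i. i < m \<Longrightarrow> functional_on scale L (f i)"
      "\<And>i x y. i < m \<Longrightarrow> x \<in> L \<Longrightarrow> y \<in> L \<Longrightarrow> f i (bracket x y) = 0"
    and m: "m \<le> comm_bound n"
  shows "\<exists>\<rho>. lie_representation scale bracket L n \<rho> \<and> (\<forall>x\<in>L. \<rho> x = 0\<^sub>m n n \<longrightarrow> (\<forall>i<m. f i x = 0))"
proof -
  define p where "p = n div 2"
  define q where "q = n - n div 2"
  \<comment> \<open>Padding with \<open>0\<close> covers the block entries left over when there are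
    fewer functionals than places.\<close>
  define h where "h i x = (if i < m then f i x else 0)" for i x
  \<comment> \<open>The functional with index \<open>0\<close> is the scalar; those from index
    \<open>1\<close> on fill the block of width \<open>q\<close> row by row.\<close>
  define \<rho> where "\<rho> x = corner_mat n p (h 0 x) (\<lambda>i j. h (1 + i * q + (j - p)) x)" for x
  have hadd: "h i (x + y) = h i x + h i y" if "x \<in> L" "y \<in> L" for i x y
    using functional_on_add[OF f(1) that] unfolding h_def by auto
  have hscale: "h i (scale c x) = c * h i x" if "x \<in> L" for i c x
    using functional_on_scale[OF f(1) that] unfolding h_def by auto
  have hbr: "h i (bracket x y) = 0" if "x \<in> L" "y \<in> L" for i x y
    using f(2)[OF _ that] unfolding h_def by auto
  have car: "\<rho> x \<in> carrier_mat n n" for x unfolding \<rho>_def corner_mat_def by simp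
  have "lie_representation scale bracket L n \<rho>"
    unfolding lie_representation_def
  proof (intro conjI ballI allI)
    show "\<rho> x \<in> carrier_mat n n" for x by (rule car)
    show "\<rho> (x + y) = \<rho> x + \<rho> y" if "x \<in> L" "y \<in> L" for x y
      unfolding \<rho>_def corner_mat_def hadd[OF that] by (rule eq_matI) auto
    show "\<rho> (scale c x) = c \<cdot>\<^sub>m \<rho> x" if "x \<in> L" for c x
      unfolding \<rho>_def corner_mat_def hscale[OF that] by (rule eq_matI) auto
    show "\<rho> (bracket x y) = \<rho> x * \<rho> y - \<rho> y * \<rho> x" if "x \<in> L" "y \<in> L" for x y
    proof -
      have "\<rho> x * \<rho> y = \<rho> y * \<rho> x" unfolding \<rho>_def by (rule corner_mat_commute)
      then have "\<rho> x * \<rho> y - \<rho> y * \<rho> x = 0\<^sub>m n n" using car[of x] car[of y] by simp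
      moreover have "\<rho> (bracket x y) = 0\<^sub>m n n"
        unfolding \<rho>_def corner_mat_def hbr[OF that] by (rule eq_matI) auto
      ultimately show ?thesis by simp
    qed
  qed
  moreover have "f i x = 0" if x: "x \<in> L" and 0: "\<rho> x = 0\<^sub>m n n" and i: "i < m" for x i
  proof -
    have n: "0 < n" using i m unfolding comm_bound_def by (cases n) auto
    have e: "\<rho> x $$ (a, b) = 0" if "a < n" "b < n" for a b unfolding 0 using that by simp
    show ?thesis
    proof (cases i)
      case 0
      then show ?thesis using e[of 0 0] n i unfolding \<rho>_def corner_mat_def h_def by simp
    next
      case (Suc k)
      have "k < p * q" using Suc i m n unfolding comm_bound_def p_def q_def half_mult by simp
      moreover then have q0: "0 < q" by (cases q) auto
      ultimately have a: "k div q < p" by (simp add: div_less_iff_less_mult)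
      have b: "k mod q < q" using q0 by simp
      have pq: "n = p + q" unfolding p_def q_def by simp
      \<comment> \<open>The place of functional \<open>Suc k\<close> in this filling: row
        \<open>k div q\<close>, and column \<open>k mod q\<close> counted from
        \<open>p\<close>.\<close>
      have "\<rho> x $$ (k div q, p + k mod q) = h (1 + k div q * q + k mod q) x"
        unfolding \<rho>_def corner_mat_def using a b pq by simp
      also have "1 + k div q * q + k mod q = i" using Suc by simp
      finally show ?thesis using e[of "k div q" "p + k mod q"] a b pq i unfolding h_def by simp
    qed
  qed
  ultimately show ?thesis by blast
qed

section \<open>Matrices as operators on coordinate vectors\<close>

interpretation coord: complex_vector_space coord_scale
  by (intro complex_vector_space.intro vector_space_coord_scale)

lemma coord_space_dim:
  "finite_dim coord_scale (coord_space n :: (nat \<Rightarrow> complex) set) \<and>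
   coord.dim (coord_space n) = n"
proof -
  define e :: "nat \<Rightarrow> nat \<Rightarrow> complex" where "e i = (\<lambda>j. if j = i then 1 else 0)" for i
  have inj: "inj_on e {..<n}" unfolding inj_on_def e_def by (metis one_neq_zero)
  have sum: "(\<Sum>i<n. coord_scale (u i) (e i)) j = (if j < n then u j else 0)" for u j
  proof -
    have "(\<Sum>i<n. coord_scale (u i) (e i)) j = (\<Sum>i<n. coord_scale (u i) (e i) j)"
      by (induction n) auto
    also have "\<dots> = (\<Sum>i<n. if j = i then u i else 0)" by (rule sum.cong) (auto simp: coord_scale_def e_def)
    finally show ?thesis by simp
  qed
  have sub: "coord.subspace (coord_space n :: (nat \<Rightarrow> complex) set)"
    by (rule coord.subspaceI) (auto simp: coord_space_def coord_scale_def)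
  have "coord_space n \<subseteq> coord.span (e ` {..<n})"
  proof
    fix v :: "nat \<Rightarrow> complex" assume "v \<in> coord_space n"
    then have "v = (\<Sum>i<n. coord_scale (v i) (e i))"
      using sum[of v] by (auto simp: fun_eq_iff coord_space_def)
    moreover have "\<dots> \<in> coord.span (e ` {..<n})"
      by (intro coord.span_sum coord.span_scale coord.span_base) auto
    ultimately show "v \<in> coord.span (e ` {..<n})" by simp
  qed
  moreover have "coord.span (e ` {..<n}) \<subseteq> coord_space n"
    by (rule coord.span_minimal[OF _ sub]) (auto simp: e_def coord_space_def)
  ultimately have span: "coord_space n = coord.span (e ` {..<n})" by blast
  have "coord.independent (e ` {..<n})"
  proof (rule coord.independent_if_scalars_zero)
    fix u x assume 0: "(\<Sum>x\<in>e ` {..<n}. coord_scale (u x) x) = 0" and x: "x \<in> e ` {..<n}"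
    obtain i where i: "i < n" "x = e i" using x by auto
    have "(\<Sum>i<n. coord_scale (u (e i)) (e i)) = 0"
      using 0 sum.reindex[OF inj, of "\<lambda>x. coord_scale (u x) x"] by (simp add: o_def)
    then show "u x = 0" using sum[of "\<lambda>i. u (e i)" i] i by simp
  qed simp
  then have "coord.dim (coord_space n) = n"
    unfolding span using coord.dim_span_eq_card_independent card_image[OF inj] by simp
  then show ?thesis using span coord.finite_dim_span[of "e ` {..<n}"] by simp
qed

text \<open>Vectors are functions on all naturals, so the result is cut off at \<open>n\<close> in
  order to lie in \<open>coord_space n\<close>.\<close>

definition mat_act :: "nat \<Rightarrow> 'k::semiring_0 mat \<Rightarrow> (nat \<Rightarrow> 'k) \<Rightarrow> nat \<Rightarrow> 'k" where
  "mat_act n M v = (\<lambda>i. if i < n then \<Sum>j<n. M $$ (i, j) * v j else 0)"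

lemma mat_act_mult:
  assumes "M \<in> carrier_mat n n" "N \<in> carrier_mat n n"
  shows "mat_act n (M * N) v = mat_act n M (mat_act n N v)"
proof
  fix i
  show "mat_act n (M * N) v i = mat_act n M (mat_act n N v) i"
  proof (cases "i < n")
    case True
    have "(\<Sum>j<n. (M * N) $$ (i, j) * v j) = (\<Sum>j<n. \<Sum>k<n. M $$ (i, k) * (N $$ (k, j) * v j))"
      using assms True by (auto simp: scalar_prod_def atLeast0LessThan sum_distrib_right mult.assoc intro!: sum.cong)
    also have "\<dots> = (\<Sum>k<n. M $$ (i, k) * (\<Sum>j<n. N $$ (k, j) * v j))"
      by (subst sum.swap) (simp add: sum_distrib_left)
    finally show ?thesis using True by (simp add: mat_act_def)
  qed (simp add: mat_act_def)
qed

text \<open>Passes from matrices to operators, the form in which the lower bound can restrict them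
  to subspaces.\<close>

lemma representation_lie_action:
  assumes \<rho>: "lie_representation scale bracket L n (\<rho> :: _ \<Rightarrow> complex mat)"
    and closed: "\<And>x y. x \<in> L \<Longrightarrow> y \<in> L \<Longrightarrow> bracket x y \<in> L"
  shows "lie_action scale coord_scale bracket L (coord_space n) (\<lambda>x. mat_act n (\<rho> x))"
  unfolding lie_action_def acts_on_def endo_def
proof (intro conjI ballI allI)
  note c = lie_representation_carrier[OF \<rho>]
  fix x assume x: "x \<in> L"
  show "mat_act n (\<rho> x) ` coord_space n \<subseteq> coord_space n" by (auto simp: mat_act_def coord_space_def)
  show "mat_act n (\<rho> x) (v + w) = mat_act n (\<rho> x) v + mat_act n (\<rho> x) w" for v w
    by (auto simp: mat_act_def fun_eq_iff algebra_simps sum.distrib)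
  show "mat_act n (\<rho> x) (coord_scale a v) = coord_scale a (mat_act n (\<rho> x) v)" for a v
    by (auto simp: mat_act_def coord_scale_def fun_eq_iff sum_distrib_left mult_ac intro!: sum.cong)
  show "mat_act n (\<rho> (scale a x)) v = coord_scale a (mat_act n (\<rho> x) v)" for a v
    unfolding lie_representation_scale[OF \<rho> x] using c[OF x]
    by (auto simp: mat_act_def coord_scale_def fun_eq_iff sum_distrib_left mult_ac intro!: sum.cong)
  fix y assume y: "y \<in> L"
  show "mat_act n (\<rho> (x + y)) v = mat_act n (\<rho> x) v + mat_act n (\<rho> y) v" for v
    unfolding lie_representation_add[OF \<rho> x y] using c[OF x] c[OF y]
    by (auto simp: mat_act_def fun_eq_iff algebra_simps sum.distrib[symmetric] intro!: sum.cong)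
  have "mat_act n (A - B) v = mat_act n A v - mat_act n B v" if "A \<in> carrier_mat n n" "B \<in> carrier_mat n n"
    for A B :: "complex mat" and v
    using that by (auto simp: mat_act_def fun_eq_iff left_diff_distrib sum_subtractf)
  then show "mat_act n (\<rho> (bracket x y)) v = mat_act n (\<rho> x) (mat_act n (\<rho> y) v) - mat_act n (\<rho> y) (mat_act n (\<rho> x) v)" for v
    unfolding lie_representation_bracket[OF \<rho> x y] mat_act_mult[OF c[OF x] c[OF y], symmetric]
      mat_act_mult[OF c[OF y] c[OF x], symmetric] using c[OF x] c[OF y] by simp
qed

lemma mat_act_faithful:
  assumes M: "M \<in> carrier_mat n n" and 0: "\<And>v. v \<in> coord_space n \<Longrightarrow> mat_act n M v = 0"
  shows "M = (0\<^sub>m n n :: complex mat)"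
proof -
  have "M $$ (i, j) = 0" if ij: "i < n" "j < n" for i j
  proof -
    let ?e = "\<lambda>k. if k = j then 1 else (0::complex)"
    have "?e \<in> coord_space n" using ij by (auto simp: coord_space_def)
    then have "mat_act n M ?e i = 0" using 0 by (metis zero_fun_apply)
    moreover have "mat_act n M ?e i = (\<Sum>k<n. if k = j then M $$ (i, k) else 0)"
      unfolding mat_act_def using ij by (simp add: if_distrib[of "(*) _"] cong: if_cong)
    ultimately show ?thesis using ij by simp
  qed
  then show ?thesis using M by (intro eq_matI) auto
qed

section \<open>Minimal faithful representations\<close>

lemma (in space_pair) acts_on_zero:
  assumes "acts_on gscale scale Z V act" "g.subspace Z" "v \<in> V"
  shows "act 0 v = 0"
  using acts_on_scale[OF assms(1,3) g.subspace_0[OF assms(2)], of 0] by simp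

lemma commuting_of_bracket_zero:
  fixes act :: "'g::{zero,plus} \<Rightarrow> 'v::ab_group_add \<Rightarrow> 'v"
  assumes "lie_action gscale scale bracket A V act" "x \<in> A" "y \<in> A" "v \<in> V"
    and "bracket x y = 0" "act 0 v = 0"
  shows "act x (act y v) = act y (act x v)"
  using lie_action_bracket[OF assms(1-4)] assms(5,6) by simp

text \<open>Inverts \<open>comm_bound\<close>, so that the least admissible \<open>n\<close> becomes
  a ceiling. For \<open>m = 1\<close> the right side would already hold at \<open>n = 0\<close>,
  whence \<open>2 \<le> m\<close>.\<close>

lemma comm_bound_ge_iff:
  assumes "2 \<le> m"
  shows "m \<le> comm_bound n \<longleftrightarrow> 2 * sqrt (real m - 1) \<le> real n"
proof -
  have "m \<le> comm_bound n \<longleftrightarrow> 4 * (m - 1) \<le> n\<^sup>2"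
  proof (cases "n = 0")
    case True
    then show ?thesis using assms by (simp add: comm_bound_def)
  next
    case False
    have "m \<le> n\<^sup>2 div 4 + 1 \<longleftrightarrow> m - 1 \<le> n\<^sup>2 div 4" using assms by linarith
    also have "\<dots> \<longleftrightarrow> 4 * (m - 1) \<le> n\<^sup>2" by (simp add: less_eq_div_iff_mult_less_eq mult.commute)
    finally show ?thesis using False by (simp add: comm_bound_def)
  qed
  also have "\<dots> \<longleftrightarrow> real (4 * (m - 1)) \<le> real (n\<^sup>2)" by (simp only: of_nat_le_iff)
  also have "\<dots> \<longleftrightarrow> sqrt (4 * (real m - 1)) \<le> real n"
    using assms real_sqrt_le_iff[of "4 * (real m - 1)" "(real n)\<^sup>2"] by (simp add: of_nat_diff)
  also have "sqrt (4 * (real m - 1)) = 2 * sqrt (real m - 1)" unfolding real_sqrt_mult by simp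
  finally show ?thesis .
qed

lemma comm_bound_unbounded: "m \<le> comm_bound (2 * m)"
  by (auto simp: comm_bound_def power2_eq_square intro: le_SucI le_square)

text \<open>Necessity is Schur's bound, sufficiency the corner matrices; both give the same number
  \<open>comm_bound n\<close>.\<close>

lemma abelian_faithful_iff:
  "(\<exists>\<rho>. faithful_representation coord_scale zero_bracket (coord_space m :: (nat \<Rightarrow> complex) set) n \<rho>) \<longleftrightarrow>
    m \<le> comm_bound n"
proof
  interpret lie_algebra coord_scale zero_bracket "coord_space m :: (nat \<Rightarrow> complex) set"
    by (rule lie_algebra_coord_space)
  interpret space_pair coord_scale coord_scale by unfold_locales
  let ?L = "coord_space m :: (nat \<Rightarrow> complex) set"
  {
    assume "\<exists>\<rho>. faithful_representation coord_scale zero_bracket ?L n \<rho>"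
    then obtain \<rho> where \<rho>: "lie_representation coord_scale zero_bracket ?L n \<rho>" and inj: "inj_on \<rho> ?L"
      unfolding faithful_representation_def by blast
    have act: "lie_action coord_scale coord_scale zero_bracket ?L (coord_space n) (\<lambda>x. mat_act n (\<rho> x))"
      by (rule representation_lie_action[OF \<rho> bracket_closed])
    note ac = lie_action_acts[OF act]
    have "coord.dim ?L \<le> comm_bound (coord.dim (coord_space n :: (nat \<Rightarrow> complex) set))"
    proof (rule commuting_dim_bound[OF _ _ ac])
      show "finite_dim coord_scale (coord_space n :: (nat \<Rightarrow> complex) set)" "finite_dim coord_scale ?L"
        using coord_space_dim by blast+
      show "mat_act n (\<rho> z) (mat_act n (\<rho> w) v) = mat_act n (\<rho> w) (mat_act n (\<rho> z) v)"
        if "z \<in> ?L" "w \<in> ?L" "v \<in> coord_space n" for z w v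
      proof (rule commuting_of_bracket_zero[OF act that])
        show "zero_bracket z w = 0" by (simp add: zero_bracket_def)
        show "mat_act n (\<rho> 0) v = 0" by (rule acts_on_zero[OF ac subspace_carrier that(3)])
      qed
      show "z = 0" if z: "z \<in> ?L" and 0: "\<And>v. v \<in> coord_space n \<Longrightarrow> mat_act n (\<rho> z) v = 0" for z
      proof -
        have "\<rho> z = 0\<^sub>m n n" by (rule mat_act_faithful[OF lie_representation_carrier[OF \<rho> z] 0])
        then have "\<rho> z = \<rho> 0" using lie_representation_zero[OF vector_space_coord_scale subspace_carrier \<rho>] by simp
        then show ?thesis using inj z coord.subspace_0[OF subspace_carrier] unfolding inj_on_def by blast
      qed
    qed
    then show "m \<le> comm_bound n" using coord_space_dim by simp
  next
    assume m: "m \<le> comm_bound n"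
    have "\<exists>\<rho>. lie_representation coord_scale zero_bracket ?L n \<rho> \<and>
      (\<forall>x\<in>?L. \<rho> x = 0\<^sub>m n n \<longrightarrow> (\<forall>i<m. x i = 0))"
      by (rule abelian_representation[OF _ _ m])
        (simp_all add: functional_on_def coord_scale_def zero_bracket_def)
    then obtain \<rho> where \<rho>: "lie_representation coord_scale zero_bracket ?L n \<rho>"
      "\<forall>x\<in>?L. \<rho> x = 0\<^sub>m n n \<longrightarrow> (\<forall>i<m. x i = 0)"
      by (elim exE conjE)
    have "faithful_representation coord_scale zero_bracket ?L n \<rho>"
    proof (rule faithful_representationI[OF vector_space_coord_scale subspace_carrier \<rho>(1)])
      fix x assume x: "x \<in> ?L" "\<rho> x = 0\<^sub>m n n"
      have "x i = 0" for i
      proof (cases "i < m")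
        case True
        then show ?thesis using \<rho>(2) x by blast
      next
        case False
        then show ?thesis using x(1) by (simp add: coord_space_def)
      qed
      then show "x = 0" by (auto simp: fun_eq_iff)
    qed
    then show "\<exists>\<rho>. faithful_representation coord_scale zero_bracket ?L n \<rho>" by blast
  }
qed

text \<open>Truncated subtraction matches the convention for nonpositive arguments: if
  \<open>k \<le> l\<close>, the condition on \<open>n\<close> is void and the least \<open>n\<close>
  is \<open>0\<close>.\<close>

lemma mu_complex_abelian_eq:
  "mu_complex_abelian (int k - int l) = (LEAST n. k - l \<le> comm_bound n)"
proof (cases "k \<le> l")
  case True
  then have "(LEAST n. k - l \<le> comm_bound n) = 0" by (intro Least_eq_0) simp
  then show ?thesis using True unfolding mu_complex_abelian_def by simp
next
  case False
  then have "nat (int k - int l) = k - l" by simp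
  then show ?thesis using False unfolding mu_complex_abelian_def lie_mu_def abelian_faithful_iff by simp
qed

text \<open>Monotonicity of \<open>comm_bound\<close> turns the least value into an equivalence. One
  direction provides room for the remaining central dimensions in the upper bound, the other
  converts a dimension count into the lower bound.\<close>

lemma mu_complex_abelian_le_iff: "mu_complex_abelian (int k - int l) \<le> n \<longleftrightarrow> k - l \<le> comm_bound n"
proof -
  have "k - l \<le> comm_bound (mu_complex_abelian (int k - int l))"
    unfolding mu_complex_abelian_eq by (rule LeastI[of "\<lambda>n. k - l \<le> comm_bound n", OF comm_bound_unbounded])
  then show ?thesis
    using comm_bound_mono[of "mu_complex_abelian (int k - int l)" n] Least_le[of "\<lambda>n. k - l \<le> comm_bound n" n]
    unfolding mu_complex_abelian_eq by linarith
qed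

lemma mu_complex_abelian_gt_1:
  assumes "int k - int l > 1"
  shows "int (mu_complex_abelian (int k - int l)) = \<lceil>2 * sqrt (real k - real l - 1)\<rceil>"
proof -
  have m: "2 \<le> k - l" "real (k - l) = real k - real l" using assms by (auto simp: of_nat_diff)
  have iff: "mu_complex_abelian (int k - int l) \<le> n \<longleftrightarrow> 2 * sqrt (real k - real l - 1) \<le> real n" for n
    unfolding mu_complex_abelian_le_iff comm_bound_ge_iff[OF m(1)] m(2) ..
  let ?c = "\<lceil>2 * sqrt (real k - real l - 1)\<rceil>"
  have "0 \<le> real k - real l - 1" using m by linarith
  then have c0: "0 \<le> ?c" by (simp add: order_less_le_trans[of "-1" 0])
  have "2 * sqrt (real k - real l - 1) \<le> real (nat ?c)" using c0 by (simp add: le_of_int_ceiling)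
  then have "mu_complex_abelian (int k - int l) \<le> nat ?c" using iff by blast
  moreover have "2 * sqrt (real k - real l - 1) \<le> real (mu_complex_abelian (int k - int l))" using iff by blast
  then have "?c \<le> int (mu_complex_abelian (int k - int l))" by (simp add: ceiling_le_iff)
  ultimately show ?thesis using c0 by linarith
qed

lemma mu_complex_abelian_1:
  assumes "int k - int l = 1"
  shows "mu_complex_abelian (int k - int l) = 1"
proof -
  have m: "k - l = 1" using assms by linarith
  have "mu_complex_abelian (int k - int l) \<le> n \<longleftrightarrow> 1 \<le> n" for n
    unfolding mu_complex_abelian_le_iff m by (auto simp: comm_bound_def)
  then show ?thesis by (metis le_antisym order_refl)
qed

text \<open>Trades the bijection for component maps with a uniqueness clause, from which linearity
  and compatibility with the bracket will follow.\<close>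

lemma internal_direct_sum_components:
  fixes L :: "'a::ab_group_add set"
  assumes "internal_direct_sum L l V Z"
  obtains p \<zeta> where
    "\<And>x i. x \<in> L \<Longrightarrow> i \<in> {1..l} \<Longrightarrow> p i x \<in> V i" "\<And>x. x \<in> L \<Longrightarrow> \<zeta> x \<in> Z"
    "\<And>x. x \<in> L \<Longrightarrow> x = (\<Sum>i = 1..l. p i x) + \<zeta> x"
    "\<And>x v z. x \<in> L \<Longrightarrow> (\<And>i. i \<in> {1..l} \<Longrightarrow> v i \<in> V i) \<Longrightarrow> z \<in> Z \<Longrightarrow> x = (\<Sum>i = 1..l. v i) + z \<Longrightarrow>
      (\<forall>i\<in>{1..l}. p i x = v i) \<and> \<zeta> x = z"
proof -
  let ?P = "(\<Pi>\<^sub>E i\<in>{1..l}. V i) \<times> Z"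
  let ?f = "\<lambda>(v, z). (\<Sum>i = 1..l. v i) + z"
  have inj: "inj_on ?f ?P" and im: "?f ` ?P = L" using assms unfolding internal_direct_sum_def bij_betw_def by auto
  define d where "d = inv_into ?P ?f"
  have d: "d x \<in> ?P" "?f (d x) = x" if "x \<in> L" for x
    unfolding d_def using that im by (auto intro: inv_into_into f_inv_into_f)
  \<comment> \<open>Members of the extensional product are \<open>undefined\<close> outside the
    index range, so an arbitrary family of components has to be restricted first.\<close>
  have uniq: "d x = (restrict v {1..l}, z)"
    if x: "x \<in> L" "\<And>i. i \<in> {1..l} \<Longrightarrow> v i \<in> V i" "z \<in> Z" "x = (\<Sum>i = 1..l. v i) + z" for x v z
  proof (rule inj_onD[OF inj])
    show "?f (d x) = ?f (restrict v {1..l}, z)" using d(2)[OF x(1)] x(4) by simp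
    show "(restrict v {1..l}, z) \<in> ?P" using x(2,3) by auto
  qed (rule d(1)[OF x(1)])
  show thesis
  proof (rule that[of "\<lambda>i x. fst (d x) i" "\<lambda>x. snd (d x)"])
    show "fst (d x) i \<in> V i" if "x \<in> L" "i \<in> {1..l}" for x i using d(1)[OF that(1)] that(2) by (auto simp: mem_Times_iff)
    show "snd (d x) \<in> Z" if "x \<in> L" for x using d(1)[OF that] by (auto simp: mem_Times_iff)
    show "x = (\<Sum>i = 1..l. fst (d x) i) + snd (d x)" if "x \<in> L" for x
      using d(2)[OF that] by (simp add: case_prod_beta)
    show "(\<forall>i\<in>{1..l}. fst (d x) i = v i) \<and> snd (d x) = z"
      if "x \<in> L" "\<And>i. i \<in> {1..l} \<Longrightarrow> v i \<in> V i" "z \<in> Z" "x = (\<Sum>i = 1..l. v i) + z" for x v z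
      using uniq[OF that] by simp
  qed
qed

theorem theorem1p4:
  fixes scale :: "complex \<Rightarrow> 'a::ab_group_add \<Rightarrow> 'a"
    and bracket :: "'a \<Rightarrow> 'a \<Rightarrow> 'a"
    and g :: "'a set"
    and s :: "nat \<Rightarrow> 'a set"
    and l k :: nat
  assumes "lie_algebra scale bracket g"
    and "finite_dim scale g"
    and "lie_reductive scale bracket g"
    and "\<And>i. i \<in> {1..l} \<Longrightarrow> lie_ideal scale bracket g (s i)"
    and "\<And>i. i \<in> {1..l} \<Longrightarrow> lie_simple scale bracket (s i)"
    and "vector_space.dim scale (lie_center bracket g) = k"
    and "internal_direct_sum g l s (lie_center bracket g)"
  shows "lie_mu scale bracket g =
           (\<Sum>i = 1..l. lie_mu scale bracket (s i)) + mu_complex_abelian (int k - int l)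
       \<and> (int k - int l > 1 \<longrightarrow>
            int (mu_complex_abelian (int k - int l)) = \<lceil>2 * sqrt (real k - real l - 1)\<rceil>)
       \<and> (int k - int l = 1 \<longrightarrow> mu_complex_abelian (int k - int l) = 1)
       \<and> (int k - int l \<le> 0 \<longrightarrow> mu_complex_abelian (int k - int l) = 0)"
proof -
  interpret lie_algebra scale bracket g by (rule assms(1))
  interpret sp: space_pair coord_scale scale by unfold_locales
  note fin = assms(2) and ideal = assms(4) and simple = assms(5) and dimZ = assms(6)
  let ?Z = "lie_center bracket g"
  let ?\<mu> = "\<lambda>i. lie_mu scale bracket (s i)"
  let ?N = "mu_complex_abelian (int k - int l)"
  have alg: "lie_algebra scale bracket (s i)" if "i \<in> {1..l}" for i
    by (rule lie_ideal_lie_algebra[OF assms(1) ideal[OF that]])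
  have ss: "subspace (s i)" "s i \<subseteq> g" if "i \<in> {1..l}" for i
    using ideal[OF that] unfolding lie_ideal_def by auto
  have sZ: "subspace ?Z"
    by (rule subspaceI)
      (use subspace_carrier bracket_zero bracket_add_left bracket_scale_left in
        \<open>auto simp: lie_center_def subspace_0 subspace_add subspace_scale\<close>)
  have Zg: "?Z \<subseteq> g" unfolding lie_center_def by auto
  have finZ: "finite_dim scale ?Z" by (rule finite_dim_subset[OF fin sZ Zg])
  have Zl: "bracket z x = 0" and Zr: "bracket x z = 0" if "z \<in> ?Z" "x \<in> g" for x z
    using that bracket_anticomm[of x z] unfolding lie_center_def by auto
  obtain p \<zeta> where p: "\<And>x i. x \<in> g \<Longrightarrow> i \<in> {1..l} \<Longrightarrow> p i x \<in> s i" "\<And>x. x \<in> g \<Longrightarrow> \<zeta> x \<in> ?Z"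
    "\<And>x. x \<in> g \<Longrightarrow> x = (\<Sum>i = 1..l. p i x) + \<zeta> x"
    "\<And>x v z. x \<in> g \<Longrightarrow> (\<And>i. i \<in> {1..l} \<Longrightarrow> v i \<in> s i) \<Longrightarrow> z \<in> ?Z \<Longrightarrow> x = (\<Sum>i = 1..l. v i) + z \<Longrightarrow>
      (\<forall>i\<in>{1..l}. p i x = v i) \<and> \<zeta> x = z"
    by (fact internal_direct_sum_components[OF assms(7)])
  \<comment> \<open>The bracket lies in both ideals. Placing it in either summand gives two
    decompositions of the same vector, and uniqueness forces it to be \<open>0\<close>.\<close>
  have cross: "bracket a b = 0" if ij: "i \<in> {1..l}" "j \<in> {1..l}" "i \<noteq> j" and a: "a \<in> s i" and b: "b \<in> s j" for i j a b
  proof -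
    let ?w = "bracket a b"
    have ag: "a \<in> g" and bg: "b \<in> g" using ss a b ij by auto
    have wj: "?w \<in> s j" using ideal[OF ij(2)] ag b unfolding lie_ideal_def by blast
    have "bracket b a \<in> s i" using ideal[OF ij(1)] bg a unfolding lie_ideal_def by blast
    then have wi: "?w \<in> s i" using bracket_anticomm[OF ag bg] subspace_neg[OF ss(1)[OF ij(1)]] by simp
    have wg: "?w \<in> g" using bracket_closed[OF ag bg] .
    have one: "p i ?w = (if i = m then ?w else 0)" if m: "m \<in> {1..l}" "?w \<in> s m" for m
    proof -
      have "(if n = m then ?w else 0) \<in> s n" if "n \<in> {1..l}" for n using m subspace_0[OF ss(1)[OF that]] by auto
      moreover have "?w = (\<Sum>n = 1..l. if n = m then ?w else 0) + 0" using m by simp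
      ultimately show ?thesis
        using p(4)[OF wg, of "\<lambda>n. if n = m then ?w else 0" 0] subspace_0[OF sZ] ij(1) by simp
    qed
    show ?thesis using one[OF ij(1) wi] one[OF ij(2) wj] ij(3) by simp
  qed
  have addD: "x + y \<in> g" "\<And>i. i \<in> {1..l} \<Longrightarrow> p i x + p i y \<in> s i" "\<zeta> x + \<zeta> y \<in> ?Z"
      "x + y = (\<Sum>i = 1..l. p i x + p i y) + (\<zeta> x + \<zeta> y)" if xy: "x \<in> g" "y \<in> g" for x y
  proof -
    show "x + y \<in> g" by (rule subspace_add[OF subspace_carrier xy])
    show "p i x + p i y \<in> s i" if "i \<in> {1..l}" for i
      using subspace_add[OF ss(1)[OF that] p(1)[OF xy(1) that] p(1)[OF xy(2) that]] .
    show "\<zeta> x + \<zeta> y \<in> ?Z" using subspace_add[OF sZ p(2)[OF xy(1)] p(2)[OF xy(2)]] .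
    show "x + y = (\<Sum>i = 1..l. p i x + p i y) + (\<zeta> x + \<zeta> y)"
      by (subst p(3)[OF xy(1)], subst p(3)[OF xy(2)]) (simp add: sum.distrib algebra_simps)
  qed
  have add: "(\<forall>i\<in>{1..l}. p i (x + y) = p i x + p i y) \<and> \<zeta> (x + y) = \<zeta> x + \<zeta> y" if "x \<in> g" "y \<in> g" for x y
    by (rule p(4)[OF addD[OF that]])
  have scaleD: "scale c x \<in> g" "\<And>i. i \<in> {1..l} \<Longrightarrow> scale c (p i x) \<in> s i" "scale c (\<zeta> x) \<in> ?Z"
      "scale c x = (\<Sum>i = 1..l. scale c (p i x)) + scale c (\<zeta> x)" if x: "x \<in> g" for c x
  proof -
    show "scale c x \<in> g" by (rule subspace_scale[OF subspace_carrier x])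
    show "scale c (p i x) \<in> s i" if "i \<in> {1..l}" for i
      using subspace_scale[OF ss(1)[OF that] p(1)[OF x that]] .
    show "scale c (\<zeta> x) \<in> ?Z" using subspace_scale[OF sZ p(2)[OF x]] .
    show "scale c x = (\<Sum>i = 1..l. scale c (p i x)) + scale c (\<zeta> x)"
      using arg_cong[OF p(3)[OF x], of "scale c"] by (simp add: scale_right_distrib scale_sum_right)
  qed
  have scale: "(\<forall>i\<in>{1..l}. p i (scale c x) = scale c (p i x)) \<and> \<zeta> (scale c x) = scale c (\<zeta> x)" if "x \<in> g" for c x
    by (rule p(4)[OF scaleD[OF that]])
  have br_right: "endo scale g (bracket x)" if "x \<in> g" for x
    unfolding endo_def using that bracket_closed bracket_add_right bracket_scale_right by auto
  have br_left: "endo scale g (\<lambda>y. bracket y x)" if "x \<in> g" for x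
    unfolding endo_def using that bracket_closed bracket_add_left bracket_scale_left by auto
  have br_dec: "bracket x y = (\<Sum>i = 1..l. bracket (p i x) (p i y)) + 0" if xy: "x \<in> g" "y \<in> g" for x y
  proof -
    have pg: "p i z \<in> g" if "z \<in> g" "i \<in> {1..l}" for z i using p(1)[OF that] ss that by blast
    have sg: "(\<Sum>i = 1..l. p i z) \<in> g" if "z \<in> g" for z by (rule subspace_sum[OF subspace_carrier]) (rule pg[OF that])
    have \<zeta>g: "\<zeta> z \<in> g" if "z \<in> g" for z using p(2)[OF that] Zg by blast
    have "bracket x y = bracket ((\<Sum>i = 1..l. p i x) + \<zeta> x) y" using p(3)[OF xy(1)] by simp
    also have "\<dots> = bracket (\<Sum>i = 1..l. p i x) y"
      using bracket_add_left[OF sg[OF xy(1)] \<zeta>g[OF xy(1)] xy(2)] Zl[OF p(2)[OF xy(1)] xy(2)] by simp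
    also have "\<dots> = (\<Sum>i = 1..l. bracket (p i x) y)"
      by (rule endo_sum[OF br_left[OF xy(2)] subspace_carrier]) (rule pg[OF xy(1)])
    also have "\<dots> = (\<Sum>i = 1..l. bracket (p i x) (p i y))"
    proof (rule sum.cong[OF refl])
      fix i assume i: "i \<in> {1..l}"
      have "bracket (p i x) y = bracket (p i x) ((\<Sum>j = 1..l. p j y) + \<zeta> y)" using p(3)[OF xy(2)] by simp
      also have "\<dots> = bracket (p i x) (\<Sum>j = 1..l. p j y)"
        using bracket_add_right[OF pg[OF xy(1) i] sg[OF xy(2)] \<zeta>g[OF xy(2)]] Zr[OF p(2)[OF xy(2)] pg[OF xy(1) i]] by simp
      also have "\<dots> = (\<Sum>j = 1..l. bracket (p i x) (p j y))"
        by (rule endo_sum[OF br_right[OF pg[OF xy(1) i]] subspace_carrier]) (rule pg[OF xy(2)])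
      also have "\<dots> = (\<Sum>j = 1..l. if j = i then bracket (p i x) (p i y) else 0)"
        by (rule sum.cong[OF refl]) (use cross[OF i] p(1) xy i in auto)
      finally show "bracket (p i x) y = bracket (p i x) (p i y)" using i by simp
    qed
    finally show ?thesis by simp
  qed
  have brD: "bracket x y \<in> g" "\<And>i. i \<in> {1..l} \<Longrightarrow> bracket (p i x) (p i y) \<in> s i" "0 \<in> ?Z" if xy: "x \<in> g" "y \<in> g" for x y
    using bracket_closed[OF xy] lie_algebra.bracket_closed[OF alg] p(1)[OF xy(1)] p(1)[OF xy(2)] subspace_0[OF sZ] by auto
  have br: "(\<forall>i\<in>{1..l}. p i (bracket x y) = bracket (p i x) (p i y)) \<and> \<zeta> (bracket x y) = 0"
    if "x \<in> g" "y \<in> g" for x y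
    by (rule p(4)[OF brD[OF that] br_dec[OF that]])
  \<comment> \<open>Coordinates modulo \<open>{0}\<close>: a basis \<open>b\<close> of the centre
    with its coordinate functionals.\<close>
  obtain q b \<kappa> where \<kappa>: "q + dim {0} = dim ?Z" "\<And>i. i < q \<Longrightarrow> b i \<in> ?Z"
      "\<And>i. i < q \<Longrightarrow> functional_on scale ?Z (\<kappa> i)" "\<And>i t. i < q \<Longrightarrow> t \<in> {0} \<Longrightarrow> \<kappa> i t = 0"
      "\<And>x. x \<in> ?Z \<Longrightarrow> x - (\<Sum>i<q. scale (\<kappa> i x) (b i)) \<in> {0}"
    using quotient_coordinates[OF finZ subspace_single_0] subspace_0[OF sZ] by blast
  have qk: "q = k" using \<kappa>(1) dimZ dim_zero_singleton by simp
  \<comment> \<open>Extension by \<open>0\<close> beyond \<open>k\<close> gives every simple ideal a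
    functional even when \<open>k < l\<close>.\<close>
  define f where "f i x = (if i < k then \<kappa> i (\<zeta> x) else 0)" for i x
  have f_lin: "functional_on scale g (f i)" for i
    unfolding functional_on_def f_def
    using functional_on_add[OF \<kappa>(3)] functional_on_scale[OF \<kappa>(3)] p(2) add scale qk by auto
  have f_br: "f i (bracket x y) = 0" if "x \<in> g" "y \<in> g" for i x y
    unfolding f_def using br[OF that] \<kappa>(4) qk by simp
  have f_inj: "\<zeta> x = 0" if x: "x \<in> g" and 0: "\<And>i. i < k \<Longrightarrow> f i x = 0" for x
  proof -
    have "(\<Sum>i<q. scale (\<kappa> i (\<zeta> x)) (b i)) = 0" by (rule sum.neutral) (use 0 qk in \<open>auto simp: f_def\<close>)
    then show ?thesis using \<kappa>(5)[OF p(2)[OF x]] by simp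
  qed
  have ex_faith: "\<exists>\<sigma>. faithful_representation scale bracket (s i) (?\<mu> i) \<sigma>" if i: "i \<in> {1..l}" for i
    using simple_faithful_representation_exists[OF alg[OF i] simple[OF i] finite_dim_subset[OF fin ss[OF i]]]
      lie_mu_attained by metis
  then obtain \<sigma> where \<sigma>: "\<And>i. i \<in> {1..l} \<Longrightarrow> faithful_representation scale bracket (s i) (?\<mu> i) (\<sigma> i)" by metis
  have \<sigma>r: "lie_representation scale bracket (s i) (?\<mu> i) (\<sigma> i)" "inj_on (\<sigma> i) (s i)" if "i \<in> {1..l}" for i
    using \<sigma>[OF that] unfolding faithful_representation_def by auto
  have \<mu>pos: "0 < ?\<mu> i" if i: "i \<in> {1..l}" for i
    using lie_algebra.simple_faithful_dim_ge_2[OF alg[OF i] simple[OF i] \<sigma>[OF i]] by simp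
  \<comment> \<open>Ideals are numbered from \<open>1\<close> and functionals from \<open>0\<close>,
    hence \<open>i - 1\<close>. The ideals use up the first \<open>l\<close> functionals, and those
    of the form \<open>f (l + i)\<close> are left for the abelian block.\<close>
  define \<tau> where "\<tau> i x = \<sigma> i (p i x) + f (i - 1) x \<cdot>\<^sub>m 1\<^sub>m (?\<mu> i)" for i x
  have \<tau>: "lie_representation scale bracket g (?\<mu> i) (\<tau> i) \<and>
    (\<forall>x\<in>g. \<tau> i x = 0\<^sub>m (?\<mu> i) (?\<mu> i) \<longrightarrow> \<sigma> i (p i x) = 0\<^sub>m (?\<mu> i) (?\<mu> i) \<and> f (i - 1) x = 0)" if i: "i \<in> {1..l}" for i
    unfolding \<tau>_def
  proof (rule twisted_representation[OF \<sigma>r(1)[OF i] \<mu>pos[OF i]])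
    show "mat_trace (\<sigma> i y) = 0" if "y \<in> s i" for y
      by (rule lie_algebra.simple_representation_trace[OF alg[OF i] simple[OF i] \<sigma>r(1)[OF i] that])
  qed (use p(1) add scale br f_lin f_br i in auto)
  have "k - l \<le> comm_bound ?N" using mu_complex_abelian_le_iff by blast
  then obtain \<alpha> where \<alpha>: "lie_representation scale bracket g ?N \<alpha>"
    "\<And>x. x \<in> g \<Longrightarrow> \<alpha> x = 0\<^sub>m ?N ?N \<Longrightarrow> \<forall>i<k - l. f (l + i) x = 0"
    using abelian_representation[of "k - l" scale g "\<lambda>i. f (l + i)" bracket ?N] f_lin f_br by blast
  let ?S = "\<Sum>i = 1..l. ?\<mu> i"
  obtain \<beta> where \<beta>: "lie_representation scale bracket g ?S \<beta>"
    "\<And>x. x \<in> g \<Longrightarrow> \<beta> x = 0\<^sub>m ?S ?S \<Longrightarrow> \<forall>i\<in>{1..l}. \<tau> i x = 0\<^sub>m (?\<mu> i) (?\<mu> i)"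
    using direct_sum_representation[OF _ assms(1), of "{1..l}" ?\<mu> \<tau>] \<tau> by auto
  have upper: "faithful_representation scale bracket g (?S + ?N) (\<lambda>x. block_diag (\<beta> x) (\<alpha> x))"
  proof (rule faithful_representationI[OF vector_space_axioms subspace_carrier lie_representation_block_diag[OF assms(1) \<beta>(1) \<alpha>(1)]])
    fix x assume x: "x \<in> g" and 0: "block_diag (\<beta> x) (\<alpha> x) = 0\<^sub>m (?S + ?N) (?S + ?N)"
    note z = block_diag_zeroD[OF lie_representation_carrier[OF \<beta>(1) x] lie_representation_carrier[OF \<alpha>(1) x] 0]
    have t: "\<sigma> i (p i x) = 0\<^sub>m (?\<mu> i) (?\<mu> i)" "f (i - 1) x = 0" if i: "i \<in> {1..l}" for i
      using \<tau>[OF i] \<beta>(2)[OF x z(1)] x i by auto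
    have "p i x = 0" if i: "i \<in> {1..l}" for i
    proof -
      have "\<sigma> i (p i x) = \<sigma> i 0"
        using t(1)[OF i] lie_representation_zero[OF vector_space_axioms ss(1)[OF i] \<sigma>r(1)[OF i]] by simp
      then show ?thesis using \<sigma>r(2)[OF i] p(1)[OF x i] subspace_0[OF ss(1)[OF i]] unfolding inj_on_def by blast
    qed
    moreover have "\<zeta> x = 0"
    proof (rule f_inj[OF x])
      fix i assume i: "i < k"
      show "f i x = 0"
      proof (cases "i < l")
        case True
        then show ?thesis using t(2)[of "Suc i"] by simp
      next
        case False
        then have "i - l < k - l" "l + (i - l) = i" using i by auto
        then show ?thesis using \<alpha>(2)[OF x z(2)] by metis
      qed
    qed
    ultimately show "x = 0" using p(3)[OF x] by simp
  qed
  have lower: "?S + ?N \<le> n" if \<rho>: "faithful_representation scale bracket g n \<rho>" for n \<rho>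
  proof -
    have r: "lie_representation scale bracket g n \<rho>" and inj: "inj_on \<rho> g"
      using \<rho> unfolding faithful_representation_def by auto
    let ?V = "coord_space n :: (nat \<Rightarrow> complex) set"
    let ?a = "\<lambda>x. mat_act n (\<rho> x)"
    have act: "lie_action scale coord_scale bracket g ?V ?a" by (rule representation_lie_action[OF r bracket_closed])
    note ac = lie_action_acts[OF act]
    have faith: "x = 0" if x: "x \<in> g" and 0: "\<And>v. v \<in> ?V \<Longrightarrow> ?a x v = 0" for x
    proof -
      have "\<rho> x = 0\<^sub>m n n" by (rule mat_act_faithful[OF lie_representation_carrier[OF r x] 0])
      then have "\<rho> x = \<rho> 0" using lie_representation_zero[OF vector_space_axioms subspace_carrier r] by simp
      then show ?thesis using inj x subspace_0[OF subspace_carrier] unfolding inj_on_def by blast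
    qed
    have comm: "?a x (?a y v) = ?a y (?a x v)" if "x \<in> g" "y \<in> g" "v \<in> ?V" "bracket x y = 0" for x y v
      by (rule commuting_of_bracket_zero[OF act that sp.acts_on_zero[OF ac subspace_carrier that(3)]])
    have V: "finite_dim coord_scale ?V" "coord.dim ?V = n" using coord_space_dim by auto
    have "(\<Sum>i\<in>{1..l}. ?\<mu> i) \<le> coord.dim ?V \<and>
      dim ?Z \<le> card {1..l} + comm_bound (coord.dim ?V - (\<Sum>i\<in>{1..l}. ?\<mu> i))"
    proof (rule sp.reductive_action_bound)
      show "finite {1..l}" by simp
      show "finite_dim coord_scale ?V" by (rule V)
      show "finite_dim scale ?Z" by (rule finZ)
      show "lie_algebra scale bracket (s i)" "lie_simple scale bracket (s i)" if "i \<in> {1..l}" for i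
        using alg simple that by auto
      show "lie_action scale coord_scale bracket (s i) ?V ?a" if "i \<in> {1..l}" for i
        using act ss(2)[OF that] unfolding lie_action_def acts_on_def by blast
      show "\<exists>x\<in>s i. \<exists>v\<in>?V. ?a x v \<noteq> 0" if i: "i \<in> {1..l}" for i
      proof -
        obtain x where "x \<in> s i" "x \<noteq> 0" using lie_algebra.simple_nonzero[OF alg[OF i] simple[OF i]] .
        then show ?thesis using faith[of x] ss(2)[OF i] by blast
      qed
      show "acts_on scale coord_scale ?Z ?V ?a"
        using ac Zg unfolding acts_on_def by blast
      show "?a x (?a y v) = ?a y (?a x v)"
        if "i \<in> {1..l}" "j \<in> {1..l}" "i \<noteq> j" "x \<in> s i" "y \<in> s j" "v \<in> ?V" for i j x y v
        using comm[of x y v] cross[OF that(1-5)] ss that by blast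
      show "?a x (?a z v) = ?a z (?a x v)" if "i \<in> {1..l}" "x \<in> s i" "z \<in> ?Z" "v \<in> ?V" for i x z v
        using comm[of x z v] Zr[of z x] ss that Zg by blast
      show "?a z (?a w v) = ?a w (?a z v)" if "z \<in> ?Z" "w \<in> ?Z" "v \<in> ?V" for z w v
        using comm[of z w v] Zl[of z w] that Zg by blast
      show "z = 0" if "z \<in> ?Z" "\<And>v. v \<in> ?V \<Longrightarrow> ?a z v = 0" for z
        using faith[of z] that Zg by blast
    qed
    \<comment> \<open>The first inequality makes the truncated difference \<open>n - ?S\<close>
      exact, so that a bound on \<open>?N\<close> by this difference yields
      \<open>?S + ?N \<le> n\<close>.\<close>
    then have *: "?S \<le> n" "k \<le> l + comm_bound (n - ?S)" unfolding V(2) dimZ by auto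
    then have "?N \<le> n - ?S" unfolding mu_complex_abelian_le_iff by linarith
    then show ?thesis using *(1) by linarith
  qed
  have "lie_mu scale bracket g = ?S + ?N"
    unfolding lie_mu_def[of scale bracket g] by (rule Least_equality) (use upper lower in blast)+
  moreover have "int k - int l \<le> 0 \<longrightarrow> ?N = 0" by (simp add: mu_complex_abelian_def)
  ultimately show ?thesis using mu_complex_abelian_gt_1 mu_complex_abelian_1 by blast
qed

end
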